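(* Let $\eta,\kappa\in\mathbb{Z}_+\cup\{\infty\}$ with $\eta\ge2$, and let $\{\gamma_n\}_{n=-\kappa}^\infty$, $\nu$, $\rho$, $\{\Omega_i\}_{i\in J_\eta}$, $\{\mu_{i,1}\}_{i\in J_\eta}$, $\boldsymbol\lambda=\{\lambda_v\}_{v\in V_{\eta,\kappa}^\circ}$ and the weighted shift $S_{\boldsymbol\lambda}$ on the directed tree $\mathcal{T}_{\eta,\kappa}$ be as described in the context. Then the following assertions hold. (i) $e_u\in\mathcal{D}^\infty(S_{\boldsymbol\lambda})$ for every $u\in V_{\eta,\kappa}$ (equivalently, the linear span of $\{e_u\colon u\in V_{\eta,\kappa}\}$ is contained in $\mathcal{D}^\infty(S_{\boldsymbol\lambda})$). (ii) $\{\|S_{\boldsymbol\lambda}^nf\|^2\}_{n=0}^\infty$ is a Stieltjes moment sequence for every $f\in\mathcal{D}^\infty(S_{\boldsymbol\lambda})$. (iii) $S_{\boldsymbol\lambda}$ is paranormal. (iv) The consistency condition at $u=0$, i.e., $\sum_{i\in J_\eta}\lambda_{i,1}^2\int_0^\infty\frac1x\,d\mu_{i,1}(x)\le1$, holds if and only if $\int_0^\infty\frac1x\,d\rho(x)\le1$. (v) $S_{\boldsymbol\lambda}$ is hyponormal if and only if $\sum_{i\in J_\eta}\frac{\lambda_{i,1}^2}{\|S_{\boldsymbol\lambda}e_{i,1}\|^2}\le1$. (vi) The inequality $\sum_{i\in J_\eta}\frac{\lambda_{i,1}^2}{\|S_{\boldsymbol\lambda}e_{i,1}\|^2}\le\int_0^\infty\frac1x\,d\rho(x)$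 holds. (vii) The inequality in (vi) turns into equality if and only if for every $i\in J_\eta$ there exists $q_i\in\Omega_i$ such that $\rho(\sigma\cap\Omega_i)=\rho(\Omega_i)\cdot\delta_{q_i}(\sigma)$ for all Borel sets $\sigma\subseteq\mathbb{R}_+$ and all $i\in J_\eta$. (viii) If $\{\gamma_{n+1}\}_{n=0}^\infty$ is S-determinate, then $S_{\boldsymbol\lambda}$ is subnormal and $\int_0^\infty\frac1x\,d\rho(x)\le1$.
   Context: Notation: $\mathbb{N}=\{1,2,\ldots\}$, $\mathbb{Z}_+=\mathbb{N}\cup\{0\}$, $\mathbb{R}_+=[0,\infty)$, $\int_0^\infty=\int_{\mathbb{R}_+}$, $\frac10:=\infty$, $\infty+1=\infty$, $J_\iota=\{k\in\mathbb{N}\colon k\le\iota\}$ for $\iota\in\mathbb{Z}_+\cup\{\infty\}$; $\delta_q$ is the unit mass at $q$. Moments: a sequence $\{a_n\}_{n=0}^\infty\subseteq\mathbb{R}$ is a Stieltjes moment sequence if $a_n=\int_0^\infty x^n\,d\mu(x)$, $n\in\mathbb{Z}_+$, for some positive Borel measure $\mu$ on $\mathbb{R}_+$; such $\mu$ is called an S-representing measure. It is S-determinate if it has exactly one S-representing measure. Tree: $\mathcal{T}_{\eta,\kappa}=(V_{\eta,\kappa},E_{\eta,\kappa})$ with $V_{\eta,\kappa}=\{-k\colon k\in J_\kappa\}\sqcup\{0\}\sqcup\{(i,j)\colon i\in J_\eta,j\in\mathbb{N}\}$ and $E_{\eta,\kappa}=\{(-k,-k+1)\colon k\in J_\kappa\}\sqcup\{(0,(i,1))\colon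 i\in J_\eta\}\sqcup\{((i,j),(i,j+1))\colon i\in J_\eta,j\in\mathbb{N}\}$; $V_{\eta,\kappa}^\circ=V_{\eta,\kappa}\setminus\{-\kappa\}$ (equal to $V_{\eta,\kappa}$ if $\kappa=\infty$). For $v\in V_{\eta,\kappa}^\circ$, $\mathrm{par}(v)$ is the unique vertex $u$ with $(u,v)\in E_{\eta,\kappa}$. $e_u\in\ell^2(V_{\eta,\kappa})$ is the characteristic function of $\{u\}$; $e_{i,j}:=e_{(i,j)}$, $\lambda_{i,j}:=\lambda_{(i,j)}$. Data: $\{\gamma_n\}_{n=-\kappa}^\infty$ is a system of positive reals (indexed by integers $n\ge-\kappa$) with $\gamma_0=1$ and $\gamma_n=\int_0^\infty x^n\,d\nu(x)$ for all $n\in\mathbb{Z}$, $n\ge-\kappa$, for some positive Borel measure $\nu$ on $\mathbb{R}_+$. $\rho$ is an S-representing measure of $\{\gamma_{n+1}\}_{n=0}^\infty$ such that $0<\int_0^\infty\frac1{x^n}\,d\rho(x)<\infty$ for all $n\in J_{\kappa+1}$, and the closed support of $\rho$ has cardinality at least $\eta$ if $\eta<\infty$ and at least $\aleph_0$ if $\eta=\infty$. $\{\Omega_i\}_{i\in J_\eta}$ is a sequence of pairwise disjoint Borel subsets of $(0,\infty)$ with $\rho(\Omega_i)>0$ for $i\in J_\eta$ and $\bigsqcup_{i\in J_\eta}\Omega_i=(0,\infty)$. For $i\in J_\eta$, $\mu_{i,1}$ is the Borel probability measure on $\mathbb{R}_+$ given by $\mu_{i,1}(\sigma)=\rho(\Omega_i\cap\sigma)/\rho(\Omega_i)$.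 Weights: for $i\in J_\eta$, $\lambda_{i,1}=\sqrt{\rho(\Omega_i)}$ and $\lambda_{i,j}=\sqrt{\int_0^\infty x^{j-1}\,d\mu_{i,1}(x)\big/\int_0^\infty x^{j-2}\,d\mu_{i,1}(x)}$ for $j\ge2$; if $\kappa>0$, $\lambda_{-k}=\sqrt{\gamma_{-k}/\gamma_{-(k+1)}}$ for integers $0\le k<\kappa$. Operator: $\mathcal{D}(S_{\boldsymbol\lambda})=\{f\in\ell^2(V_{\eta,\kappa})\colon\Lambda f\in\ell^2(V_{\eta,\kappa})\}$, $S_{\boldsymbol\lambda}f=\Lambda f$, where $(\Lambda f)(v)=\lambda_vf(\mathrm{par}(v))$ for $v\in V_{\eta,\kappa}^\circ$ and $(\Lambda f)(v)=0$ if $v$ is the root $-\kappa$ (when $\kappa<\infty$). Operator classes (in a complex Hilbert space): $\mathcal{D}^\infty(A)=\bigcap_{n=0}^\infty\mathcal{D}(A^n)$. $A$ is paranormal if $\|Af\|^2\le\|f\|\|A^2f\|$ for $f\in\mathcal{D}(A^2)$; hyponormal if densely defined, $\mathcal{D}(A)\subseteq\mathcal{D}(A^* )$ and $\|A^*f\|\le\|Af\|$ for $f\in\mathcal{D}(A)$. A densely defined operator $N$ is normal if it is closed and $N^*N=NN^*$. A densely defined operator $S$ in $\mathcal{H}$ is subnormal if there are a complex Hilbert space $\mathcal{K}\supseteq\mathcal{H}$ (isometric embedding) and a normal operator $N$ in $\mathcal{K}$ with $\mathcal{D}(S)\subseteq\mathcal{D}(N)$ and $Sh=Nh$ for all $h\in\mathcal{D}(S)$.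 *)

theory Defs
  imports "HOL-Analysis.Analysis" "HOL-Library.Extended_Nat"
begin

section \<open>Complex Hilbert spaces with explicit carriers\<close>

text \<open>
  The spaces needed depend on parameters (the vertex set) and one of them is existentially
  quantified (the space of a normal extension), so Hilbert spaces are records rather than instances
  of a type class. Inner products are linear in the first argument.
\<close>

record 'a hspace =
  hcarrier :: "'a set"
  hzero :: 'a
  hadd :: "'a \<Rightarrow> 'a \<Rightarrow> 'a"
  hscale :: "complex \<Rightarrow> 'a \<Rightarrow> 'a"
  hinner :: "'a \<Rightarrow> 'a \<Rightarrow> complex"

definition hnorm :: "'a hspace \<Rightarrow> 'a \<Rightarrow> real" where
  "hnorm H f = sqrt (Re (hinner H f f))"

text \<open>The value off the carrier is fixed because \<open>Metric_space\<close> asks for symmetry on the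
  whole type.\<close>

definition hdist :: "'a hspace \<Rightarrow> 'a \<Rightarrow> 'a \<Rightarrow> real" where
  "hdist H f g = (if f \<in> hcarrier H \<and> g \<in> hcarrier H
     then hnorm H (hadd H f (hscale H (-1) g)) else 0)"

definition htopology :: "'a hspace \<Rightarrow> 'a topology" where
  "htopology H = Metric_space.mtopology (hcarrier H) (hdist H)"

locale complex_hilbert_space =
  fixes H :: "'a hspace"
  assumes zero_closed: "hzero H \<in> hcarrier H"
    and add_closed: "\<lbrakk>f \<in> hcarrier H; g \<in> hcarrier H\<rbrakk> \<Longrightarrow> hadd H f g \<in> hcarrier H"
    and scale_closed: "f \<in> hcarrier H \<Longrightarrow> hscale H c f \<in> hcarrier H"
    and add_assoc: "\<lbrakk>f \<in> hcarrier H; g \<in> hcarrier H; h \<in> hcarrier H\<rbrakk> \<Longrightarrow>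
      hadd H (hadd H f g) h = hadd H f (hadd H g h)"
    and add_commute: "\<lbrakk>f \<in> hcarrier H; g \<in> hcarrier H\<rbrakk> \<Longrightarrow> hadd H f g = hadd H g f"
    and add_zero: "f \<in> hcarrier H \<Longrightarrow> hadd H f (hzero H) = f"
    and add_inverse: "f \<in> hcarrier H \<Longrightarrow> hadd H f (hscale H (-1) f) = hzero H"
    and scale_one: "f \<in> hcarrier H \<Longrightarrow> hscale H 1 f = f"
    and scale_scale: "f \<in> hcarrier H \<Longrightarrow> hscale H c (hscale H d f) = hscale H (c * d) f"
    and scale_add_left: "f \<in> hcarrier H \<Longrightarrow>
      hscale H (c + d) f = hadd H (hscale H c f) (hscale H d f)"
    and scale_add_right: "\<lbrakk>f \<in> hcarrier H; g \<in> hcarrier H\<rbrakk> \<Longrightarrow>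
      hscale H c (hadd H f g) = hadd H (hscale H c f) (hscale H c g)"
    and inner_add_left: "\<lbrakk>f \<in> hcarrier H; g \<in> hcarrier H; h \<in> hcarrier H\<rbrakk> \<Longrightarrow>
      hinner H (hadd H f g) h = hinner H f h + hinner H g h"
    and inner_scale_left: "\<lbrakk>f \<in> hcarrier H; g \<in> hcarrier H\<rbrakk> \<Longrightarrow>
      hinner H (hscale H c f) g = c * hinner H f g"
    and inner_commute: "\<lbrakk>f \<in> hcarrier H; g \<in> hcarrier H\<rbrakk> \<Longrightarrow>
      hinner H g f = cnj (hinner H f g)"
    and inner_nonneg: "f \<in> hcarrier H \<Longrightarrow> 0 \<le> Re (hinner H f f)"
    and inner_definite: "\<lbrakk>f \<in> hcarrier H; hinner H f f = 0\<rbrakk> \<Longrightarrow> f = hzero H"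
    and complete: "Metric_space.mcomplete (hcarrier H) (hdist H)"

definition hsubspace :: "'a hspace \<Rightarrow> 'a set \<Rightarrow> bool" where
  "hsubspace H M \<longleftrightarrow> M \<subseteq> hcarrier H \<and> hzero H \<in> M \<and>
     (\<forall>f\<in>M. \<forall>g\<in>M. hadd H f g \<in> M) \<and> (\<forall>c. \<forall>f\<in>M. hscale H c f \<in> M)"

definition hspan :: "'a hspace \<Rightarrow> 'a set \<Rightarrow> 'a set" where
  "hspan H B = \<Inter> {M. hsubspace H M \<and> B \<subseteq> M}"

definition isometric_embedding :: "'a hspace \<Rightarrow> 'b hspace \<Rightarrow> ('a \<Rightarrow> 'b) \<Rightarrow> bool" where
  "isometric_embedding H K \<iota> \<longleftrightarrow> \<iota> \<in> hcarrier H \<rightarrow> hcarrier K \<and>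
     (\<forall>f\<in>hcarrier H. \<forall>g\<in>hcarrier H. \<iota> (hadd H f g) = hadd K (\<iota> f) (\<iota> g)) \<and>
     (\<forall>c. \<forall>f\<in>hcarrier H. \<iota> (hscale H c f) = hscale K c (\<iota> f)) \<and>
     (\<forall>f\<in>hcarrier H. \<forall>g\<in>hcarrier H. hinner K (\<iota> f) (\<iota> g) = hinner H f g)"


section \<open>Unbounded operators\<close>

text \<open>
  An operator is a partial map: its domain is \<open>dom A\<close>, its value at \<open>f \<in> dom A\<close> is
  \<open>the (A f)\<close>. The product of operators, with its natural domain, is \<open>A \<circ>\<^sub>m B\<close>, and
  equality of partial maps includes equality of the domains.
\<close>

definition linear_operator :: "'a hspace \<Rightarrow> ('a \<rightharpoonup> 'a) \<Rightarrow> bool" where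
  "linear_operator H A \<longleftrightarrow> hsubspace H (dom A) \<and> ran A \<subseteq> hcarrier H \<and>
     (\<forall>f\<in>dom A. \<forall>g\<in>dom A. the (A (hadd H f g)) = hadd H (the (A f)) (the (A g))) \<and>
     (\<forall>c. \<forall>f\<in>dom A. the (A (hscale H c f)) = hscale H c (the (A f)))"

primrec op_power :: "'a hspace \<Rightarrow> ('a \<rightharpoonup> 'a) \<Rightarrow> nat \<Rightarrow> ('a \<rightharpoonup> 'a)" where
  "op_power H A 0 = Some |` hcarrier H"
| "op_power H A (Suc n) = A \<circ>\<^sub>m op_power H A n"

definition dom_infty :: "'a hspace \<Rightarrow> ('a \<rightharpoonup> 'a) \<Rightarrow> 'a set" where
  "dom_infty H A = (\<Inter>n. dom (op_power H A n))"

definition densely_defined :: "'a hspace \<Rightarrow> ('a \<rightharpoonup> 'a) \<Rightarrow> bool" where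
  "densely_defined H A \<longleftrightarrow> htopology H closure_of (dom A) = hcarrier H"

definition closed_operator :: "'a hspace \<Rightarrow> ('a \<rightharpoonup> 'a) \<Rightarrow> bool" where
  "closed_operator H A \<longleftrightarrow>
     closedin (prod_topology (htopology H) (htopology H)) {(f, g). A f = Some g}"

text \<open>Meaningful for densely defined \<open>A\<close>, in which case the vector \<open>h\<close> is unique.\<close>

definition adjoint_op :: "'a hspace \<Rightarrow> ('a \<rightharpoonup> 'a) \<Rightarrow> ('a \<rightharpoonup> 'a)" where
  "adjoint_op H A g =
     (let P = (\<lambda>h. h \<in> hcarrier H \<and> (\<forall>f\<in>dom A. hinner H (the (A f)) g = hinner H f h))
      in if g \<in> hcarrier H \<and> (\<exists>h. P h) then Some (THE h. P h) else None)"

definition normal_operator :: "'a hspace \<Rightarrow> ('a \<rightharpoonup> 'a) \<Rightarrow> bool" where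
  "normal_operator H N \<longleftrightarrow> linear_operator H N \<and> densely_defined H N \<and> closed_operator H N \<and>
     adjoint_op H N \<circ>\<^sub>m N = N \<circ>\<^sub>m adjoint_op H N"

definition paranormal :: "'a hspace \<Rightarrow> ('a \<rightharpoonup> 'a) \<Rightarrow> bool" where
  "paranormal H A \<longleftrightarrow> (\<forall>f\<in>dom (op_power H A 2).
     (hnorm H (the (A f)))\<^sup>2 \<le> hnorm H f * hnorm H (the (op_power H A 2 f)))"

definition hyponormal :: "'a hspace \<Rightarrow> ('a \<rightharpoonup> 'a) \<Rightarrow> bool" where
  "hyponormal H A \<longleftrightarrow> densely_defined H A \<and> dom A \<subseteq> dom (adjoint_op H A) \<and>
     (\<forall>f\<in>dom A. hnorm H (the (adjoint_op H A f)) \<le> hnorm H (the (A f)))"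

text \<open>
  HOL cannot quantify over types, so the elements of the larger space \<open>K\<close> are taken from the fixed
  type \<open>'a set\<close>. This loses no generality: if \<open>S\<close> has a normal extension \<open>N\<close> with spectral
  measure \<open>E\<close>, then the closed linear span of the vectors \<open>E(\<sigma>) h\<close>, with \<open>\<sigma>\<close> Borel and
  \<open>h\<close> in \<open>H\<close>, reduces \<open>N\<close> to a normal extension of \<open>S\<close>, and for \<open>H \<noteq> 0\<close> this span has
  the cardinality of \<open>H\<close>, so that it can be copied into \<open>'a set\<close>.
\<close>

definition subnormal :: "'a hspace \<Rightarrow> ('a \<rightharpoonup> 'a) \<Rightarrow> bool" where
  "subnormal H S \<longleftrightarrow> linear_operator H S \<and> densely_defined H S \<and>
     (\<exists>(K :: 'a set hspace) \<iota> N. complex_hilbert_space K \<and> isometric_embedding H K \<iota> \<and>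
        normal_operator K N \<and> (\<forall>h\<in>dom S. N (\<iota> h) = Some (\<iota> (the (S h)))))"


section \<open>The space of square-summable functions\<close>

definition ell2 :: "'v set \<Rightarrow> ('v \<Rightarrow> complex) hspace" where
  "ell2 V = \<lparr>
     hcarrier = {f. (\<forall>v. v \<notin> V \<longrightarrow> f v = 0) \<and> (\<lambda>v. (cmod (f v))\<^sup>2) summable_on V},
     hzero = (\<lambda>_. 0),
     hadd = (\<lambda>f g v. f v + g v),
     hscale = (\<lambda>c f v. c * f v),
     hinner = (\<lambda>f g. \<Sum>\<^sub>\<infinity>v\<in>V. f v * cnj (g v))\<rparr>"

definition basis_vec :: "'v \<Rightarrow> 'v \<Rightarrow> complex" where
  "basis_vec u = indicator {u}"


section \<open>Directed trees with one branching vertex\<close>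

definition J :: "enat \<Rightarrow> nat set" where
  "J \<iota> = {k. 1 \<le> k \<and> enat k \<le> \<iota>}"

text \<open>\<open>Trunk k\<close> is the vertex \<open>-k\<close> (so \<open>Trunk 0\<close> is the branching vertex \<open>0\<close>) and
  \<open>Branch i j\<close> is the vertex \<open>(i, j)\<close>.\<close>

datatype vertex = Trunk nat | Branch nat nat

definition tree_verts :: "enat \<Rightarrow> enat \<Rightarrow> vertex set" where
  "tree_verts \<eta> \<kappa> = {Trunk k | k. k \<in> J \<kappa>} \<union> {Trunk 0} \<union> {Branch i j | i j. i \<in> J \<eta> \<and> 1 \<le> j}"

definition tree_edges :: "enat \<Rightarrow> enat \<Rightarrow> (vertex \<times> vertex) set" where
  "tree_edges \<eta> \<kappa> = {(Trunk k, Trunk (k - 1)) | k. k \<in> J \<kappa>} \<union>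
     {(Trunk 0, Branch i 1) | i. i \<in> J \<eta>} \<union>
     {(Branch i j, Branch i (j + 1)) | i j. i \<in> J \<eta> \<and> 1 \<le> j}"

definition tree_verts_nonroot :: "enat \<Rightarrow> enat \<Rightarrow> vertex set" where
  "tree_verts_nonroot \<eta> \<kappa> = tree_verts \<eta> \<kappa> - {Trunk k | k. enat k = \<kappa>}"

definition parent :: "enat \<Rightarrow> enat \<Rightarrow> vertex \<Rightarrow> vertex" where
  "parent \<eta> \<kappa> v = (THE u. (u, v) \<in> tree_edges \<eta> \<kappa>)"

definition shift_map ::
  "enat \<Rightarrow> enat \<Rightarrow> (vertex \<Rightarrow> real) \<Rightarrow> (vertex \<Rightarrow> complex) \<Rightarrow> vertex \<Rightarrow> complex" where
  "shift_map \<eta> \<kappa> lam f v =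
     (if v \<in> tree_verts_nonroot \<eta> \<kappa> then of_real (lam v) * f (parent \<eta> \<kappa> v) else 0)"

definition weighted_shift ::
  "enat \<Rightarrow> enat \<Rightarrow> (vertex \<Rightarrow> real) \<Rightarrow> (vertex \<Rightarrow> complex) \<rightharpoonup> (vertex \<Rightarrow> complex)" where
  "weighted_shift \<eta> \<kappa> lam f =
     (if f \<in> hcarrier (ell2 (tree_verts \<eta> \<kappa>)) \<and>
         shift_map \<eta> \<kappa> lam f \<in> hcarrier (ell2 (tree_verts \<eta> \<kappa>))
      then Some (shift_map \<eta> \<kappa> lam f) else None)"


section \<open>Stieltjes moments and the weights\<close>

definition borel_measure_nonneg :: "real measure \<Rightarrow> bool" where
  "borel_measure_nonneg \<mu> \<longleftrightarrow> sets \<mu> = sets (restrict_space borel {0..})"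

definition S_representing :: "(nat \<Rightarrow> real) \<Rightarrow> real measure \<Rightarrow> bool" where
  "S_representing a \<mu> \<longleftrightarrow>
     borel_measure_nonneg \<mu> \<and> (\<forall>n. has_bochner_integral \<mu> (\<lambda>x. x ^ n) (a n))"

definition Stieltjes_moment_seq :: "(nat \<Rightarrow> real) \<Rightarrow> bool" where
  "Stieltjes_moment_seq a \<longleftrightarrow> (\<exists>\<mu>. S_representing a \<mu>)"

definition S_determinate :: "(nat \<Rightarrow> real) \<Rightarrow> bool" where
  "S_determinate a \<longleftrightarrow> (\<exists>!\<mu>. S_representing a \<mu>)"

definition closed_support :: "real measure \<Rightarrow> real set" where
  "closed_support \<mu> = {x\<in>{0..}. \<forall>U. open U \<and> x \<in> U \<longrightarrow> 0 < emeasure \<mu> (U \<inter> {0..})}"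

text \<open>The integers \<open>n \<ge> -\<kappa>\<close>.\<close>

definition ints_from_minus :: "enat \<Rightarrow> int set" where
  "ints_from_minus \<kappa> = {n. enat (nat (- n)) \<le> \<kappa>}"

text \<open>The probability measure \<open>\<mu>\<^sub>i\<^sub>,\<^sub>1\<close>, that is \<open>\<sigma> \<mapsto> \<rho>(\<Omega> i \<inter> \<sigma>) / \<rho>(\<Omega> i)\<close>.\<close>

definition branch_measure :: "real measure \<Rightarrow> (nat \<Rightarrow> real set) \<Rightarrow> nat \<Rightarrow> real measure" where
  "branch_measure \<rho> \<Omega> i = uniform_measure \<rho> (\<Omega> i)"

fun shift_weight ::
  "(int \<Rightarrow> real) \<Rightarrow> real measure \<Rightarrow> (nat \<Rightarrow> real set) \<Rightarrow> vertex \<Rightarrow> real" where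
  "shift_weight \<gamma> \<rho> \<Omega> (Branch i j) =
     (if j = 1 then sqrt (measure \<rho> (\<Omega> i))
      else sqrt ((\<integral>x. x ^ (j - 1) \<partial>branch_measure \<rho> \<Omega> i) / (\<integral>x. x ^ (j - 2) \<partial>branch_measure \<rho> \<Omega> i)))"
| "shift_weight \<gamma> \<rho> \<Omega> (Trunk k) = sqrt (\<gamma> (- int k) / \<gamma> (- (int k + 1)))"

end

theory Submission
  imports Defs
begin

text \<open>
  The vectors \<open>S\<^sup>n e\<^sub>u\<close>, for fixed \<open>n\<close> and varying \<open>u\<close>, have disjoint supports, so
  \<open>\<parallel>S\<^sup>n f\<parallel>\<^sup>2\<close> is the sum over \<open>u\<close> of \<open>|f u|\<^sup>2 \<parallel>S\<^sup>n e\<^sub>u\<parallel>\<^sup>2\<close>, and by the choice of the weights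
  \<open>\<parallel>S\<^sup>n e\<^sub>u\<parallel>\<^sup>2\<close> is the \<open>n\<close>-th moment of a measure \<open>\<mu>\<^sub>u\<close>: it is \<open>x\<^sup>-\<^sup>k d\<nu> / \<gamma>\<^sub>-\<^sub>k\<close> at the trunk vertex \<open>-k\<close>
  and the normalised \<open>x\<^sup>j\<^sup>-\<^sup>1 d\<rho>\<close> on \<open>\<Omega> i\<close> at \<open>(i, j)\<close>. Mixing the measures \<open>\<mu>\<^sub>u\<close> represents
  \<open>\<parallel>S\<^sup>n f\<parallel>\<^sup>2\<close>, and the log-convexity of moments gives paranormality. Hyponormality amounts to the
  inequality between \<open>1\<close> and the sum of \<open>\<lambda>\<^sub>v\<^sup>2 / \<parallel>S e\<^sub>v\<parallel>\<^sup>2\<close> over the children \<open>v\<close> of each vertex, which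
  follows from log-convexity except at the branching vertex. There the sum falls short of
  the integral of \<open>1/x\<close> by the integrals of \<open>(x - m)\<^sup>2 / (x m\<^sup>2)\<close> over the sets \<open>\<Omega> i\<close>, with \<open>m\<close> the mean
  of \<open>\<mu>\<^sub>i\<^sub>,\<^sub>1\<close>. In the determinate case \<open>d\<rho> = x d\<nu>\<close>, and since almost every \<open>x\<close> belongs to exactly one
  \<open>\<Omega> i\<close>, \<open>S\<close> embeds into the product of \<open>\<surd>x\<close> and the bilateral shift on \<open>L\<^sup>2(\<nu>) \<otimes> \<ell>\<^sup>2(\<int>)\<close>, which is normal.
\<close>

section \<open>Square-integrable functions\<close>

text \<open>Norms and sums are kept in \<open>ennreal\<close>, as integrals over counting measures
  or over \<nu> and \<rho>. Tonelli and monotone convergence then apply without summability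
  conditions, and membership in a Hilbert space becomes finiteness of one number. What separates
  subnormality from the other assertions is that the trunk weights come from \<nu> and the branch
  weights from \<rho>, while the two measures are linked only through their moments. The numbers
  \<parallel>S^n e_u\<parallel>^2 see no more than moments. The construction of the normal extension
  uses a single measure over which trunk and branches fit together at the branching vertex, and
  determinacy provides it. Two Hilbert spaces occur: the sequence space over the vertices and the
  space of the normal extension. Both are described as square-integrable functions modulo null sets,
  so that norms and density arguments are treated once.\<close>

definition sq_norm :: "'x measure \<Rightarrow> ('x \<Rightarrow> complex) \<Rightarrow> ennreal" where
  "sq_norm M f = (\<integral>\<^sup>+x. ennreal ((cmod (f x))\<^sup>2) \<partial>M)"

definition L2 :: "'x measure \<Rightarrow> ('x \<Rightarrow> complex) set" where
  "L2 M = {f \<in> borel_measurable M. sq_norm M f < \<infinity>}"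

definition L2_inner :: "'x measure \<Rightarrow> ('x \<Rightarrow> complex) \<Rightarrow> ('x \<Rightarrow> complex) \<Rightarrow> complex" where
  "L2_inner M f g = (\<integral>x. f x * cnj (g x) \<partial>M)"

lemma L2_measurable: "f \<in> L2 M \<Longrightarrow> f \<in> borel_measurable M"
  by (simp add: L2_def)

lemma L2_zero: "(\<lambda>_. 0) \<in> L2 M"
  by (simp add: L2_def sq_norm_def)

lemma sq_norm_scale:
  assumes "f \<in> borel_measurable M"
  shows "sq_norm M (\<lambda>x. c * f x) = ennreal ((cmod c)\<^sup>2) * sq_norm M f"
  using assms unfolding sq_norm_def
  by (simp add: norm_mult power_mult_distrib ennreal_mult nn_integral_cmult)

lemma L2_scale: "f \<in> L2 M \<Longrightarrow> (\<lambda>x. c * f x) \<in> L2 M"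
  by (auto simp: L2_def sq_norm_scale ennreal_mult_less_top)

lemma L2_mono:
  assumes "f \<in> L2 M" "g \<in> borel_measurable M" "\<And>x. x \<in> space M \<Longrightarrow> cmod (g x) \<le> cmod (f x)"
  shows "g \<in> L2 M"
proof -
  have "sq_norm M g \<le> sq_norm M f"
    unfolding sq_norm_def using assms(3) by (intro nn_integral_mono ennreal_leI power_mono) auto
  then show ?thesis using assms by (auto simp: L2_def)
qed

lemma cmod_add_sq_le: "(cmod (a + b))\<^sup>2 \<le> 2 * (cmod a)\<^sup>2 + 2 * (cmod b)\<^sup>2"
proof -
  have "(cmod (a + b))\<^sup>2 \<le> (cmod a + cmod b)\<^sup>2"
    by (intro power_mono norm_triangle_ineq) auto
  also have "\<dots> \<le> 2 * (cmod a)\<^sup>2 + 2 * (cmod b)\<^sup>2"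
    using sum_squares_bound[of "cmod a" "cmod b"] by (simp add: power2_sum)
  finally show ?thesis .
qed

lemma L2_uminus: "f \<in> L2 M \<Longrightarrow> (\<lambda>x. - f x) \<in> L2 M"
  using L2_scale[of f M "-1"] by simp

lemma L2_add: assumes "f \<in> L2 M" "g \<in> L2 M" shows "(\<lambda>x. f x + g x) \<in> L2 M"
proof -
  have [measurable]: "f \<in> borel_measurable M" "g \<in> borel_measurable M"
    using assms by (auto simp: L2_def)
  have "sq_norm M (\<lambda>x. f x + g x) \<le> (\<integral>\<^sup>+x. 2 * ennreal ((cmod (f x))\<^sup>2) + 2 * ennreal ((cmod (g x))\<^sup>2) \<partial>M)"
    unfolding sq_norm_def
  proof (rule nn_integral_mono)
    fix x
    show "ennreal ((cmod (f x + g x))\<^sup>2) \<le> 2 * ennreal ((cmod (f x))\<^sup>2) + 2 * ennreal ((cmod (g x))\<^sup>2)"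
      using ennreal_leI[OF cmod_add_sq_le[of "f x" "g x"]]
      by (simp add: ennreal_plus ennreal_mult)
  qed
  also have "\<dots> = 2 * sq_norm M f + 2 * sq_norm M g"
    unfolding sq_norm_def by (subst nn_integral_add) (auto simp: nn_integral_cmult)
  also have "\<dots> < \<infinity>" using assms by (auto simp: L2_def ennreal_mult_less_top)
  finally show ?thesis by (simp add: L2_def)
qed

lemma L2_diff: assumes "f \<in> L2 M" "g \<in> L2 M" shows "(\<lambda>x. f x - g x) \<in> L2 M"
  using L2_add[OF assms(1) L2_scale[OF assms(2), of "-1"]] by simp

lemma borel_measurable_cnj [measurable]:
  "f \<in> borel_measurable M \<Longrightarrow> (\<lambda>x. cnj (f x)) \<in> borel_measurable M"
  by (rule borel_measurable_continuous_on[OF _ ]) (intro continuous_intros)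

lemma L2_norm_mult_le:
  assumes "f \<in> L2 M" "g \<in> L2 M"
  shows "(\<integral>\<^sup>+x. ennreal (cmod (f x * cnj (g x))) \<partial>M)\<^sup>2 \<le> sq_norm M f * sq_norm M g"
proof -
  have [measurable]: "f \<in> borel_measurable M" "g \<in> borel_measurable M"
    using assms by (auto simp: L2_def)
  have "(\<integral>\<^sup>+x. ennreal (cmod (f x)) * ennreal (cmod (g x)) \<partial>M)\<^sup>2 \<le>
     (\<integral>\<^sup>+x. ennreal (cmod (f x))^2 \<partial>M) * (\<integral>\<^sup>+x. ennreal (cmod (g x))^2 \<partial>M)"
    by (rule Cauchy_Schwarz_nn_integral) auto
  then show ?thesis
    by (simp add: sq_norm_def norm_mult ennreal_mult ennreal_power)
qed

lemma L2_integrable: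
  assumes "f \<in> L2 M" "g \<in> L2 M"
  shows "integrable M (\<lambda>x. f x * cnj (g x))"
proof -
  have [measurable]: "f \<in> borel_measurable M" "g \<in> borel_measurable M"
    using assms by (auto simp: L2_def)
  have "sq_norm M f * sq_norm M g < \<infinity>" using assms by (auto simp: L2_def ennreal_mult_less_top)
  then have "(\<integral>\<^sup>+x. ennreal (cmod (f x * cnj (g x))) \<partial>M)\<^sup>2 < \<infinity>"
    using L2_norm_mult_le[OF assms] by (rule order.strict_trans1[rotated])
  then have "(\<integral>\<^sup>+x. ennreal (cmod (f x * cnj (g x))) \<partial>M) < \<infinity>"
    by (auto simp: power_less_top_ennreal)
  then show ?thesis by (intro integrableI_bounded) auto
qed

lemma L2_inner_self:
  assumes "f \<in> L2 M"
  shows "L2_inner M f f = complex_of_real (enn2real (sq_norm M f))"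
proof -
  have [measurable]: "f \<in> borel_measurable M"
    using assms by (auto simp: L2_def)
  have "L2_inner M f f = (\<integral>x. complex_of_real ((cmod (f x))\<^sup>2) \<partial>M)"
    unfolding L2_inner_def by (rule Bochner_Integration.integral_cong) (simp_all flip: complex_norm_square)
  also have "\<dots> = complex_of_real (\<integral>x. (cmod (f x))\<^sup>2 \<partial>M)"
    by (rule integral_complex_of_real)
  also have "(\<integral>x. (cmod (f x))\<^sup>2 \<partial>M) = enn2real (sq_norm M f)"
    unfolding sq_norm_def by (rule integral_eq_nn_integral) auto
  finally show ?thesis .
qed

lemma L2_Cauchy_Schwarz:
  assumes "f \<in> L2 M" "g \<in> L2 M"
  shows "cmod (L2_inner M f g) \<le> sqrt (enn2real (sq_norm M f)) * sqrt (enn2real (sq_norm M g))"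
proof -
  let ?I = "\<integral>x. cmod (f x * cnj (g x)) \<partial>M"
  have fin: "sq_norm M f < \<infinity>" "sq_norm M g < \<infinity>" using assms by (auto simp: L2_def)
  have "ennreal (?I\<^sup>2) = (\<integral>\<^sup>+x. ennreal (cmod (f x * cnj (g x))) \<partial>M)\<^sup>2"
    using L2_integrable[OF assms] by (subst nn_integral_eq_integral) (auto simp: ennreal_power)
  also have "\<dots> \<le> sq_norm M f * sq_norm M g" by (rule L2_norm_mult_le[OF assms])
  also have "\<dots> = ennreal (enn2real (sq_norm M f) * enn2real (sq_norm M g))"
    using fin by (simp add: ennreal_mult)
  finally have "?I\<^sup>2 \<le> enn2real (sq_norm M f) * enn2real (sq_norm M g)"
    by simp
  then have "?I \<le> sqrt (enn2real (sq_norm M f) * enn2real (sq_norm M g))"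
    by (rule real_le_rsqrt)
  moreover have "cmod (L2_inner M f g) \<le> ?I"
    unfolding L2_inner_def by (rule integral_norm_bound)
  ultimately show ?thesis by (simp add: real_sqrt_mult)
qed

lemma L2_inner_add_left:
  "\<lbrakk>f \<in> L2 M; g \<in> L2 M; h \<in> L2 M\<rbrakk> \<Longrightarrow> L2_inner M (\<lambda>x. f x + g x) h = L2_inner M f h + L2_inner M g h"
  unfolding L2_inner_def by (simp add: distrib_right L2_integrable)

lemma L2_inner_scale_left: "L2_inner M (\<lambda>x. c * f x) g = c * L2_inner M f g"
  unfolding L2_inner_def by (simp add: mult.assoc)

lemma L2_inner_commute: "L2_inner M g f = cnj (L2_inner M f g)"
proof -
  have "L2_inner M g f = (\<integral>x. cnj (f x * cnj (g x)) \<partial>M)"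
    unfolding L2_inner_def by (rule Bochner_Integration.integral_cong) (simp_all add: mult.commute)
  also have "\<dots> = cnj (L2_inner M f g)"
    unfolding L2_inner_def by (rule Bochner_Integration.integral_cnj)
  finally show ?thesis .
qed

lemma L2_inner_scale_right: "L2_inner M f (\<lambda>x. c * g x) = cnj c * L2_inner M f g"
  by (subst (1 2) L2_inner_commute) (simp add: L2_inner_scale_left)

lemma L2_inner_add_right:
  "\<lbrakk>f \<in> L2 M; g \<in> L2 M; h \<in> L2 M\<rbrakk> \<Longrightarrow> L2_inner M h (\<lambda>x. f x + g x) = L2_inner M h f + L2_inner M h g"
  by (subst (1 2 3) L2_inner_commute) (simp add: L2_inner_add_left)

lemma Re_L2_inner:
  assumes "f \<in> L2 M" "g \<in> L2 M"
  shows "2 * Re (L2_inner M f g) =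
    enn2real (sq_norm M (\<lambda>x. f x + g x)) - enn2real (sq_norm M f) - enn2real (sq_norm M g)"
proof -
  let ?n = "\<lambda>f. enn2real (sq_norm M f)"
  have "complex_of_real (?n (\<lambda>x. f x + g x)) = L2_inner M f f + L2_inner M g g + (L2_inner M f g + cnj (L2_inner M f g))"
    unfolding L2_inner_self[OF L2_add[OF assms], symmetric] L2_inner_commute[symmetric]
    by (simp add: assms L2_add L2_inner_add_left L2_inner_add_right)
  also have "\<dots> = complex_of_real (?n f + ?n g + 2 * Re (L2_inner M f g))"
    by (simp add: assms L2_inner_self complex_add_cnj)
  finally show ?thesis by (simp only: of_real_eq_iff)
qed

text \<open>The values c = 1 and c = \<i> yield the real and the imaginary part of the inner
  product. The hypotheses concern the two given vectors only, so that \<open>embed\<close> can be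
  used without first being made an operator between Hilbert spaces.\<close>

lemma L2_polarization:
  assumes L: "f \<in> L2 M" "g \<in> L2 M" "f' \<in> L2 N" "g' \<in> L2 N"
    and iso: "\<And>c. sq_norm M (\<lambda>x. f x + c * g x) = sq_norm N (\<lambda>x. f' x + c * g' x)"
    and iso_g: "sq_norm M g = sq_norm N g'"
  shows "L2_inner M f g = L2_inner N f' g'"
proof -
  have iso_f: "sq_norm M f = sq_norm N f'" using iso[of 0] by simp
  have Re: "Re (L2_inner M f (\<lambda>x. c * g x)) = Re (L2_inner N f' (\<lambda>x. c * g' x))" for c
    using Re_L2_inner[OF L(1) L2_scale[OF L(2)], of c] Re_L2_inner[OF L(3) L2_scale[OF L(4)], of c]
      L(2,4) by (simp add: iso iso_f sq_norm_scale L2_measurable iso_g)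
  show ?thesis
    using Re[of 1] Re[of \<i>] by (simp add: complex_eq_iff L2_inner_scale_right)
qed

lemma L2_norm_triangle:
  assumes "f \<in> L2 M" "g \<in> L2 M"
  shows "sqrt (enn2real (sq_norm M (\<lambda>x. f x + g x))) \<le>
    sqrt (enn2real (sq_norm M f)) + sqrt (enn2real (sq_norm M g))"
proof -
  let ?n = "\<lambda>f. enn2real (sq_norm M f)"
  have "?n (\<lambda>x. f x + g x) = ?n f + ?n g + 2 * Re (L2_inner M f g)"
    using Re_L2_inner[OF assms] by simp
  also have "\<dots> \<le> ?n f + ?n g + 2 * (sqrt (?n f) * sqrt (?n g))"
    using L2_Cauchy_Schwarz[OF assms] complex_Re_le_cmod[of "L2_inner M f g"] by linarith
  also have "\<dots> = (sqrt (?n f) + sqrt (?n g))\<^sup>2"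
    by (simp add: power2_sum)
  finally show ?thesis by (intro real_le_lsqrt) auto
qed

section \<open>Almost everywhere equality and completeness of the square-integrable
  functions\<close>

lemma sq_norm_cong_AE: "(AE x in M. f x = g x) \<Longrightarrow> sq_norm M f = sq_norm M g"
  unfolding sq_norm_def by (rule nn_integral_cong_AE) auto

lemma sq_norm_eq_0_iff:
  "f \<in> borel_measurable M \<Longrightarrow> sq_norm M f = 0 \<longleftrightarrow> (AE x in M. f x = 0)"
  unfolding sq_norm_def by (subst nn_integral_0_iff_AE) auto

lemma L2_cong_AE:
  "f \<in> L2 M \<Longrightarrow> g \<in> borel_measurable M \<Longrightarrow> (AE x in M. f x = g x) \<Longrightarrow> g \<in> L2 M"
  using sq_norm_cong_AE[of f g M] by (auto simp: L2_def)

text \<open>By 2ab \<le> a^2 + b^2 with a = 2^-k and b = |d k|, the term |d k| is at most 2^-k + 2^k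
  |d k|^2. The weighted square sum can be integrated term by term, which gives convergence at almost
  every point in \<open>L2_complete\<close> without Minkowski's inequality for series.\<close>

lemma summable_if_weighted_squares:
  fixes d :: "nat \<Rightarrow> complex"
  assumes "(\<Sum>k. ennreal (2 ^ k * (cmod (d k))\<^sup>2)) < \<infinity>"
  shows "summable d"
proof -
  have s: "summable (\<lambda>k. 2 ^ k * (cmod (d k))\<^sup>2)"
    by (rule summable_suminf_not_top) (use assms in auto)
  have "summable (\<lambda>k. (1/2)^k + 2 ^ k * (cmod (d k))\<^sup>2)"
    by (intro summable_add s summable_geometric) simp
  moreover have "cmod (d k) \<le> (1/2)^k + 2 ^ k * (cmod (d k))\<^sup>2" for k
  proof -
    have "0 \<le> ((1/2::real)^k - cmod (d k))\<^sup>2" by simp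
    then have "2 * (1/2::real)^k * cmod (d k) \<le> ((1/2)^k)\<^sup>2 + (cmod (d k))\<^sup>2"
      by (simp add: power2_diff)
    then have "2 ^ k * (2 * (1/2::real)^k * cmod (d k)) \<le> 2 ^ k * (((1/2)^k)\<^sup>2 + (cmod (d k))\<^sup>2)"
      by (intro mult_left_mono) auto
    moreover have "2 ^ k * (2 * (1/2::real)^k * cmod (d k)) = 2 * cmod (d k)"
      by (simp add: power_one_over)
    moreover have "2 ^ k * ((1/2::real)^k)\<^sup>2 = (1/2)^k"
      by (simp add: power_one_over power2_eq_square)
    ultimately have "2 * cmod (d k) \<le> (1/2::real)^k + 2 ^ k * (cmod (d k))\<^sup>2"
      by (simp add: distrib_left)
    then show ?thesis using norm_ge_zero[of "d k"] by linarith
  qed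
  ultimately show ?thesis by (intro summable_comparison_test[of d] exI[of _ 0]) auto
qed

text \<open>Riesz-Fischer: a fast subsequence converges almost everywhere, and Fatou's lemma turns
  the Cauchy condition into norm convergence of the whole sequence.\<close>

lemma L2_complete:
  fixes F :: "nat \<Rightarrow> 'x \<Rightarrow> complex"
  assumes L2: "\<And>n. F n \<in> L2 M"
    and Cauchy: "\<And>e. 0 < e \<Longrightarrow> \<exists>N. \<forall>m\<ge>N. \<forall>n\<ge>N. sq_norm M (\<lambda>x. F m x - F n x) < ennreal e"
  obtains f where "f \<in> L2 M"
    "\<And>e. 0 < e \<Longrightarrow> \<exists>N. \<forall>n\<ge>N. sq_norm M (\<lambda>x. F n x - f x) \<le> ennreal e"
proof -
  have [measurable]: "F n \<in> borel_measurable M" for n using L2 by (simp add: L2_def)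
  \<comment> \<open>The rate 4^-k survives the weight 2^k of
    \<open>summable_if_weighted_squares\<close> and leaves the geometric series of 2^-k.\<close>
  have "\<exists>N. \<forall>k. \<forall>m\<ge>N k. \<forall>n\<ge>N k. sq_norm M (\<lambda>x. F m x - F n x) < ennreal ((1/4)^k)"
    using Cauchy[of "(1/4)^_"] by (intro choice) auto
  then obtain N where N: "\<And>k m n. m \<ge> N k \<Longrightarrow> n \<ge> N k \<Longrightarrow> sq_norm M (\<lambda>x. F m x - F n x) < ennreal ((1/4)^k)"
    by blast
  \<comment> \<open>\<open>N\<close> need not be monotone. Adding up its values makes
    \<open>r\<close> increasing and at least \<open>N k\<close>, and the summand \<open>k\<close>
    sends it to infinity.\<close>
  define r where "r k = (\<Sum>j\<le>k. N j) + k" for k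
  have r_ge: "r k \<ge> N k" "r k \<ge> k" for k
    using member_le_sum[of k "{..k}" N] by (auto simp: r_def)
  have r_mono: "r k \<le> r (Suc k)" for k by (simp add: r_def)
  define d where "d k x = F (r (Suc k)) x - F (r k) x" for k x
  have d_le: "sq_norm M (d k) \<le> ennreal ((1/4)^k)" for k
    unfolding d_def using N[of k "r (Suc k)" "r k"] r_ge(1)[of k] r_mono[of k] by simp
  have [measurable]: "d k \<in> borel_measurable M" for k unfolding d_def by measurable
  have "(\<integral>\<^sup>+x. (\<Sum>k. ennreal (2 ^ k * (cmod (d k x))\<^sup>2)) \<partial>M) = (\<Sum>k. (\<integral>\<^sup>+x. ennreal (2 ^ k * (cmod (d k x))\<^sup>2) \<partial>M))"
    by (rule nn_integral_suminf) measurable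
  also have "\<dots> = (\<Sum>k. ennreal (2 ^ k) * sq_norm M (d k))"
    unfolding sq_norm_def by (simp add: ennreal_mult nn_integral_cmult)
  also have "\<dots> \<le> (\<Sum>k. ennreal ((1/2) ^ k))"
  proof (intro suminf_le)
    fix k
    have "ennreal (2 ^ k) * sq_norm M (d k) \<le> ennreal (2 ^ k) * ennreal ((1/4)^k)"
      by (intro mult_left_mono d_le) auto
    also have "\<dots> = ennreal ((1/2)^k)"
      by (simp flip: ennreal_mult power_mult_distrib)
    finally show "ennreal (2 ^ k) * sq_norm M (d k) \<le> ennreal ((1/2)^k)" .
  qed auto
  also have "\<dots> < \<infinity>"
    by (subst suminf_ennreal2) (auto intro: summable_geometric)
  finally have "AE x in M. (\<Sum>k. ennreal (2 ^ k * (cmod (d k x))\<^sup>2)) \<noteq> \<infinity>"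
    by (intro nn_integral_PInf_AE) auto
  then have conv: "AE x in M. convergent (\<lambda>k. F (r k) x)"
  proof eventually_elim
    case (elim x)
    then have "summable (\<lambda>k. d k x)" by (intro summable_if_weighted_squares) (auto simp: top.not_eq_extremum)
    then have "convergent (\<lambda>n. (\<Sum>k<n. d k x))" by (rule summable_iff_convergent[THEN iffD1])
    moreover have "(\<Sum>k<n. d k x) = F (r n) x - F (r 0) x" for n
      unfolding d_def by (rule sum_lessThan_telescope)
    ultimately have "convergent (\<lambda>n. F (r n) x - F (r 0) x)" by simp
    then have "convergent (\<lambda>n. (F (r n) x - F (r 0) x) + F (r 0) x)"
      by (intro convergent_add convergent_const)
    then show ?case by simp
  qed
  define f where "f x = lim (\<lambda>k. F (r k) x)" for x
  have [measurable]: "f \<in> borel_measurable M" unfolding f_def by measurable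
  have lim: "AE x in M. (\<lambda>k. F (r k) x) \<longlonglongrightarrow> f x"
    using conv by eventually_elim (simp add: f_def convergent_LIMSEQ_iff)
  have main: "\<exists>N. \<forall>n\<ge>N. sq_norm M (\<lambda>x. F n x - f x) \<le> ennreal e" if e: "0 < e" for e
  proof -
    from Cauchy[OF e] obtain N0 where N0: "\<And>m n. m \<ge> N0 \<Longrightarrow> n \<ge> N0 \<Longrightarrow> sq_norm M (\<lambda>x. F m x - F n x) < ennreal e"
      by blast
    show ?thesis
    proof (intro exI allI impI)
      fix n assume n: "N0 \<le> n"
      \<comment> \<open>\<open>F n\<close> stays fixed while the subsequence runs to its limit;
        Fatou then carries the Cauchy bound over to the limit.\<close>
      have "sq_norm M (\<lambda>x. F n x - f x) = (\<integral>\<^sup>+x. liminf (\<lambda>k. ennreal ((cmod (F n x - F (r k) x))\<^sup>2)) \<partial>M)"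
        unfolding sq_norm_def
      proof (rule nn_integral_cong_AE, use lim in eventually_elim)
        case (elim x)
        have "(\<lambda>k. ennreal ((cmod (F n x - F (r k) x))\<^sup>2)) \<longlonglongrightarrow> ennreal ((cmod (F n x - f x))\<^sup>2)"
          by (intro tendsto_intros elim)
        then show ?case by (intro lim_imp_Liminf[symmetric]) auto
      qed
      also have "\<dots> \<le> liminf (\<lambda>k. sq_norm M (\<lambda>x. F n x - F (r k) x))"
        unfolding sq_norm_def by (rule nn_integral_liminf) measurable
      also have "\<dots> \<le> limsup (\<lambda>k. sq_norm M (\<lambda>x. F n x - F (r k) x))"
        by (intro Liminf_le_Limsup) auto
      also have "\<dots> \<le> ennreal e"
      proof (rule Limsup_bounded, rule eventually_sequentiallyI[of N0])
        fix k assume "N0 \<le> k"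
        then have "N0 \<le> r k" using r_ge(2)[of k] by simp
        then show "sq_norm M (\<lambda>x. F n x - F (r k) x) \<le> ennreal e" using N0[OF n] by (simp add: less_imp_le)
      qed
      finally show "sq_norm M (\<lambda>x. F n x - f x) \<le> ennreal e" .
    qed
  qed
  moreover have "f \<in> L2 M"
  proof -
    obtain n where "sq_norm M (\<lambda>x. F n x - f x) \<le> ennreal 1" using main[of 1] by auto
    then have "(\<lambda>x. F n x - f x) \<in> L2 M"
      by (auto simp: L2_def intro: le_less_trans)
    from L2_diff[OF L2[of n] this] show ?thesis by simp
  qed
  ultimately show thesis using that by blast
qed


section \<open>Hilbert spaces modelled on square-integrable functions\<close>

text \<open>No quotient type is formed: \<open>cls\<close> sends a function to whatever element of
  \<open>K\<close> stands for its class, and all that is known of these elements is when two of them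
  agree. The two instances are \<open>ell2\<close>, whose elements are functions, and a space of
  sets built to fit the type demanded by \<open>subnormal\<close>.\<close>

locale L2_model =
  fixes M :: "'x measure" and K :: "'b hspace" and cls :: "('x \<Rightarrow> complex) \<Rightarrow> 'b"
  assumes carrier: "hcarrier K = cls ` L2 M"
    and cls_eq_iff: "\<lbrakk>f \<in> L2 M; g \<in> L2 M\<rbrakk> \<Longrightarrow> cls f = cls g \<longleftrightarrow> (AE x in M. f x = g x)"
    and zero: "hzero K = cls (\<lambda>_. 0)"
    and add: "\<lbrakk>f \<in> L2 M; g \<in> L2 M\<rbrakk> \<Longrightarrow> hadd K (cls f) (cls g) = cls (\<lambda>x. f x + g x)"
    and scale: "f \<in> L2 M \<Longrightarrow> hscale K c (cls f) = cls (\<lambda>x. c * f x)"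
    and inner: "\<lbrakk>f \<in> L2 M; g \<in> L2 M\<rbrakk> \<Longrightarrow> hinner K (cls f) (cls g) = L2_inner M f g"
begin

lemma cls_closed: "f \<in> L2 M \<Longrightarrow> cls f \<in> hcarrier K"
  by (simp add: carrier)

lemma carrierE:
  assumes "a \<in> hcarrier K" obtains f where "f \<in> L2 M" "a = cls f"
  using assms by (auto simp: carrier)

lemma hnorm_cls: "f \<in> L2 M \<Longrightarrow> hnorm K (cls f) = sqrt (enn2real (sq_norm M f))"
  by (simp add: hnorm_def inner L2_inner_self)

lemma ennreal_hnorm_sq: "f \<in> L2 M \<Longrightarrow> ennreal ((hnorm K (cls f))\<^sup>2) = sq_norm M f"
  by (simp add: hnorm_cls) (simp add: L2_def)

lemma hdist_cls:
  assumes "f \<in> L2 M" "g \<in> L2 M"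
  shows "hdist K (cls f) (cls g) = sqrt (enn2real (sq_norm M (\<lambda>x. f x - g x)))"
proof -
  have "hdist K (cls f) (cls g) = hnorm K (cls (\<lambda>x. f x + (-1) * g x))"
    using assms by (simp only: hdist_def cls_closed scale add L2_scale if_True simp_thms)
  also have "\<dots> = sqrt (enn2real (sq_norm M (\<lambda>x. f x + (-1) * g x)))"
    using assms by (intro hnorm_cls L2_add L2_scale)
  finally show ?thesis by simp
qed

lemma hdist_less_iff:
  assumes "f \<in> L2 M" "g \<in> L2 M" "0 < e"
  shows "hdist K (cls f) (cls g) < e \<longleftrightarrow> sq_norm M (\<lambda>x. f x - g x) < ennreal (e\<^sup>2)"
proof -
  have "sq_norm M (\<lambda>x. f x - g x) < \<infinity>" using L2_diff[OF assms(1,2)] by (simp add: L2_def)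
  then obtain r where r: "0 \<le> r" "sq_norm M (\<lambda>x. f x - g x) = ennreal r"
    by (cases "sq_norm M (\<lambda>x. f x - g x)") auto
  show ?thesis
    unfolding hdist_cls[OF assms(1,2)] r(2) using r(1) assms(3)
    by (simp add: ennreal_less_iff real_less_lsqrt) (metis abs_of_pos real_sqrt_abs real_sqrt_less_iff)
qed

lemma Metric_space: "Metric_space (hcarrier K) (hdist K)"
proof
  fix a b
  show "0 \<le> hdist K a b"
  proof (cases "a \<in> hcarrier K \<and> b \<in> hcarrier K")
    case True
    then show ?thesis by (auto elim!: carrierE simp: hdist_cls)
  qed (auto simp: hdist_def)
  show "hdist K a b = hdist K b a"
  proof (cases "a \<in> hcarrier K \<and> b \<in> hcarrier K")
    case True
    then obtain f g where "f \<in> L2 M" "a = cls f" "g \<in> L2 M" "b = cls g" by (auto elim!: carrierE)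
    then show ?thesis by (simp add: hdist_cls sq_norm_def norm_minus_commute)
  qed (auto simp: hdist_def)
next
  fix a b assume "a \<in> hcarrier K" "b \<in> hcarrier K"
  then obtain f g where fg: "f \<in> L2 M" "a = cls f" "g \<in> L2 M" "b = cls g" by (auto elim!: carrierE)
  have fin: "sq_norm M (\<lambda>x. f x - g x) < \<infinity>" using L2_diff[OF fg(1,3)] by (simp add: L2_def)
  have m: "(\<lambda>x. f x - g x) \<in> borel_measurable M" using L2_diff[OF fg(1,3)] by (simp add: L2_def)
  have "hdist K a b = 0 \<longleftrightarrow> sq_norm M (\<lambda>x. f x - g x) = 0"
    using fin by (simp add: fg hdist_cls enn2real_eq_0_iff) (auto simp: less_top)
  also have "\<dots> \<longleftrightarrow> a = b" by (simp add: fg cls_eq_iff sq_norm_eq_0_iff[OF m])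
  finally show "hdist K a b = 0 \<longleftrightarrow> a = b" .
next
  fix a b c assume "a \<in> hcarrier K" "b \<in> hcarrier K" "c \<in> hcarrier K"
  then obtain f g h where fgh: "f \<in> L2 M" "a = cls f" "g \<in> L2 M" "b = cls g" "h \<in> L2 M" "c = cls h"
    by (auto elim!: carrierE)
  have "(\<lambda>x. f x - h x) = (\<lambda>x. (f x - g x) + (g x - h x))" by auto
  then show "hdist K a c \<le> hdist K a b + hdist K b c"
    using L2_norm_triangle[of "\<lambda>x. f x - g x" M "\<lambda>x. g x - h x"] fgh
    by (simp add: hdist_cls L2_diff)
qed

sublocale metric: Metric_space "hcarrier K" "hdist K"
  by (rule Metric_space)

lemma mcomplete: "metric.mcomplete"
  unfolding metric.mcomplete_def
proof (intro allI impI)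
  fix s assume s: "metric.MCauchy s"
  then have "\<forall>n. \<exists>f. f \<in> L2 M \<and> s n = cls f"
    unfolding metric.MCauchy_def by (meson carrierE range_subsetD)
  then obtain F where F: "\<And>n. F n \<in> L2 M" "\<And>n. s n = cls (F n)" by metis
  have "\<exists>N. \<forall>m\<ge>N. \<forall>n\<ge>N. sq_norm M (\<lambda>x. F m x - F n x) < ennreal e" if e: "0 < e" for e
  proof -
    have "\<exists>N. \<forall>n n'. N \<le> n \<longrightarrow> N \<le> n' \<longrightarrow> hdist K (s n) (s n') < sqrt e"
      using s e by (auto simp: metric.MCauchy_def)
    then show "\<exists>N. \<forall>m\<ge>N. \<forall>n\<ge>N. sq_norm M (\<lambda>x. F m x - F n x) < ennreal e"
      using e by (simp add: F hdist_less_iff)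
  qed
  then obtain f where f: "f \<in> L2 M"
    "\<And>e. 0 < e \<Longrightarrow> \<exists>N. \<forall>n\<ge>N. sq_norm M (\<lambda>x. F n x - f x) \<le> ennreal e"
    using L2_complete[of F M] F(1) by metis
  have "limitin metric.mtopology s (cls f) sequentially"
    unfolding metric.limitin_metric
  proof (intro conjI allI impI)
    fix e :: real assume e: "0 < e"
    obtain N where N: "\<And>n. n \<ge> N \<Longrightarrow> sq_norm M (\<lambda>x. F n x - f x) \<le> ennreal (e\<^sup>2 / 2)"
      using f(2)[of "e\<^sup>2 / 2"] e by auto
    have "ennreal (e\<^sup>2 / 2) < ennreal (e\<^sup>2)" using e by (simp add: ennreal_less_iff)
    then have "sq_norm M (\<lambda>x. F n x - f x) < ennreal (e\<^sup>2)" if "n \<ge> N" for n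
      using N[OF that] by (rule le_less_trans[rotated])
    then show "\<forall>\<^sub>F n in sequentially. s n \<in> hcarrier K \<and> hdist K (s n) (cls f) < e"
      by (intro eventually_sequentiallyI[of N]) (simp add: F f e hdist_less_iff cls_closed)
  qed (simp add: f cls_closed)
  then show "\<exists>x. limitin metric.mtopology s x sequentially" by blast
qed

lemma complex_hilbert_space: "complex_hilbert_space K"
proof
  fix a assume "a \<in> hcarrier K" and z: "hinner K a a = 0"
  then obtain f where f: "f \<in> L2 M" "a = cls f" by (auto elim: carrierE)
  then have "sq_norm M f = 0" using z by (auto simp: inner L2_inner_self enn2real_eq_0_iff L2_def)
  then have "AE x in M. f x = 0" using f by (simp add: sq_norm_eq_0_iff L2_measurable)
  then show "a = hzero K" using f by (simp add: zero cls_eq_iff L2_zero)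
next
  show "Metric_space.mcomplete (hcarrier K) (hdist K)" by (rule mcomplete)
qed (auto elim!: carrierE simp: zero L2_zero cls_closed add scale L2_add L2_scale L2_uminus inner L2_inner_self
    L2_inner_add_left L2_inner_scale_left algebra_simps intro: L2_inner_commute)

text \<open>The truncations of f to an exhausting sequence of sets converge to f by dominated
  convergence. The sets may depend on f; they are sublevel sets of the weight for the normal
  operator and finite sets of vertices for S.\<close>

lemma densely_definedI:
  assumes dom: "dom A \<subseteq> hcarrier K"
    and trunc: "\<And>f. f \<in> L2 M \<Longrightarrow> \<exists>E :: nat \<Rightarrow> 'x set. incseq E \<and> range E \<subseteq> sets M \<and> space M \<subseteq> (\<Union>n. E n) \<and>
      (\<forall>n. cls (\<lambda>x. indicator (E n) x * f x) \<in> dom A)"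
  shows "densely_defined K A"
  unfolding densely_defined_def htopology_def metric.metric_closure_of
proof (intro equalityI subsetI CollectI conjI allI impI)
  fix a and r :: real assume a: "a \<in> hcarrier K" and r: "0 < r"
  obtain f where f: "f \<in> L2 M" "a = cls f" using a by (auto elim: carrierE)
  have [measurable]: "f \<in> borel_measurable M" using f by (simp add: L2_measurable)
  obtain E :: "nat \<Rightarrow> 'x set" where E: "incseq E" "\<And>n. E n \<in> sets M" "space M \<subseteq> (\<Union>n. E n)"
    "\<And>n. cls (\<lambda>x. indicator (E n) x * f x) \<in> dom A"
    using trunc[OF f(1)] by auto
  note [measurable] = E(2)
  let ?g = "\<lambda>n x. indicator (E n) x * f x"
  have g: "?g n \<in> L2 M" for n
    by (rule L2_mono[OF f(1)]) (auto simp: indicator_def)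
  have "(\<lambda>n. \<integral>\<^sup>+x. ennreal ((cmod (f x - ?g n x))\<^sup>2) \<partial>M) \<longlonglongrightarrow> (\<integral>\<^sup>+x. 0 \<partial>M)"
  proof (rule nn_integral_dominated_convergence[where w = "\<lambda>x. ennreal ((cmod (f x))\<^sup>2)"])
    show "(\<integral>\<^sup>+x. ennreal ((cmod (f x))\<^sup>2) \<partial>M) < \<infinity>" using f(1) by (simp add: L2_def sq_norm_def)
    show "AE x in M. (\<lambda>n. ennreal ((cmod (f x - ?g n x))\<^sup>2)) \<longlonglongrightarrow> 0"
    proof (rule AE_I2)
      fix x assume "x \<in> space M"
      then obtain N where N: "x \<in> E N" using E(3) by auto
      have "x \<in> E n" if "n \<ge> N" for n using incseqD[OF E(1) that] N by auto
      then have "\<forall>\<^sub>F n in sequentially. ennreal ((cmod (f x - ?g n x))\<^sup>2) = 0"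
        by (intro eventually_sequentiallyI[of N]) auto
      then show "(\<lambda>n. ennreal ((cmod (f x - ?g n x))\<^sup>2)) \<longlonglongrightarrow> 0"
        by (rule tendsto_eventually)
    qed
    show "AE x in M. ennreal ((cmod (f x - ?g n x))\<^sup>2) \<le> ennreal ((cmod (f x))\<^sup>2)" for n
      by (auto simp: indicator_def)
  qed auto
  then have "(\<lambda>n. sq_norm M (\<lambda>x. f x - ?g n x)) \<longlonglongrightarrow> 0"
    by (simp add: sq_norm_def)
  then have "\<forall>\<^sub>F n in sequentially. sq_norm M (\<lambda>x. f x - ?g n x) < ennreal (r\<^sup>2)"
    by (rule order_tendstoD) (use r in simp)
  then obtain n where "sq_norm M (\<lambda>x. f x - ?g n x) < ennreal (r\<^sup>2)"
    by (auto simp: eventually_sequentially)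
  then have "hdist K a (cls (?g n)) < r" by (simp add: f g r hdist_less_iff)
  then show "\<exists>y\<in>dom A. y \<in> metric.mball a r"
    using E(4)[of n] dom a by (intro bexI[of _ "cls (?g n)"]) auto
qed auto

lemma continuous_inner_right:
  assumes b: "b \<in> hcarrier K"
  shows "continuous_map (htopology K) euclidean (hinner K b)"
proof -
  have "continuous_map metric.mtopology Met_TC.mtopology (hinner K b)"
    unfolding metric.metric_continuous_map[OF Met_TC.Metric_space_axioms]
  proof (intro conjI ballI allI impI)
    obtain h where h: "h \<in> L2 M" "b = cls h" using b by (auto elim: carrierE)
    fix a and e :: real assume a: "a \<in> hcarrier K" and e: "0 < e"
    obtain f where f: "f \<in> L2 M" "a = cls f" using a by (auto elim: carrierE)
    \<comment> \<open>Adding 1 keeps the divisor in e / c positive when h has norm 0.\<close>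
    define c where "c = sqrt (enn2real (sq_norm M h)) + 1"
    have c: "0 < c" by (simp add: c_def add_nonneg_pos)
    show "\<exists>\<delta>>0. \<forall>x. x \<in> hcarrier K \<and> hdist K a x < \<delta> \<longrightarrow> dist (hinner K b a) (hinner K b x) < e"
    proof (intro exI[of _ "e / c"] conjI allI impI)
      fix x assume x: "x \<in> hcarrier K \<and> hdist K a x < e / c"
      then obtain g where g: "g \<in> L2 M" "x = cls g" by (auto elim: carrierE)
      have "hinner K b a - hinner K b x = L2_inner M h (\<lambda>x. f x - g x)"
        using L2_inner_add_right[of "\<lambda>x. f x - g x" M g h] f g h by (simp add: inner L2_diff)
      then have "dist (hinner K b a) (hinner K b x) \<le> sqrt (enn2real (sq_norm M h)) * hdist K a x"
        using L2_Cauchy_Schwarz[of h M "\<lambda>x. f x - g x"] f g h by (simp add: dist_norm L2_diff hdist_cls)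
      also have "\<dots> \<le> c * hdist K a x"
        by (intro mult_right_mono) (simp_all add: c_def)
      also have "\<dots> < e" using x c by (simp add: pos_less_divide_eq mult.commute)
      finally show "dist (hinner K b a) (hinner K b x) < e" .
    qed (use e c in auto)
  qed auto
  then show ?thesis by (simp add: htopology_def)
qed

text \<open>The graph of an adjoint is the common zero set of continuous functions, namely of the
  inner product of B f with a minus that of f with b. Here B on D plays the operator whose adjoint
  is A.\<close>

lemma closed_operatorI:
  assumes "\<And>f. f \<in> D \<Longrightarrow> f \<in> hcarrier K \<and> B f \<in> hcarrier K"
    and graph: "\<And>a b. A a = Some b \<longleftrightarrow>
      a \<in> hcarrier K \<and> b \<in> hcarrier K \<and> (\<forall>f\<in>D. hinner K (B f) a = hinner K f b)"
  shows "closed_operator K A"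
proof -
  let ?T = "prod_topology (htopology K) (htopology K)"
  have top: "topspace ?T = hcarrier K \<times> hcarrier K"
    by (simp add: htopology_def)
  have cl: "closedin ?T {p \<in> topspace ?T. hinner K (B f) (fst p) - hinner K f (snd p) \<in> {0}}"
    if "f \<in> D" for f
  proof (rule closedin_continuous_map_preimage[where Y = euclidean])
    show "continuous_map ?T euclidean (\<lambda>p. hinner K (B f) (fst p) - hinner K f (snd p))"
      using assms(1)[OF that]
      by (intro continuous_map_diff continuous_map_compose[OF continuous_map_fst, unfolded comp_def]
        continuous_map_compose[OF continuous_map_snd, unfolded comp_def] continuous_inner_right) auto
  qed simp
  have "{(a, b). A a = Some b} =
    topspace ?T \<inter> (\<Inter>f\<in>D. {p \<in> topspace ?T. hinner K (B f) (fst p) - hinner K f (snd p) \<in> {0}})"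
    unfolding top using graph by auto
  also have "closedin ?T \<dots>"
  \<comment> \<open>An intersection over the empty set is the whole type and not the topological
    space, so this case stands apart.\<close>
  proof (cases "D = {}")
    case False
    then show ?thesis by (intro closedin_Int closedin_topspace closedin_INT cl) auto
  next
    case True
    then show ?thesis by (simp only: INF_empty Int_UNIV_right closedin_topspace)
  qed
  finally show ?thesis by (simp add: closed_operator_def)
qed

end

section \<open>Normal operators from measure-preserving bijections and invariant weights\<close>

locale weighted_automorphism =
  fixes M :: "'x measure" and \<tau> \<sigma> :: "'x \<Rightarrow> 'x" and \<phi> :: "'x \<Rightarrow> real"
  assumes \<tau>_measurable [measurable]: "\<tau> \<in> measurable M M"
    and \<sigma>_measurable [measurable]: "\<sigma> \<in> measurable M M"
    and \<phi>_measurable [measurable]: "\<phi> \<in> borel_measurable M"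
    and distr_\<tau>: "distr M M \<tau> = M"
    and \<tau>_\<sigma>: "x \<in> space M \<Longrightarrow> \<tau> (\<sigma> x) = x"
    and \<sigma>_\<tau>: "x \<in> space M \<Longrightarrow> \<sigma> (\<tau> x) = x"
    and \<phi>_\<tau>: "x \<in> space M \<Longrightarrow> \<phi> (\<tau> x) = \<phi> x"
begin

lemma distr_\<sigma>: "distr M M \<sigma> = M"
proof -
  have "distr M M \<sigma> = distr (distr M M \<tau>) M \<sigma>" by (simp add: distr_\<tau>)
  also have "\<dots> = distr M M (\<sigma> \<circ> \<tau>)" by (rule distr_distr) auto
  also have "\<dots> = distr M M (\<lambda>x. x)" by (rule distr_cong) (auto simp: \<sigma>_\<tau>)
  finally show ?thesis by simp
qed

lemma \<phi>_\<sigma>: "x \<in> space M \<Longrightarrow> \<phi> (\<sigma> x) = \<phi> x"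
  using \<phi>_\<tau>[of "\<sigma> x"] measurable_space[OF \<sigma>_measurable] by (simp add: \<tau>_\<sigma>)

text \<open>The hypotheses are symmetric in \<tau> and \<sigma>, so every fact proved for the
  operator built from \<tau> also serves for the one built from \<sigma>, which turns out to be its
  adjoint.\<close>

lemma inverse: "weighted_automorphism M \<sigma> \<tau> \<phi>"
  by standard (auto simp: distr_\<sigma> \<tau>_\<sigma> \<sigma>_\<tau> \<phi>_\<sigma>)

lemma sq_norm_comp:
  assumes [measurable]: "f \<in> borel_measurable M"
  shows "sq_norm M (\<lambda>x. f (\<tau> x)) = sq_norm M f"
proof -
  have "sq_norm (distr M M \<tau>) f = sq_norm M (\<lambda>x. f (\<tau> x))"
    unfolding sq_norm_def by (rule nn_integral_distr) auto
  then show ?thesis by (simp add: distr_\<tau>)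
qed

lemma L2_comp: "f \<in> L2 M \<Longrightarrow> (\<lambda>x. f (\<tau> x)) \<in> L2 M"
  using measurable_compose[OF \<tau>_measurable L2_measurable[of f M]] by (simp add: L2_def sq_norm_comp)

lemma AE_comp:
  assumes "AE x in M. P x" shows "AE x in M. P (\<tau> x)"
proof (rule AE_distrD[OF \<tau>_measurable])
  show "AE x in distr M M \<tau>. P x" unfolding distr_\<tau> by (rule assms)
qed

text \<open>Composition with \<tau> is unitary and commutes with multiplication by the
  \<tau>-invariant function \<phi>; a unitary times a commuting self-adjoint operator is normal.
  Since \<phi> may be unbounded, the domain has to be tracked.\<close>

definition shift_fun :: "('x \<Rightarrow> complex) \<Rightarrow> 'x \<Rightarrow> complex" where
  "shift_fun f x = of_real (\<phi> x) * f (\<tau> x)"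

lemma shift_fun_measurable [measurable]:
  assumes [measurable]: "f \<in> borel_measurable M"
  shows "shift_fun f \<in> borel_measurable M"
  unfolding shift_fun_def by measurable

lemma shift_fun_AE:
  "(AE x in M. f x = g x) \<Longrightarrow> (AE x in M. shift_fun f x = shift_fun g x)"
  using AE_comp[of "\<lambda>x. f x = g x"] by (auto simp: shift_fun_def)

text \<open>By invariance of \<phi>, \<open>shift_fun f\<close> is the function \<phi> f composed
  with \<tau>. So the domain is that of multiplication by \<phi> and does not depend on
  \<tau>.\<close>

lemma shift_fun_L2_iff:
  assumes [measurable]: "f \<in> borel_measurable M"
  shows "shift_fun f \<in> L2 M \<longleftrightarrow> (\<lambda>x. of_real (\<phi> x) * f x) \<in> L2 M"
proof -
  have "sq_norm M (shift_fun f) = sq_norm M (\<lambda>x. of_real (\<phi> (\<tau> x)) * f (\<tau> x))"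
    unfolding sq_norm_def shift_fun_def by (rule nn_integral_cong) (simp add: \<phi>_\<tau>)
  also have "\<dots> = sq_norm M (\<lambda>x. of_real (\<phi> x) * f x)"
    by (rule sq_norm_comp) measurable
  finally show ?thesis by (simp add: L2_def)
qed

text \<open>Change of variables along \<tau>. It is stated for measurable functions because in
  \<open>adjoint_graph\<close> it is not yet known that the function formed from g and \<sigma> is
  square-integrable.\<close>

lemma L2_inner_shift_fun:
  assumes [measurable]: "f \<in> borel_measurable M" "g \<in> borel_measurable M"
  shows "L2_inner M (shift_fun f) g = L2_inner M f (weighted_automorphism.shift_fun \<sigma> \<phi> g)"
proof -
  interpret inv: weighted_automorphism M \<sigma> \<tau> \<phi> by (rule inverse)
  have "L2_inner M f (inv.shift_fun g) = (\<integral>x. f x * cnj (inv.shift_fun g x) \<partial>distr M M \<tau>)"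
    by (simp add: L2_inner_def distr_\<tau>)
  also have "\<dots> = (\<integral>x. f (\<tau> x) * cnj (inv.shift_fun g (\<tau> x)) \<partial>M)"
    by (rule integral_distr) auto
  also have "\<dots> = L2_inner M (shift_fun f) g"
    unfolding L2_inner_def
    by (rule Bochner_Integration.integral_cong) (auto simp: shift_fun_def inv.shift_fun_def \<phi>_\<tau> \<sigma>_\<tau>)
  finally show ?thesis ..
qed

end

locale weighted_automorphism_model = L2_model M K cls + weighted_automorphism M \<tau> \<sigma> \<phi>
  for M :: "'x measure" and K :: "'b hspace" and cls \<tau> \<sigma> \<phi>
begin

text \<open>A class has no canonical member, so one is chosen; \<open>shift_op_cls\<close> shows
  that the choice does not matter.\<close>

definition shift_op :: "'b \<rightharpoonup> 'b" where
  "shift_op a = (let f = (SOME f. f \<in> L2 M \<and> cls f = a) in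
     if a \<in> hcarrier K \<and> shift_fun f \<in> L2 M then Some (cls (shift_fun f)) else None)"

lemma shift_op_cls:
  assumes f: "f \<in> L2 M"
  shows "shift_op (cls f) = (if shift_fun f \<in> L2 M then Some (cls (shift_fun f)) else None)"
proof -
  define g where "g = (SOME g. g \<in> L2 M \<and> cls g = cls f)"
  have g: "g \<in> L2 M \<and> cls g = cls f"
    unfolding g_def by (rule someI[where x = f]) (simp add: f)
  then have AE: "AE x in M. shift_fun g x = shift_fun f x"
    using f by (intro shift_fun_AE) (simp flip: cls_eq_iff)
  have m: "shift_fun f \<in> borel_measurable M" "shift_fun g \<in> borel_measurable M"
    using f g by (auto intro: shift_fun_measurable L2_measurable)
  have "shift_fun g \<in> L2 M \<longleftrightarrow> shift_fun f \<in> L2 M"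
    using m sq_norm_cong_AE[OF AE] by (simp add: L2_def)
  moreover have "cls (shift_fun g) = cls (shift_fun f)" if "shift_fun f \<in> L2 M" "shift_fun g \<in> L2 M"
    using that AE by (simp add: cls_eq_iff)
  ultimately show ?thesis
    unfolding shift_op_def g_def[symmetric] using f by (simp add: Let_def cls_closed)
qed

lemma shift_op_outside: "a \<notin> hcarrier K \<Longrightarrow> shift_op a = None"
  by (simp add: shift_op_def Let_def)

lemma dom_shift_op: "dom shift_op = cls ` {f \<in> L2 M. shift_fun f \<in> L2 M}"
proof (intro equalityI subsetI)
  fix a assume a: "a \<in> dom shift_op"
  then have "a \<in> hcarrier K" using shift_op_outside by fastforce
  then obtain f where f: "f \<in> L2 M" "a = cls f" by (auto elim: carrierE)
  with a have "shift_fun f \<in> L2 M" by (auto simp: shift_op_cls split: if_splits)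
  with f show "a \<in> cls ` {f \<in> L2 M. shift_fun f \<in> L2 M}" by auto
qed (auto simp: shift_op_cls)

lemma shift_fun_add: "shift_fun (\<lambda>x. f x + g x) = (\<lambda>x. shift_fun f x + shift_fun g x)"
  by (auto simp: shift_fun_def distrib_left)

lemma shift_fun_scale: "shift_fun (\<lambda>x. c * f x) = (\<lambda>x. c * shift_fun f x)"
  by (auto simp: shift_fun_def)

lemma shift_fun_zero: "shift_fun (\<lambda>x. 0) = (\<lambda>x. 0)"
  by (auto simp: shift_fun_def)

lemma linear_shift_op: "linear_operator K shift_op"
proof -
  have "hsubspace K (dom shift_op)"
    unfolding hsubspace_def dom_shift_op
    by (auto simp: carrier zero add scale L2_zero L2_add L2_scale shift_fun_add shift_fun_scale
        shift_fun_zero)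
  moreover have "ran shift_op \<subseteq> hcarrier K"
  proof
    fix b assume "b \<in> ran shift_op"
    then obtain a where a: "shift_op a = Some b" by (auto simp: ran_def)
    then have "a \<in> cls ` {f \<in> L2 M. shift_fun f \<in> L2 M}" unfolding dom_shift_op[symmetric] by auto
    with a show "b \<in> hcarrier K" by (auto simp: shift_op_cls cls_closed)
  qed
  ultimately show ?thesis
    unfolding linear_operator_def
    by (auto simp: dom_shift_op shift_op_cls add scale L2_add L2_scale shift_fun_add shift_fun_scale)
qed

text \<open>Multiplication by \<phi> is bounded by n on the set where |\<phi>| \<le> n. These
  truncations make the domain dense and supply the test functions of
  \<open>adjoint_graph\<close>.\<close>

lemma truncation:
  assumes f: "f \<in> L2 M"
  shows "(\<lambda>x. indicator {x \<in> space M. \<bar>\<phi> x\<bar> \<le> real n} x * f x) \<in> L2 M" (is "?g \<in> _")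
    and "shift_fun (\<lambda>x. indicator {x \<in> space M. \<bar>\<phi> x\<bar> \<le> real n} x * f x) \<in> L2 M"
proof -
  have [measurable]: "f \<in> borel_measurable M" using f by (simp add: L2_measurable)
  show g: "?g \<in> L2 M"
    by (rule L2_mono[OF f]) (auto simp: indicator_def)
  have "(\<lambda>x. of_real (\<phi> x) * ?g x) \<in> L2 M"
  proof (rule L2_mono[OF L2_scale[OF g, of "of_nat n"]])
    fix x show "cmod (complex_of_real (\<phi> x) * ?g x) \<le> cmod (of_nat n * ?g x)"
      by (auto simp: indicator_def norm_mult intro!: mult_right_mono)
  qed measurable
  then show "shift_fun ?g \<in> L2 M" by (subst shift_fun_L2_iff) auto
qed

lemma densely_defined_shift_op: "densely_defined K shift_op"
proof (rule densely_definedI)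
  show "dom shift_op \<subseteq> hcarrier K" by (auto simp: dom_shift_op carrier)
  fix f assume f: "f \<in> L2 M"
  show "\<exists>E :: nat \<Rightarrow> 'x set. incseq E \<and> range E \<subseteq> sets M \<and> space M \<subseteq> (\<Union>n. E n) \<and>
      (\<forall>n. cls (\<lambda>x. indicator (E n) x * f x) \<in> dom shift_op)"
  proof (intro exI[of _ "\<lambda>n. {x \<in> space M. \<bar>\<phi> x\<bar> \<le> real n}"] conjI allI)
    show "incseq (\<lambda>n. {x \<in> space M. \<bar>\<phi> x\<bar> \<le> real n})" by (auto simp: incseq_def)
    show "space M \<subseteq> (\<Union>n. {x \<in> space M. \<bar>\<phi> x\<bar> \<le> real n})" by (auto intro: real_arch_simple)
  qed (auto simp: dom_shift_op truncation[OF f])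
qed

lemma adjoint_graph:
  assumes g: "g \<in> L2 M" and h: "h \<in> L2 M"
  shows "(\<forall>a\<in>dom shift_op. hinner K (the (shift_op a)) (cls g) = hinner K a (cls h)) \<longleftrightarrow>
    (AE x in M. weighted_automorphism.shift_fun \<sigma> \<phi> g x = h x)"
proof -
  interpret inv: weighted_automorphism M \<sigma> \<tau> \<phi> by (rule inverse)
  have [measurable]: "g \<in> borel_measurable M" "h \<in> borel_measurable M"
    using g h by (auto simp: L2_measurable)
  have "(\<forall>a\<in>dom shift_op. hinner K (the (shift_op a)) (cls g) = hinner K a (cls h)) \<longleftrightarrow>
    (\<forall>f\<in>L2 M. shift_fun f \<in> L2 M \<longrightarrow> L2_inner M (shift_fun f) g = L2_inner M f h)"
    by (auto simp: dom_shift_op shift_op_cls inner g h)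
  also have "\<dots> \<longleftrightarrow> (\<forall>f\<in>L2 M. shift_fun f \<in> L2 M \<longrightarrow> L2_inner M f (inv.shift_fun g) = L2_inner M f h)"
    by (simp add: L2_inner_shift_fun L2_measurable g)
  also have "\<dots> \<longleftrightarrow> (AE x in M. inv.shift_fun g x = h x)"
  proof
    assume *: "\<forall>f\<in>L2 M. shift_fun f \<in> L2 M \<longrightarrow> L2_inner M f (inv.shift_fun g) = L2_inner M f h"
    have "AE x in M. \<bar>\<phi> x\<bar> \<le> real n \<longrightarrow> inv.shift_fun g x = h x" for n :: nat
    proof -
      let ?I = "\<lambda>x. indicator {x \<in> space M. \<bar>\<phi> x\<bar> \<le> real n} x :: complex"
      let ?g = "\<lambda>x. of_real (\<phi> x) * (?I x * g (\<sigma> x))"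
      let ?h = "\<lambda>x. ?I x * h x"
      \<comment> \<open>The test function is the difference to be shown null, cut down to |\<phi>|
        \<le> n so that it lies in the domain. Pairing it with the untruncated difference gives its
        own squared norm, because it vanishes off the set of truncation.\<close>
      let ?f = "\<lambda>x. ?g x - ?h x"
      have gL: "?g \<in> L2 M"
      proof (rule L2_mono[OF L2_scale[OF inv.L2_comp[OF g], of "of_nat n"]])
        fix x show "cmod (?g x) \<le> cmod (of_nat n * g (\<sigma> x))"
          by (auto simp: indicator_def norm_mult intro!: mult_right_mono)
      qed measurable
      have hL: "?h \<in> L2 M" using truncation(1)[OF h] .
      have fL: "?f \<in> L2 M" using L2_diff[OF gL hL] .
      have feq: "?I x * ?f x = ?f x" for x by (simp add: indicator_def)
      then have "shift_fun ?f \<in> L2 M" using truncation(2)[OF fL, of n] by (simp only: feq)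
      with * fL have "L2_inner M ?f (inv.shift_fun g) = L2_inner M ?f h" by blast
      moreover have "L2_inner M ?f (inv.shift_fun g) = L2_inner M ?f ?g"
        unfolding L2_inner_def by (rule Bochner_Integration.integral_cong)
          (auto simp: indicator_def inv.shift_fun_def)
      moreover have "L2_inner M ?f h = L2_inner M ?f ?h"
        unfolding L2_inner_def by (rule Bochner_Integration.integral_cong)
          (auto simp: indicator_def)
      ultimately have "L2_inner M ?f ?f = 0"
        using L2_inner_add_right[OF fL hL fL] by simp
      then have "sq_norm M ?f = 0"
        using fL by (auto simp: L2_inner_self enn2real_eq_0_iff L2_def)
      then have "AE x in M. ?f x = 0"
        using fL by (subst (asm) sq_norm_eq_0_iff) (simp_all add: L2_measurable)
      then show ?thesis
        by (rule AE_mp) (auto intro!: AE_I2 simp: indicator_def inv.shift_fun_def)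
    qed
    then have "AE x in M. \<forall>n::nat. \<bar>\<phi> x\<bar> \<le> real n \<longrightarrow> inv.shift_fun g x = h x"
      unfolding AE_all_countable by blast
    then show "AE x in M. inv.shift_fun g x = h x"
      by eventually_elim (use real_arch_simple in blast)
  next
    assume AE: "AE x in M. inv.shift_fun g x = h x"
    show "\<forall>f\<in>L2 M. shift_fun f \<in> L2 M \<longrightarrow> L2_inner M f (inv.shift_fun g) = L2_inner M f h"
      unfolding L2_inner_def
    proof (intro ballI impI integral_cong_AE)
      fix f assume "f \<in> L2 M"
      then have [measurable]: "f \<in> borel_measurable M" by (simp add: L2_measurable)
      show "(\<lambda>x. f x * cnj (inv.shift_fun g x)) \<in> borel_measurable M"
        "(\<lambda>x. f x * cnj (h x)) \<in> borel_measurable M" by measurable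
      show "AE x in M. f x * cnj (inv.shift_fun g x) = f x * cnj (h x)"
        using AE by eventually_elim simp
    qed
  qed
  finally show ?thesis .
qed

lemma inverse_model: "weighted_automorphism_model M K cls \<sigma> \<tau> \<phi>"
  by (intro weighted_automorphism_model.intro inverse) unfold_locales

text \<open>\<open>adjoint_graph\<close> determines the image up to a null set, so the class picked
  by \<open>THE\<close> is unique, and it exists exactly when the function formed from g and
  \<sigma> is square-integrable.\<close>

lemma adjoint_shift_op:
  "adjoint_op K shift_op = weighted_automorphism_model.shift_op M K cls \<sigma> \<phi>"
proof
  interpret inv: weighted_automorphism_model M K cls \<sigma> \<tau> \<phi> by (rule inverse_model)
  fix b
  show "adjoint_op K shift_op b = inv.shift_op b"
  proof (cases "b \<in> hcarrier K")
    case True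
    then obtain g where g: "g \<in> L2 M" "b = cls g" by (auto elim: carrierE)
    have m: "inv.shift_fun g \<in> borel_measurable M"
      using g by (intro inv.shift_fun_measurable L2_measurable)
    define P where "P = (\<lambda>h. h \<in> hcarrier K \<and> (\<forall>f\<in>dom shift_op. hinner K (the (shift_op f)) b = hinner K f h))"
    have P: "P a \<longleftrightarrow> inv.shift_fun g \<in> L2 M \<and> a = cls (inv.shift_fun g)" for a
    proof
      assume a: "P a"
      then obtain h where h: "h \<in> L2 M" "a = cls h" by (auto simp: P_def elim: carrierE)
      have AE: "AE x in M. inv.shift_fun g x = h x"
        using a adjoint_graph[OF g(1) h(1)] by (simp add: P_def g h)
      then have "inv.shift_fun g \<in> L2 M"
        by (intro L2_cong_AE[OF h(1) m]) auto
      then show "inv.shift_fun g \<in> L2 M \<and> a = cls (inv.shift_fun g)"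
        using AE h by (auto simp: cls_eq_iff)
    next
      assume a: "inv.shift_fun g \<in> L2 M \<and> a = cls (inv.shift_fun g)"
      then show "P a"
        using adjoint_graph[OF g(1), of "inv.shift_fun g"] by (simp add: P_def g cls_closed)
    qed
    have "adjoint_op K shift_op b = (if b \<in> hcarrier K \<and> (\<exists>h. P h) then Some (THE h. P h) else None)"
      unfolding adjoint_op_def Let_def P_def ..
    also have "\<dots> = inv.shift_op b"
      using True unfolding P by (simp add: g inv.shift_op_cls)
    finally show ?thesis .
  next
    case False
    then show ?thesis by (simp add: adjoint_op_def inv.shift_op_outside)
  qed
qed

text \<open>The operator is the adjoint of the one built from \<sigma>, and adjoints are
  closed.\<close>

lemma closed_shift_op: "closed_operator K shift_op"
proof -
  interpret inv: weighted_automorphism_model M K cls \<sigma> \<tau> \<phi> by (rule inverse_model)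
  show ?thesis
  proof (rule closed_operatorI[where D = "dom inv.shift_op" and B = "\<lambda>a. the (inv.shift_op a)"])
    show "f \<in> hcarrier K \<and> the (inv.shift_op f) \<in> hcarrier K" if "f \<in> dom inv.shift_op" for f
      using that by (auto simp: inv.dom_shift_op inv.shift_op_cls cls_closed)
    fix a b
    show "shift_op a = Some b \<longleftrightarrow> a \<in> hcarrier K \<and> b \<in> hcarrier K \<and>
        (\<forall>f\<in>dom inv.shift_op. hinner K (the (inv.shift_op f)) a = hinner K f b)" (is "?l \<longleftrightarrow> ?r")
    proof (cases "a \<in> hcarrier K")
      case True
      then obtain f where f: "f \<in> L2 M" "a = cls f" by (auto elim: carrierE)
      have m: "shift_fun f \<in> borel_measurable M" using f by (intro shift_fun_measurable L2_measurable)
      show ?thesis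
      proof
        assume ?l
        then have "shift_fun f \<in> L2 M" "b = cls (shift_fun f)"
          by (auto simp: f shift_op_cls split: if_splits)
        then show ?r using inv.adjoint_graph[OF f(1), of "shift_fun f"] f by (simp add: cls_closed)
      next
        assume r: ?r
        then obtain h where h: "h \<in> L2 M" "b = cls h" by (auto elim: carrierE)
        have AE: "AE x in M. shift_fun f x = h x"
          using r inv.adjoint_graph[OF f(1) h(1)] by (simp add: f h)
        then have "shift_fun f \<in> L2 M" by (intro L2_cong_AE[OF h(1) m]) auto
        then show ?l using AE f h by (simp add: shift_op_cls cls_eq_iff)
      qed
    qed (simp add: shift_op_outside)
  qed
qed

text \<open>The right-hand side does not mention \<tau> or \<sigma>. Exchanging them therefore
  yields the same result for the product in the other order, domain included, and this is
  normality.\<close>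

lemma inverse_comp_shift_op:
  assumes f: "f \<in> L2 M"
  shows "(weighted_automorphism_model.shift_op M K cls \<sigma> \<phi> \<circ>\<^sub>m shift_op) (cls f) =
    (if (\<lambda>x. of_real (\<phi> x) * f x) \<in> L2 M \<and> (\<lambda>x. of_real ((\<phi> x)\<^sup>2) * f x) \<in> L2 M
     then Some (cls (\<lambda>x. of_real ((\<phi> x)\<^sup>2) * f x)) else None)"
proof -
  interpret inv: weighted_automorphism_model M K cls \<sigma> \<tau> \<phi> by (rule inverse_model)
  have [measurable]: "f \<in> borel_measurable M" using f by (simp add: L2_measurable)
  have eq: "inv.shift_fun (shift_fun f) x = of_real ((\<phi> x)\<^sup>2) * f x" if "x \<in> space M" for x
    using that by (simp add: inv.shift_fun_def shift_fun_def \<phi>_\<sigma> \<tau>_\<sigma> power2_eq_square)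
  have "inv.shift_fun (shift_fun f) \<in> borel_measurable M" by simp
  then have iff: "inv.shift_fun (shift_fun f) \<in> L2 M \<longleftrightarrow> (\<lambda>x. of_real ((\<phi> x)\<^sup>2) * f x) \<in> L2 M"
    using sq_norm_cong_AE[of "inv.shift_fun (shift_fun f)" "\<lambda>x. of_real ((\<phi> x)\<^sup>2) * f x" M] eq
    by (simp add: L2_def)
  show ?thesis
    using f iff eq
    by (auto simp: map_comp_def shift_op_cls inv.shift_op_cls shift_fun_L2_iff cls_eq_iff)
qed

lemma normal_shift_op: "normal_operator K shift_op"
proof -
  interpret inv: weighted_automorphism_model M K cls \<sigma> \<tau> \<phi> by (rule inverse_model)
  have "inv.shift_op \<circ>\<^sub>m shift_op = shift_op \<circ>\<^sub>m inv.shift_op"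
  proof
    fix a show "(inv.shift_op \<circ>\<^sub>m shift_op) a = (shift_op \<circ>\<^sub>m inv.shift_op) a"
    proof (cases "a \<in> hcarrier K")
      case True
      then show ?thesis
        by (auto elim!: carrierE simp only: inverse_comp_shift_op inv.inverse_comp_shift_op)
    qed (simp add: shift_op_outside inv.shift_op_outside map_comp_def)
  qed
  then show ?thesis
    by (simp add: normal_operator_def linear_shift_op densely_defined_shift_op closed_shift_op
        adjoint_shift_op)
qed

end


section \<open>Weighted shifts on directed forests\<close>

text \<open>A class of functions is represented by the encoded graph of a chosen member.\<close>

lemma exists_L2_model:
  fixes M :: "'x measure" and enc :: "'x \<times> complex \<Rightarrow> 'c"
  assumes enc: "inj enc"
  shows "\<exists>(K :: 'c set hspace) cls. L2_model M K cls"
proof -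
  define sel where "sel f = (SOME g. g \<in> L2 M \<and> (AE x in M. f x = g x))" for f :: "'x \<Rightarrow> complex"
  define cls where "cls f = enc ` {(x, sel f x) |x. True}" for f
  define rep where "rep = inv_into (L2 M) cls"
  define K where "K = \<lparr>hcarrier = cls ` L2 M, hzero = cls (\<lambda>_. 0),
    hadd = (\<lambda>a b. cls (\<lambda>x. rep a x + rep b x)), hscale = (\<lambda>c a. cls (\<lambda>x. c * rep a x)),
    hinner = (\<lambda>a b. L2_inner M (rep a) (rep b))\<rparr>"
  have sel: "sel f \<in> L2 M \<and> (AE x in M. f x = sel f x)" if "f \<in> L2 M" for f
    unfolding sel_def by (rule someI[where x = f]) (simp add: that)
  \<comment> \<open>\<open>SOME\<close> depends on its predicate only, and functions that agree
    almost everywhere satisfy the same predicate, so they select the same member.\<close>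
  have sel_cong: "sel f = sel g" if "AE x in M. f x = g x" for f g
  proof -
    have "(AE x in M. f x = h x) \<longleftrightarrow> (AE x in M. g x = h x)" for h
      using that by (auto elim: eventually_elim2)
    then show ?thesis by (simp add: sel_def)
  qed
  have cls_sel: "cls f = cls g \<longleftrightarrow> sel f = sel g" for f g
  proof -
    have "{(x, sel f x) |x. True} = {(x, sel g x) |x. True} \<longleftrightarrow> sel f = sel g"
      by (auto simp: set_eq_iff fun_eq_iff)
    then show ?thesis unfolding cls_def by (simp add: inj_image_eq_iff[OF enc])
  qed
  have eq: "cls f = cls g \<longleftrightarrow> (AE x in M. f x = g x)" if "f \<in> L2 M" "g \<in> L2 M" for f g
  proof
    assume "cls f = cls g"
    then have "sel f = sel g" by (simp add: cls_sel)
    then show "AE x in M. f x = g x"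
      using sel[OF that(1)] sel[OF that(2)] by (auto elim: eventually_elim2)
  qed (simp add: cls_sel sel_cong)
  have rep: "rep (cls f) \<in> L2 M" "AE x in M. rep (cls f) x = f x" if "f \<in> L2 M" for f
  proof -
    show r: "rep (cls f) \<in> L2 M" unfolding rep_def using that by (intro inv_into_into) auto
    have "cls (rep (cls f)) = cls f" 
      unfolding rep_def by (rule f_inv_into_f[of "cls f" cls "L2 M"]) (use that in auto)
    then show "AE x in M. rep (cls f) x = f x" using eq[OF r that] by simp
  qed
  have "L2_model M K cls"
  proof
    fix f g assume f: "f \<in> L2 M" and g: "g \<in> L2 M"
    have "AE x in M. rep (cls f) x + rep (cls g) x = f x + g x"
      using rep(2)[OF f] rep(2)[OF g] by eventually_elim simp
    then show "hadd K (cls f) (cls g) = cls (\<lambda>x. f x + g x)"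
      using f g rep by (simp add: K_def eq L2_add)
    have "AE x in M. rep (cls f) x * cnj (rep (cls g) x) = f x * cnj (g x)"
      using rep(2)[OF f] rep(2)[OF g] by eventually_elim simp
    then show "hinner K (cls f) (cls g) = L2_inner M f g"
      using f g rep L2_measurable[of _ M]
      by (auto simp: K_def L2_inner_def
          intro!: integral_cong_AE borel_measurable_times borel_measurable_cnj)
  next
    fix f and c :: complex assume f: "f \<in> L2 M"
    have "AE x in M. c * rep (cls f) x = c * f x"
      using rep(2)[OF f] by eventually_elim simp
    then show "hscale K c (cls f) = cls (\<lambda>x. c * f x)"
      using f rep by (simp add: K_def eq L2_scale)
  qed (auto simp: K_def eq)
  then show ?thesis by blast
qed

section \<open>The sequence space as square-integrable functions for counting measure\<close>

definition ell2_cls :: "'v set \<Rightarrow> ('v \<Rightarrow> complex) \<Rightarrow> 'v \<Rightarrow> complex" where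
  "ell2_cls V f v = (if v \<in> V then f v else 0)"

lemma L2_count_space_iff:
  "f \<in> L2 (count_space V) \<longleftrightarrow> (\<lambda>v. (cmod (f v))\<^sup>2) summable_on V"
proof -
  have "f \<in> L2 (count_space V) \<longleftrightarrow> integrable (count_space V) (\<lambda>v. (cmod (f v))\<^sup>2)"
    by (simp add: L2_def sq_norm_def integrable_iff_bounded)
  also have "\<dots> \<longleftrightarrow> (\<lambda>v. (cmod (f v))\<^sup>2) summable_on V"
    by (subst summable_on_iff_abs_summable_on_real)
      (simp only: abs_summable_equivalent abs_summable_on_def)
  finally show ?thesis .
qed

lemma L2_inner_count_space:
  assumes "f \<in> L2 (count_space V)" "g \<in> L2 (count_space V)"
  shows "L2_inner (count_space V) f g = (\<Sum>\<^sub>\<infinity>v\<in>V. f v * cnj (g v))"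
  using infsetsum_infsum[of "\<lambda>v. f v * cnj (g v)" V] L2_integrable[OF assms]
  by (simp add: L2_inner_def infsetsum_def abs_summable_on_def)

text \<open>Counting measure on V has no nonempty null sets but ignores all values outside V, where
  elements of \<open>ell2 V\<close> vanish. Hence a class corresponds to a function set to 0 off
  V.\<close>

lemma ell2_model: "L2_model (count_space V) (ell2 V) (ell2_cls V)"
proof
  show "hcarrier (ell2 V) = ell2_cls V ` L2 (count_space V)"
  proof (intro equalityI subsetI)
    fix f assume "f \<in> hcarrier (ell2 V)"
    then have "f \<in> L2 (count_space V)" "ell2_cls V f = f"
      by (auto simp: ell2_def L2_count_space_iff ell2_cls_def)
    then show "f \<in> ell2_cls V ` L2 (count_space V)" by (metis imageI)
  next
    fix f assume "f \<in> ell2_cls V ` L2 (count_space V)"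
    then obtain g where "g \<in> L2 (count_space V)" "f = ell2_cls V g" by auto
    moreover have "(\<lambda>v. (cmod (ell2_cls V g v))\<^sup>2) summable_on V \<longleftrightarrow> (\<lambda>v. (cmod (g v))\<^sup>2) summable_on V"
      by (rule summable_on_cong) (simp add: ell2_cls_def)
    ultimately show "f \<in> hcarrier (ell2 V)"
      by (simp add: ell2_def L2_count_space_iff) (simp add: ell2_cls_def)
  qed
next
  fix f g assume fg: "f \<in> L2 (count_space V)" "g \<in> L2 (count_space V)"
  show "hinner (ell2 V) (ell2_cls V f) (ell2_cls V g) = L2_inner (count_space V) f g"
    unfolding L2_inner_count_space[OF fg] by (simp add: ell2_def ell2_cls_def cong: infsum_cong)
qed (auto simp: ell2_def ell2_cls_def AE_count_space fun_eq_iff)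

lemma ell2_carrier_iff:
  "f \<in> hcarrier (ell2 V) \<longleftrightarrow> (\<forall>v. v \<notin> V \<longrightarrow> f v = 0) \<and> f \<in> L2 (count_space V)"
  by (simp add: ell2_def L2_count_space_iff)

lemma ell2_cls_id: "f \<in> hcarrier (ell2 V) \<Longrightarrow> ell2_cls V f = f"
  by (auto simp: ell2_carrier_iff ell2_cls_def)

lemma ell2_carrier_L2: "f \<in> hcarrier (ell2 V) \<Longrightarrow> f \<in> L2 (count_space V)"
  by (simp add: ell2_carrier_iff)

lemma ell2_inner:
  assumes "f \<in> hcarrier (ell2 V)" "g \<in> hcarrier (ell2 V)"
  shows "hinner (ell2 V) f g = L2_inner (count_space V) f g"
  using L2_model.inner[OF ell2_model, of f V g] assms by (simp add: ell2_cls_id ell2_carrier_L2)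

lemma ell2_norm:
  assumes "f \<in> hcarrier (ell2 V)"
  shows "ennreal ((hnorm (ell2 V) f)\<^sup>2) = sq_norm (count_space V) f"
  using L2_model.ennreal_hnorm_sq[OF ell2_model, of f V] assms by (simp add: ell2_cls_id ell2_carrier_L2)

lemma ell2_norm_nonneg: "0 \<le> hnorm (ell2 V) f" if "f \<in> hcarrier (ell2 V)"
  using L2_model.hnorm_cls[OF ell2_model, of f V] that by (simp add: ell2_cls_id ell2_carrier_L2)

text \<open>The theorem is stated with \<open>infsum\<close>, the computations use nonnegative
  integrals. Both are suprema of sums over finite sets; countability gives a finite exhaustion for
  monotone convergence.\<close>

lemma nn_integral_count_space_infsum:
  fixes f :: "'v \<Rightarrow> ennreal"
  assumes A: "countable A"
  shows "(\<integral>\<^sup>+v. f v \<partial>count_space A) = infsum f A"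
proof -
  have sup: "infsum f A = (SUP F\<in>{F. finite F \<and> F \<subseteq> A}. sum f F)"
    by (rule nonneg_infsum_complete) simp
  show ?thesis
  proof (rule antisym)
    define E where "E n = {v \<in> A. to_nat_on A v < n}" for n
    have fin: "finite (E n)" for n
      unfolding E_def by (rule finite_imageD[of "to_nat_on A", OF finite_subset[of _ "{..<n}"]])
        (auto intro: inj_on_subset[OF inj_on_to_nat_on[OF A]])
    have "(\<integral>\<^sup>+v. f v \<partial>count_space A) = (\<integral>\<^sup>+v. (SUP n. f v * indicator (E n) v) \<partial>count_space A)"
    proof (rule nn_integral_cong)
      fix v assume v: "v \<in> space (count_space A)"
      show "f v = (SUP n. f v * indicator (E n) v)"
      proof (rule antisym)
        show "f v \<le> (SUP n. f v * indicator (E n) v)"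
          using v by (intro SUP_upper2[of "Suc (to_nat_on A v)"]) (auto simp: E_def)
      qed (auto intro!: SUP_least simp: indicator_def)
    qed
    also have "\<dots> = (SUP n. \<integral>\<^sup>+v. f v * indicator (E n) v \<partial>count_space A)"
      by (intro nn_integral_monotone_convergence_SUP incseq_SucI)
        (auto simp: le_fun_def E_def indicator_def)
    also have "\<dots> \<le> infsum f A"
    proof (rule SUP_least)
      fix n
      have "(\<integral>\<^sup>+v. f v * indicator (E n) v \<partial>count_space A) = (\<Sum>v\<in>E n. f v * indicator (E n) v)"
        by (rule nn_integral_count_space') (use fin in \<open>auto simp: E_def\<close>)
      also have "\<dots> = sum f (E n)" by (rule sum.cong) auto
      also have "\<dots> \<le> infsum f A" unfolding sup
        by (rule SUP_upper) (use fin in \<open>auto simp: E_def\<close>)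
      finally show "(\<integral>\<^sup>+v. f v * indicator (E n) v \<partial>count_space A) \<le> infsum f A" .
    qed
    finally show "(\<integral>\<^sup>+v. f v \<partial>count_space A) \<le> infsum f A" .
    show "infsum f A \<le> (\<integral>\<^sup>+v. f v \<partial>count_space A)"
      unfolding sup
    proof (rule SUP_least)
      fix F assume F: "F \<in> {F. finite F \<and> F \<subseteq> A}"
      have "sum f F = (\<Sum>v\<in>F. f v * indicator F v)" by (rule sum.cong) auto
      also have "\<dots> = (\<integral>\<^sup>+v. f v * indicator F v \<partial>count_space A)"
        by (rule nn_integral_count_space'[symmetric]) (use F in auto)
      also have "\<dots> \<le> (\<integral>\<^sup>+v. f v \<partial>count_space A)"
        by (rule nn_integral_mono) (auto simp: indicator_def)
      finally show "sum f F \<le> (\<integral>\<^sup>+v. f v \<partial>count_space A)" .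
    qed
  qed
qed

section \<open>Weighted shifts defined by a parent map\<close>

locale weighted_forest =
  fixes V V0 :: "'v set" and par :: "'v \<Rightarrow> 'v" and lam :: "'v \<Rightarrow> real"
  assumes countable_V: "countable V" and V0: "V0 \<subseteq> V" and par: "v \<in> V0 \<Longrightarrow> par v \<in> V"
begin

definition children :: "'v \<Rightarrow> 'v set" where
  "children u = {v \<in> V0. par v = u}"

text \<open>Defined on all functions, so that it can be iterated before membership of the iterates
  in \<open>H\<close> is known.\<close>

definition Lam :: "('v \<Rightarrow> complex) \<Rightarrow> 'v \<Rightarrow> complex" where
  "Lam f v = (if v \<in> V0 then of_real (lam v) * f (par v) else 0)"

abbreviation H :: "('v \<Rightarrow> complex) hspace" where "H \<equiv> ell2 V"

definition S :: "('v \<Rightarrow> complex) \<rightharpoonup> ('v \<Rightarrow> complex)" where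
  "S f = (if f \<in> hcarrier H \<and> Lam f \<in> hcarrier H then Some (Lam f) else None)"

text \<open>The value of \<parallel>S^n e_u\<parallel>^2, computed one generation at a time.
  Infinitely many children may make it infinite, hence the extended values.\<close>

primrec weight_power :: "nat \<Rightarrow> 'v \<Rightarrow> ennreal" where
  "weight_power 0 u = 1"
| "weight_power (Suc n) u = (\<integral>\<^sup>+v. ennreal ((lam v)\<^sup>2) * weight_power n v \<partial>count_space (children u))"

lemma weight_power_single:
  "children u = {v} \<Longrightarrow> weight_power (Suc n) u = ennreal ((lam v)\<^sup>2) * weight_power n v"
  by (simp add: nn_integral_count_space_finite)

lemma countable_V0: "countable V0"
  using countable_V V0 countable_subset by blast

text \<open>\<open>V0\<close> is the disjoint union of the sets of children. The factor indicating
  \<open>par v\<close> writes the inner sum over all of \<open>V0\<close>, so that Tonelli exchanges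
  the sums.\<close>

lemma nn_integral_children:
  "(\<integral>\<^sup>+v. g v \<partial>count_space V0) = (\<integral>\<^sup>+u. \<integral>\<^sup>+v. g v \<partial>count_space (children u) \<partial>count_space V)"
proof -
  have "(\<integral>\<^sup>+u. \<integral>\<^sup>+v. g v \<partial>count_space (children u) \<partial>count_space V) =
      (\<integral>\<^sup>+u. \<integral>\<^sup>+v. g v * indicator {par v} u \<partial>count_space V0 \<partial>count_space V)"
  proof (rule nn_integral_cong)
    fix u
    have "(\<integral>\<^sup>+v. g v \<partial>count_space (children u)) =
        (\<integral>\<^sup>+v. g v * indicator (children u) v \<partial>count_space (children u))"
      by (rule nn_integral_cong) simp
    also have "\<dots> = (\<integral>\<^sup>+v. g v * indicator (children u) v \<partial>count_space V0)"
      by (rule nn_integral_count_space_eq) (auto simp: children_def)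
    also have "\<dots> = (\<integral>\<^sup>+v. g v * indicator {par v} u \<partial>count_space V0)"
      by (rule nn_integral_cong) (auto simp: children_def indicator_def)
    finally show "(\<integral>\<^sup>+v. g v \<partial>count_space (children u)) = (\<integral>\<^sup>+v. g v * indicator {par v} u \<partial>count_space V0)" .
  qed
  also have "\<dots> = (\<integral>\<^sup>+v. \<integral>\<^sup>+u. g v * indicator {par v} u \<partial>count_space V \<partial>count_space V0)"
    by (rule nn_integral_count_space_nn_integral) (auto simp: countable_V0)
  also have "\<dots> = (\<integral>\<^sup>+v. g v \<partial>count_space V0)"
  proof (rule nn_integral_cong)
    fix v assume "v \<in> space (count_space V0)"
    then have "(\<integral>\<^sup>+u. g v * indicator {par v} u \<partial>count_space V) = (\<Sum>u\<in>{par v}. g v * indicator {par v} u)"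
      using par by (intro nn_integral_count_space') auto
    then show "(\<integral>\<^sup>+u. g v * indicator {par v} u \<partial>count_space V) = g v" by simp
  qed
  finally show ?thesis ..
qed

text \<open>Fubini for complex summands, through the bijection between pairs (parent, child) and
  \<open>V0\<close>; here absolute summability justifies the regrouping.\<close>

lemma integral_children:
  fixes g :: "'v \<Rightarrow> complex"
  assumes g: "integrable (count_space V0) g"
  shows "(\<integral>v. g v \<partial>count_space V0) = (\<integral>u. \<integral>v. g v \<partial>count_space (children u) \<partial>count_space V)"
proof -
  have bij: "bij_betw snd (Sigma V children) V0"
    by (rule bij_betw_byWitness[where f' = "\<lambda>v. (par v, v)"]) (use par in \<open>auto simp: children_def\<close>)
  have "infsetsum (\<lambda>p. g (snd p)) (Sigma V children) = infsetsum g V0"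
    by (rule infsetsum_reindex_bij_betw[OF bij])
  moreover have "infsetsum (\<lambda>p. g (snd p)) (Sigma V children) = infsetsum (\<lambda>u. infsetsum (\<lambda>v. g (snd (u, v))) (children u)) V"
  proof (rule infsetsum_Sigma)
    show "Infinite_Set_Sum.abs_summable_on (\<lambda>p. g (snd p)) (Sigma V children)"
      using abs_summable_on_reindex_bij_betw[OF bij, of g] g by (simp add: abs_summable_on_def)
  qed (auto simp: countable_V children_def intro: countable_subset[OF _ countable_V0])
  ultimately show ?thesis by (simp add: infsetsum_def)
qed

text \<open>The factor c is what the induction on powers needs: with c =
  \<open>weight_power n\<close> the inner integral is the next \<open>weight_power\<close>.\<close>

lemma nn_integral_Lam:
  "(\<integral>\<^sup>+v. ennreal ((cmod (Lam f v))\<^sup>2) * c v \<partial>count_space V) =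
   (\<integral>\<^sup>+u. ennreal ((cmod (f u))\<^sup>2) * (\<integral>\<^sup>+v. ennreal ((lam v)\<^sup>2) * c v \<partial>count_space (children u)) \<partial>count_space V)"
proof -
  have "(\<integral>\<^sup>+v. ennreal ((cmod (Lam f v))\<^sup>2) * c v \<partial>count_space V) =
     (\<integral>\<^sup>+v. ennreal ((cmod (Lam f v))\<^sup>2) * c v \<partial>count_space V0)"
    by (rule nn_integral_count_space_eq) (use V0 in \<open>auto simp: Lam_def\<close>)
  also have "\<dots> = (\<integral>\<^sup>+u. \<integral>\<^sup>+v. ennreal ((cmod (Lam f v))\<^sup>2) * c v \<partial>count_space (children u) \<partial>count_space V)"
    by (rule nn_integral_children)
  also have "\<dots> = (\<integral>\<^sup>+u. \<integral>\<^sup>+v. ennreal ((cmod (f u))\<^sup>2) * (ennreal ((lam v)\<^sup>2) * c v) \<partial>count_space (children u) \<partial>count_space V)"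
    by (intro nn_integral_cong)
      (auto simp: children_def Lam_def norm_mult power_mult_distrib ennreal_mult mult_ac)
  finally show ?thesis by (simp add: nn_integral_cmult)
qed

lemma sq_norm_Lam_power:
  "(\<integral>\<^sup>+v. ennreal ((cmod ((Lam ^^ n) f v))\<^sup>2) \<partial>count_space V) =
   (\<integral>\<^sup>+u. ennreal ((cmod (f u))\<^sup>2) * weight_power n u \<partial>count_space V)"
proof (induction n arbitrary: f)
  case (Suc n)
  have "(\<integral>\<^sup>+v. ennreal ((cmod ((Lam ^^ Suc n) f v))\<^sup>2) \<partial>count_space V) =
      (\<integral>\<^sup>+v. ennreal ((cmod ((Lam ^^ n) (Lam f) v))\<^sup>2) \<partial>count_space V)"
    by (simp add: funpow_swap1)
  also have "\<dots> = (\<integral>\<^sup>+u. ennreal ((cmod (f u))\<^sup>2) * weight_power (Suc n) u \<partial>count_space V)"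
    by (simp add: Suc.IH nn_integral_Lam)
  finally show ?case .
qed simp

lemma Lam_power_outside: "f \<in> hcarrier H \<Longrightarrow> v \<notin> V \<Longrightarrow> (Lam ^^ n) f v = 0"
  using V0 by (cases n) (auto simp: ell2_carrier_iff Lam_def)

lemma Lam_power_carrier_iff:
  assumes "f \<in> hcarrier H"
  shows "(Lam ^^ n) f \<in> hcarrier H \<longleftrightarrow>
    (\<integral>\<^sup>+u. ennreal ((cmod (f u))\<^sup>2) * weight_power n u \<partial>count_space V) < \<infinity>"
  using Lam_power_outside[OF assms, of _ n]
  by (auto simp: ell2_carrier_iff L2_def sq_norm_def sq_norm_Lam_power[symmetric])

lemma op_power_S:
  "op_power H S n f = (if \<forall>k\<le>n. (Lam ^^ k) f \<in> hcarrier H then Some ((Lam ^^ n) f) else None)"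
proof (induction n)
  case (Suc n)
  have "(\<forall>k\<le>Suc n. (Lam ^^ k) f \<in> hcarrier H) \<longleftrightarrow>
      (\<forall>k\<le>n. (Lam ^^ k) f \<in> hcarrier H) \<and> (Lam ^^ Suc n) f \<in> hcarrier H"
    by (auto simp: le_Suc_eq)
  then show ?case unfolding op_power.simps map_comp_def Suc.IH by (simp add: S_def)
qed (auto simp: restrict_map_def)

lemma dom_infty_iff: "f \<in> dom_infty H S \<longleftrightarrow> (\<forall>n. (Lam ^^ n) f \<in> hcarrier H)"
  unfolding dom_infty_def by (auto simp: dom_def op_power_S split: if_splits)

lemma norm_op_power:
  assumes "f \<in> dom (op_power H S n)"
  shows "ennreal ((hnorm H (the (op_power H S n f)))\<^sup>2) =
    (\<integral>\<^sup>+u. ennreal ((cmod (f u))\<^sup>2) * weight_power n u \<partial>count_space V)"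
proof -
  have "\<forall>k\<le>n. (Lam ^^ k) f \<in> hcarrier H" using assms by (auto simp: op_power_S split: if_splits)
  then show ?thesis
    by (simp add: op_power_S ell2_norm) (simp add: sq_norm_def sq_norm_Lam_power)
qed

lemma carrier_add: "f \<in> hcarrier H \<Longrightarrow> g \<in> hcarrier H \<Longrightarrow> (\<lambda>v. f v + g v) \<in> hcarrier H"
  by (auto simp: ell2_carrier_iff L2_add)

lemma carrier_scale: "f \<in> hcarrier H \<Longrightarrow> (\<lambda>v. c * f v) \<in> hcarrier H"
  by (auto simp: ell2_carrier_iff L2_scale)

lemma Lam_power_add: "(Lam ^^ n) (\<lambda>v. f v + g v) = (\<lambda>v. (Lam ^^ n) f v + (Lam ^^ n) g v)"
  by (induction n) (auto simp: Lam_def distrib_left)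

lemma Lam_power_scale: "(Lam ^^ n) (\<lambda>v. c * f v) = (\<lambda>v. c * (Lam ^^ n) f v)"
  by (induction n) (auto simp: Lam_def)

lemma ell2_simps:
  "hzero H = (\<lambda>_. 0)" "hadd H f g = (\<lambda>v. f v + g v)" "hscale H c f = (\<lambda>v. c * f v)"
  by (simp_all add: ell2_def)

lemma zero_carrier: "(\<lambda>_. 0) \<in> hcarrier H"
  by (simp add: ell2_carrier_iff L2_zero)

lemma hsubspace_dom_infty: "hsubspace H (dom_infty H S)"
proof -
  have "(Lam ^^ n) (\<lambda>_. 0) = (\<lambda>_. 0)" for n using Lam_power_scale[of n 0 "\<lambda>_. 0"] by simp
  moreover have "f \<in> hcarrier H" if "f \<in> dom_infty H S" for f
    using that by (metis dom_infty_iff funpow_0)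
  ultimately show ?thesis
    unfolding hsubspace_def ell2_simps
    by (auto simp: dom_infty_iff Lam_power_add Lam_power_scale carrier_add carrier_scale zero_carrier)
qed

lemma linear_S: "linear_operator H S"
proof -
  have "hsubspace H (dom S)"
    unfolding hsubspace_def ell2_simps dom_def
    using Lam_power_add[of 1] Lam_power_scale[of 1] Lam_power_scale[of 1 0 "\<lambda>_. 0"]
    by (auto simp: S_def carrier_add carrier_scale zero_carrier split: if_splits)
  moreover have "ran S \<subseteq> hcarrier H" by (auto simp: ran_def S_def split: if_splits)
  ultimately show ?thesis
    unfolding linear_operator_def ell2_simps
    using Lam_power_add[of 1] Lam_power_scale[of 1]
    by (auto simp: S_def dom_def carrier_add carrier_scale split: if_splits)
qed

lemma finite_support_carrier:
  assumes F: "finite F" "F \<subseteq> V" and f: "\<And>v. v \<notin> F \<Longrightarrow> f v = 0"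
    and fin: "\<And>v. v \<in> F \<Longrightarrow> weight_power n v < \<infinity>"
  shows "(Lam ^^ n) f \<in> hcarrier H"
proof -
  have *: "(\<integral>\<^sup>+u. ennreal ((cmod (f u))\<^sup>2) * c u \<partial>count_space V) = (\<Sum>u\<in>F. ennreal ((cmod (f u))\<^sup>2) * c u)" for c
    by (rule nn_integral_count_space') (use F f in auto)
  have "sq_norm (count_space V) f < \<infinity>"
    using *[of "\<lambda>_. 1"] F by (simp add: sq_norm_def)
  then have "f \<in> hcarrier H" using f F by (auto simp: ell2_carrier_iff L2_def)
  then show ?thesis using fin F by (simp add: Lam_power_carrier_iff * ennreal_mult_less_top)
qed

lemma basis_vec_dom_infty:
  assumes "u \<in> V" "\<And>n. weight_power n u < \<infinity>"
  shows "basis_vec u \<in> dom_infty H S"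
  unfolding dom_infty_iff
  by (intro allI finite_support_carrier[where F = "{u}"]) (use assms in \<open>auto simp: basis_vec_def\<close>)

lemma hspan_dom_infty:
  assumes "\<And>n u. u \<in> V \<Longrightarrow> weight_power n u < \<infinity>"
  shows "hspan H (basis_vec ` V) \<subseteq> dom_infty H S"
  unfolding hspan_def using hsubspace_dom_infty basis_vec_dom_infty assms by blast

lemma norm_S_basis_vec:
  assumes u: "u \<in> V" and "weight_power 1 u < \<infinity>"
  shows "ennreal ((hnorm H (the (S (basis_vec u))))\<^sup>2) = weight_power 1 u"
proof -
  have c: "(Lam ^^ k) (basis_vec u) \<in> hcarrier H" if "k \<le> 1" for k
    by (rule finite_support_carrier[where F = "{u}"]) (use assms that in \<open>auto simp: basis_vec_def le_Suc_eq\<close>)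
  then have "Lam (basis_vec u) \<in> hcarrier H" using c[of 1] by simp
  then have "ennreal ((hnorm H (the (S (basis_vec u))))\<^sup>2) = sq_norm (count_space V) (Lam (basis_vec u))"
    using c[of 0] by (simp add: S_def ell2_norm)
  also have "\<dots> = (\<integral>\<^sup>+v. ennreal ((cmod (basis_vec u v))\<^sup>2) * weight_power 1 v \<partial>count_space V)"
    using sq_norm_Lam_power[of 1 "basis_vec u"] by (simp add: sq_norm_def)
  also have "\<dots> = (\<Sum>v\<in>{u}. ennreal ((cmod (basis_vec u v))\<^sup>2) * weight_power 1 v)"
    by (rule nn_integral_count_space') (use u in \<open>auto simp: basis_vec_def\<close>)
  finally show ?thesis by (simp add: basis_vec_def)
qed

lemma densely_defined_S:
  assumes fin: "\<And>u. u \<in> V \<Longrightarrow> weight_power 1 u < \<infinity>"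
  shows "densely_defined H S"
proof (rule L2_model.densely_definedI[OF ell2_model])
  show "dom S \<subseteq> hcarrier H" by (auto simp: S_def split: if_splits)
  fix f :: "'v \<Rightarrow> complex"
  let ?E = "\<lambda>n. {v \<in> V. to_nat_on V v < n}"
  have finE: "finite (?E n)" for n
    by (rule finite_imageD[of "to_nat_on V", OF finite_subset[of _ "{..<n}"]])
      (auto intro: inj_on_subset[OF inj_on_to_nat_on[OF countable_V]])
  show "\<exists>E :: nat \<Rightarrow> 'v set. incseq E \<and> range E \<subseteq> sets (count_space V) \<and> space (count_space V) \<subseteq> (\<Union>n. E n) \<and>
      (\<forall>n. ell2_cls V (\<lambda>x. indicator (E n) x * f x) \<in> dom S)"
  proof (intro exI[of _ ?E] conjI allI)
    fix n
    let ?g = "ell2_cls V (\<lambda>x. indicator (?E n) x * f x)"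
    have "(Lam ^^ k) ?g \<in> hcarrier H" if "k \<le> 1" for k
      by (rule finite_support_carrier[where F = "?E n"])
        (use finE fin that in \<open>auto simp: ell2_cls_def le_Suc_eq\<close>)
    from this[of 0] this[of 1] show "?g \<in> dom S" by (simp add: dom_def S_def)
  qed (auto simp: incseq_def)
qed

text \<open>Cauchy-Schwarz over the vertices for |f u| and |f u| w_1(u), followed by w_1^2 \<le>
  w_2, where w_n is \<open>weight_power n\<close>.\<close>

lemma paranormal_S:
  assumes log_convex: "\<And>u. u \<in> V \<Longrightarrow> (weight_power 1 u)\<^sup>2 \<le> weight_power 2 u"
  shows "paranormal H S"
  unfolding paranormal_def
proof
  fix f assume f: "f \<in> dom (op_power H S 2)"
  have c: "(Lam ^^ k) f \<in> hcarrier H" if "k \<le> 2" for k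
    using f that by (auto simp: op_power_S split: if_splits)
  have c0: "f \<in> hcarrier H" and c1: "Lam f \<in> hcarrier H" using c[of 0] c[of 1] by auto
  have S1: "the (S f) = Lam f" using c0 c1 by (simp add: S_def)
  have S2: "the (op_power H S 2 f) = (Lam ^^ 2) f" using c by (simp add: op_power_S)
  let ?c = "\<lambda>u. ennreal (cmod (f u))"
  have cc: "ennreal ((cmod (f u))\<^sup>2) = (?c u)\<^sup>2" for u by (simp add: ennreal_power)
  have "ennreal ((hnorm H (Lam f))\<^sup>2) = (\<integral>\<^sup>+u. (?c u)\<^sup>2 * weight_power 1 u \<partial>count_space V)"
    using sq_norm_Lam_power[of 1 f] c1
    by (simp add: ell2_norm sq_norm_def cc del: weight_power.simps)
  also have "\<dots> = (\<integral>\<^sup>+u. ?c u * (?c u * weight_power 1 u) \<partial>count_space V)"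
    by (simp add: power2_eq_square mult.assoc del: weight_power.simps)
  finally have "(ennreal ((hnorm H (Lam f))\<^sup>2))\<^sup>2 = (\<integral>\<^sup>+u. ?c u * (?c u * weight_power 1 u) \<partial>count_space V)\<^sup>2"
    by (rule arg_cong)
  also have "\<dots> \<le> (\<integral>\<^sup>+u. (?c u)\<^sup>2 \<partial>count_space V) * (\<integral>\<^sup>+u. (?c u * weight_power 1 u)\<^sup>2 \<partial>count_space V)"
    by (rule Cauchy_Schwarz_nn_integral) auto
  also have "\<dots> \<le> (\<integral>\<^sup>+u. (?c u)\<^sup>2 \<partial>count_space V) * (\<integral>\<^sup>+u. (?c u)\<^sup>2 * weight_power 2 u \<partial>count_space V)"
    unfolding power_mult_distrib using log_convex by (intro mult_left_mono nn_integral_mono) auto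
  also have "\<dots> = ennreal ((hnorm H f)\<^sup>2) * ennreal ((hnorm H ((Lam ^^ 2) f))\<^sup>2)"
    using c[of 2] c0 sq_norm_Lam_power[of 2 f]
    by (simp add: ell2_norm sq_norm_def cc del: weight_power.simps)
  finally have "((hnorm H (Lam f))\<^sup>2)\<^sup>2 \<le> (hnorm H f * hnorm H ((Lam ^^ 2) f))\<^sup>2"
    by (simp add: ennreal_power power_mult_distrib flip: ennreal_mult)
  then show "(hnorm H (the (S f)))\<^sup>2 \<le> hnorm H f * hnorm H (the (op_power H S 2 f))"
    unfolding S1 S2 by (rule power2_le_imp_le) (use c0 c[of 2] in \<open>auto intro!: mult_nonneg_nonneg ell2_norm_nonneg\<close>)
qed

end


section \<open>Hyponormality\<close>

lemma integral_count_space_neutral: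
  fixes f :: "'v \<Rightarrow> complex"
  assumes "A \<subseteq> B" "\<And>v. v \<in> B - A \<Longrightarrow> f v = 0"
  shows "(\<integral>v. f v \<partial>count_space B) = (\<integral>v. f v \<partial>count_space A)"
  using infsetsum_cong_neutral[of B A f f] assms unfolding infsetsum_def by auto

lemma integral_count_space_basis_vec:
  assumes "u \<in> V"
  shows "(\<integral>v. basis_vec u v * c v \<partial>count_space V) = c u"
proof -
  have "(\<integral>v. basis_vec u v * c v \<partial>count_space V) = (\<integral>v. basis_vec u v * c v \<partial>count_space {u})"
    by (rule integral_count_space_neutral) (use assms in \<open>auto simp: basis_vec_def\<close>)
  also have "\<dots> = infsetsum (\<lambda>v. basis_vec u v * c v) {u}" by (simp only: infsetsum_def)
  finally show ?thesis by (simp add: basis_vec_def)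
qed

context weighted_forest
begin

text \<open>The formal adjoint. Where the sum over the children does not converge absolutely, the
  integral has the default value 0.\<close>

definition Adj :: "('v \<Rightarrow> complex) \<Rightarrow> 'v \<Rightarrow> complex" where
  "Adj g u = (if u \<in> V then \<integral>v. of_real (lam v) * g v \<partial>count_space (children u) else 0)"

definition child_sum :: "'v \<Rightarrow> ennreal" where
  "child_sum u = (\<Sum>\<^sub>\<infinity>v\<in>children u. ennreal ((lam v)\<^sup>2) / weight_power 1 v)"

lemma inner_Lam:
  assumes f: "Lam f \<in> hcarrier H" and g: "g \<in> hcarrier H"
  shows "hinner H (Lam f) g = (\<integral>u. f u * cnj (Adj g u) \<partial>count_space V)"
proof -
  let ?k = "\<lambda>v. Lam f v * cnj (g v)"
  have int: "integrable (count_space V) ?k"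
    using f g by (intro L2_integrable ell2_carrier_L2)
  have "integrable (count_space V0) ?k"
    using abs_summable_on_subset[of ?k V V0] int V0 by (simp add: abs_summable_on_def)
  then have "(\<integral>v. ?k v \<partial>count_space V0) = (\<integral>u. \<integral>v. ?k v \<partial>count_space (children u) \<partial>count_space V)"
    by (rule integral_children)
  also have "\<dots> = (\<integral>u. f u * cnj (Adj g u) \<partial>count_space V)"
  proof (rule Bochner_Integration.integral_cong)
    fix u assume u: "u \<in> space (count_space V)"
    have "(\<integral>v. ?k v \<partial>count_space (children u)) = (\<integral>v. f u * cnj (of_real (lam v) * g v) \<partial>count_space (children u))"
      by (rule Bochner_Integration.integral_cong) (auto simp: children_def Lam_def mult_ac)
    also have "\<dots> = f u * (\<integral>v. cnj (of_real (lam v) * g v) \<partial>count_space (children u))"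
      by (rule integral_mult_right_zero)
    also have "\<dots> = f u * cnj (Adj g u)"
      using u by (simp only: Bochner_Integration.integral_cnj Adj_def space_count_space if_True)
    finally show "(\<integral>v. ?k v \<partial>count_space (children u)) = f u * cnj (Adj g u)" .
  qed simp
  also have "(\<integral>v. ?k v \<partial>count_space V0) = (\<integral>v. ?k v \<partial>count_space V)"
    by (rule integral_count_space_neutral[symmetric]) (use V0 in \<open>auto simp: Lam_def\<close>)
  finally show ?thesis using f g by (simp add: ell2_inner L2_inner_def)
qed

text \<open>Finiteness of the first weights puts every \<open>basis_vec u\<close> in the domain, and
  testing with it reads off h at u.\<close>

lemma adjoint_condition_iff:
  assumes fin: "\<And>u. u \<in> V \<Longrightarrow> weight_power 1 u < \<infinity>"
    and g: "g \<in> hcarrier H" and h: "h \<in> hcarrier H"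
  shows "(\<forall>f\<in>dom S. hinner H (the (S f)) g = hinner H f h) \<longleftrightarrow> h = Adj g"
proof
  assume *: "\<forall>f\<in>dom S. hinner H (the (S f)) g = hinner H f h"
  show "h = Adj g"
  proof
    fix u
    show "h u = Adj g u"
    proof (cases "u \<in> V")
      case True
      have "(Lam ^^ k) (basis_vec u) \<in> hcarrier H" if "k \<le> 1" for k
        by (rule finite_support_carrier[where F = "{u}"])
          (use fin True that in \<open>auto simp: basis_vec_def le_Suc_eq\<close>)
      from this[of 0] this[of 1] have c: "basis_vec u \<in> hcarrier H" "Lam (basis_vec u) \<in> hcarrier H"
        by auto
      then have "hinner H (Lam (basis_vec u)) g = hinner H (basis_vec u) h"
        using *[rule_format, of "basis_vec u"] by (auto simp: S_def dom_def)
      then have "cnj (Adj g u) = cnj (h u)"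
        unfolding inner_Lam[OF c(2) g] ell2_inner[OF c(1) h] L2_inner_def
          integral_count_space_basis_vec[OF True] .
      then show ?thesis by simp
    qed (use h in \<open>auto simp: Adj_def ell2_carrier_iff\<close>)
  qed
next
  assume eq: "h = Adj g"
  have "hinner H (Lam f) g = hinner H f h" if "f \<in> hcarrier H" "Lam f \<in> hcarrier H" for f
    unfolding inner_Lam[OF that(2) g] ell2_inner[OF that(1) h] L2_inner_def by (simp only: eq)
  then show "\<forall>f\<in>dom S. hinner H (the (S f)) g = hinner H f h"
    by (auto simp: S_def dom_def)
qed

lemma adjoint_S:
  assumes fin: "\<And>u. u \<in> V \<Longrightarrow> weight_power 1 u < \<infinity>"
  shows "adjoint_op H S g = (if g \<in> hcarrier H \<and> Adj g \<in> hcarrier H then Some (Adj g) else None)"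
proof (cases "g \<in> hcarrier H")
  case True
  have P: "(\<lambda>h. h \<in> hcarrier H \<and> (\<forall>f\<in>dom S. hinner H (the (S f)) g = hinner H f h)) =
    (\<lambda>h. Adj g \<in> hcarrier H \<and> h = Adj g)"
    using adjoint_condition_iff[OF fin True] by (intro ext) blast
  show ?thesis unfolding adjoint_op_def P Let_def using True by auto
qed (simp add: adjoint_op_def)

text \<open>\<parallel>S g\<parallel>^2 is a weighted square sum over the vertices, with weight w =
  \<open>weight_power 1\<close>, whereas \<open>Adj g u\<close> is the sum of lam v * g v over the
  children v of u only. By Cauchy-Schwarz \<open>child_sum u\<close> is the best constant C in
  |\<open>Adj g u\<close>|^2 \<le> C * \<Sum> |g v|^2 w(v), and different u involve disjoint sets of
  children.\<close>

lemma hyponormal_S_iff: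
  assumes fin: "\<And>u. u \<in> V \<Longrightarrow> weight_power 1 u < \<infinity>"
    and pos: "\<And>u. u \<in> V \<Longrightarrow> 0 < weight_power 1 u"
  shows "hyponormal H S \<longleftrightarrow> (\<forall>u\<in>V. child_sum u \<le> 1)"
proof -
  define r where "r v = enn2real (weight_power 1 v)" for v
  have r: "weight_power 1 v = ennreal (r v)" "0 < r v" if "v \<in> V" for v
    using fin[OF that] pos[OF that] by (auto simp: r_def enn2real_positive_iff simp del: weight_power.simps)
  have ch: "children u \<subseteq> V" "countable (children u)" for u
    using V0 countable_subset[OF _ countable_V0, of "children u"] by (auto simp: children_def)
  have S_norm: "ennreal ((hnorm H (Lam f))\<^sup>2) = (\<integral>\<^sup>+u. ennreal ((cmod (f u))\<^sup>2) * weight_power 1 u \<partial>count_space V)"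
    if "Lam f \<in> hcarrier H" for f
    using that sq_norm_Lam_power[of 1 f] by (simp add: ell2_norm sq_norm_def del: weight_power.simps)
  have child_term: "ennreal ((lam v)\<^sup>2) / weight_power 1 v = ennreal ((lam v)\<^sup>2 / r v)" if "v \<in> V" for v
    using r[OF that] by (simp add: divide_ennreal del: weight_power.simps)
  show ?thesis
  proof
    assume hypo: "hyponormal H S"
    show "\<forall>u\<in>V. child_sum u \<le> 1"
    proof
      fix u assume u: "u \<in> V"
      have sup: "child_sum u = (SUP F\<in>{F. finite F \<and> F \<subseteq> children u}. \<Sum>v\<in>F. ennreal ((lam v)\<^sup>2) / weight_power 1 v)"
        unfolding child_sum_def by (rule nonneg_infsum_complete) simp
      show "child_sum u \<le> 1" unfolding sup
      proof (rule SUP_least)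
        fix F assume F: "F \<in> {F. finite F \<and> F \<subseteq> children u}"
        then have FV: "finite F" "F \<subseteq> V" "F \<subseteq> children u" using ch by auto
        define s where "s = (\<Sum>v\<in>F. (lam v)\<^sup>2 / r v)"
        have s0: "0 \<le> s" unfolding s_def
          by (intro sum_nonneg divide_nonneg_nonneg) (use r(2) FV in \<open>auto intro: less_imp_le\<close>)
        \<comment> \<open>The case of equality in Cauchy-Schwarz, restricted to finitely many
          children of u. It gives \<parallel>S f\<parallel>^2 = s and \<open>Adj f u\<close> =
          s.\<close>
        define f where "f v = complex_of_real (if v \<in> F then lam v / r v else 0)" for v
        have "(Lam ^^ k) f \<in> hcarrier H" if "k \<le> 1" for k
          by (rule finite_support_carrier[where F = F])
            (use FV fin that in \<open>auto simp: f_def le_Suc_eq\<close>)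
        from this[of 0] this[of 1] have c: "f \<in> hcarrier H" "Lam f \<in> hcarrier H" by auto
        then have fdom: "f \<in> dom S" "the (S f) = Lam f" by (auto simp: S_def)
        have "ennreal ((hnorm H (Lam f))\<^sup>2) = (\<Sum>v\<in>F. ennreal ((cmod (f v))\<^sup>2) * weight_power 1 v)"
          unfolding S_norm[OF c(2)] by (rule nn_integral_count_space') (use FV in \<open>auto simp: f_def\<close>)
        also have "\<dots> = (\<Sum>v\<in>F. ennreal ((lam v)\<^sup>2 / r v))"
        proof (rule sum.cong)
          fix v assume v: "v \<in> F"
          then have "v \<in> V" using FV by auto
          note rv = r[OF this]
          have "(lam v / r v)\<^sup>2 * r v = (lam v)\<^sup>2 / r v"
            using rv(2) by (simp add: power2_eq_square)
          then have "(\<bar>lam v\<bar> / r v)\<^sup>2 * r v = (lam v)\<^sup>2 / r v"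
            by (simp add: power_divide)
          then show "ennreal ((cmod (f v))\<^sup>2) * weight_power 1 v = ennreal ((lam v)\<^sup>2 / r v)"
            using v rv by (simp add: f_def norm_power flip: ennreal_mult del: weight_power.simps of_real_divide)
        qed simp
        also have "\<dots> = ennreal s"
          unfolding s_def using r(2) FV by (intro sum_ennreal) (auto intro!: divide_nonneg_pos)
        finally have nS: "(hnorm H (Lam f))\<^sup>2 = s" using s0 by (simp add: ennreal_inj)
        have "f \<in> dom (adjoint_op H S)" using hypo fdom by (auto simp: hyponormal_def)
        then have A: "Adj f \<in> hcarrier H" "the (adjoint_op H S f) = Adj f"
          by (auto simp: adjoint_S[OF fin] split: if_splits)
        have le: "hnorm H (Adj f) \<le> hnorm H (Lam f)"
          using hypo fdom A unfolding hyponormal_def by metis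
        have "Adj f u = (\<integral>v. of_real (lam v) * f v \<partial>count_space F)"
          using u integral_count_space_neutral[OF FV(3), of "\<lambda>v. of_real (lam v) * f v"]
          by (simp add: Adj_def f_def)
        also have "\<dots> = (\<Sum>v\<in>F. of_real (lam v) * f v)"
          using FV(1) by (simp add: lebesgue_integral_count_space_finite)
        also have "\<dots> = of_real s"
          unfolding s_def of_real_sum by (rule sum.cong) (auto simp: f_def power2_eq_square)
        finally have Au: "Adj f u = of_real s" .
        \<comment> \<open>One coordinate of \<open>Adj f\<close> is bounded by its norm, which
          hyponormality bounds by \<parallel>S f\<parallel>; hence s^2 \<le> s.\<close>
        have "ennreal (s\<^sup>2) = ennreal ((cmod (Adj f u))\<^sup>2)" using s0 by (simp add: Au)
        also have "\<dots> \<le> (\<integral>\<^sup>+v. ennreal ((cmod (Adj f v))\<^sup>2) \<partial>count_space V)"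
          by (rule nn_integral_ge_point[OF u])
        also have "\<dots> = ennreal ((hnorm H (Adj f))\<^sup>2)"
          using ell2_norm[OF A(1)] by (simp add: sq_norm_def)
        also have "\<dots> \<le> ennreal s"
          unfolding nS[symmetric] using le ell2_norm_nonneg[OF A(1)] by (intro ennreal_leI power_mono) auto
        finally have "s\<^sup>2 \<le> s" using s0 by simp
        then have "s \<le> 1" using s0 by (cases "s = 0") (auto simp: power2_eq_square)
        have "(\<Sum>v\<in>F. ennreal ((lam v)\<^sup>2) / weight_power 1 v) = (\<Sum>v\<in>F. ennreal ((lam v)\<^sup>2 / r v))"
          using FV child_term by (intro sum.cong) auto
        also have "\<dots> = ennreal s"
          unfolding s_def using r(2) FV by (intro sum_ennreal) (auto intro!: divide_nonneg_pos)
        also have "\<dots> \<le> 1" using \<open>s \<le> 1\<close> by simp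
        finally show "(\<Sum>v\<in>F. ennreal ((lam v)\<^sup>2) / weight_power 1 v) \<le> 1" .
      qed
    qed
  next
    assume cs: "\<forall>u\<in>V. child_sum u \<le> 1"
    have main: "Adj g \<in> hcarrier H \<and> hnorm H (Adj g) \<le> hnorm H (Lam g)"
      if g: "g \<in> hcarrier H" "Lam g \<in> hcarrier H" for g
    proof -
      have pt: "ennreal ((cmod (Adj g u))\<^sup>2) \<le>
        (\<integral>\<^sup>+v. ennreal ((cmod (g v))\<^sup>2) * weight_power 1 v \<partial>count_space (children u))" if u: "u \<in> V" for u
      proof -
        let ?M = "count_space (children u)"
        have "ennreal (cmod (Adj g u)) \<le> (\<integral>\<^sup>+v. ennreal (cmod (of_real (lam v) * g v)) \<partial>?M)"
        proof (cases "integrable ?M (\<lambda>v. of_real (lam v) * g v)")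
          case True
          then show ?thesis using u integral_norm_bound_ennreal[OF True] by (simp add: Adj_def)
        \<comment> \<open>Without integrability \<open>Adj g u\<close> is 0 by default.\<close>
        qed (simp add: Adj_def not_integrable_integral_eq)
        also have "\<dots> = (\<integral>\<^sup>+v. ennreal (\<bar>lam v\<bar> / sqrt (r v)) * ennreal (cmod (g v) * sqrt (r v)) \<partial>?M)"
        proof (rule nn_integral_cong)
          fix v assume "v \<in> space ?M"
          then have "0 < r v" using ch r(2) by auto
          then show "ennreal (cmod (of_real (lam v) * g v)) =
              ennreal (\<bar>lam v\<bar> / sqrt (r v)) * ennreal (cmod (g v) * sqrt (r v))"
            by (simp add: norm_mult flip: ennreal_mult)
        qed
        finally have "(ennreal (cmod (Adj g u)))\<^sup>2 \<le>
            (\<integral>\<^sup>+v. ennreal (\<bar>lam v\<bar> / sqrt (r v)) * ennreal (cmod (g v) * sqrt (r v)) \<partial>?M)\<^sup>2"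
          by (rule power_mono) simp
        also have "\<dots> \<le> (\<integral>\<^sup>+v. (ennreal (\<bar>lam v\<bar> / sqrt (r v)))\<^sup>2 \<partial>?M) *
            (\<integral>\<^sup>+v. (ennreal (cmod (g v) * sqrt (r v)))\<^sup>2 \<partial>?M)"
          by (rule Cauchy_Schwarz_nn_integral) auto
        also have "(\<integral>\<^sup>+v. (ennreal (\<bar>lam v\<bar> / sqrt (r v)))\<^sup>2 \<partial>?M) = (\<integral>\<^sup>+v. ennreal ((lam v)\<^sup>2) / weight_power 1 v \<partial>?M)"
        proof (rule nn_integral_cong)
          fix v assume "v \<in> space ?M"
          then have v: "v \<in> V" using ch by auto
          then show "(ennreal (\<bar>lam v\<bar> / sqrt (r v)))\<^sup>2 = ennreal ((lam v)\<^sup>2) / weight_power 1 v"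
            unfolding child_term[OF v] using r(2)[OF v] by (simp add: ennreal_power power_divide)
        qed
        also have "\<dots> = child_sum u"
          unfolding child_sum_def by (rule nn_integral_count_space_infsum[OF ch(2)])
        also have "(\<integral>\<^sup>+v. (ennreal (cmod (g v) * sqrt (r v)))\<^sup>2 \<partial>?M) =
            (\<integral>\<^sup>+v. ennreal ((cmod (g v))\<^sup>2) * weight_power 1 v \<partial>?M)"
        proof (rule nn_integral_cong)
          fix v assume "v \<in> space ?M"
          then have v: "v \<in> V" using ch by auto
          show "(ennreal (cmod (g v) * sqrt (r v)))\<^sup>2 = ennreal ((cmod (g v))\<^sup>2) * weight_power 1 v"
            unfolding r(1)[OF v] using r(2)[OF v]
            by (simp add: ennreal_power power_mult_distrib flip: ennreal_mult)
        qed
        also have "child_sum u * \<dots> \<le> 1 * \<dots>"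
          using cs u by (intro mult_right_mono) auto
        finally show ?thesis by (simp add: ennreal_power)
      qed
      have "sq_norm (count_space V) (Adj g) \<le>
          (\<integral>\<^sup>+u. \<integral>\<^sup>+v. ennreal ((cmod (g v))\<^sup>2) * weight_power 1 v \<partial>count_space (children u) \<partial>count_space V)"
        unfolding sq_norm_def by (rule nn_integral_mono) (use pt in simp)
      also have "\<dots> = (\<integral>\<^sup>+v. ennreal ((cmod (g v))\<^sup>2) * weight_power 1 v \<partial>count_space V0)"
        by (rule nn_integral_children[symmetric])
      also have "\<dots> = (\<integral>\<^sup>+v. ennreal ((cmod (g v))\<^sup>2) * weight_power 1 v * indicator V0 v \<partial>count_space V0)"
        by (rule nn_integral_cong) simp
      also have "\<dots> = (\<integral>\<^sup>+v. ennreal ((cmod (g v))\<^sup>2) * weight_power 1 v * indicator V0 v \<partial>count_space V)"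
        by (rule nn_integral_count_space_eq) (use V0 in auto)
      \<comment> \<open>Vertices without a parent are nobody's children; their terms can only
        increase \<parallel>S g\<parallel>^2.\<close>
      also have "\<dots> \<le> (\<integral>\<^sup>+v. ennreal ((cmod (g v))\<^sup>2) * weight_power 1 v \<partial>count_space V)"
        by (rule nn_integral_mono) (auto simp: indicator_def)
      also have "\<dots> = ennreal ((hnorm H (Lam g))\<^sup>2)" using S_norm[OF g(2)] ..
      finally have le: "sq_norm (count_space V) (Adj g) \<le> ennreal ((hnorm H (Lam g))\<^sup>2)" .
      then have A: "Adj g \<in> hcarrier H"
        by (auto simp: ell2_carrier_iff L2_def Adj_def intro: le_less_trans)
      then have "(hnorm H (Adj g))\<^sup>2 \<le> (hnorm H (Lam g))\<^sup>2" using le by (simp flip: ell2_norm)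
      then show ?thesis using A ell2_norm_nonneg[OF g(2)] by (auto intro: power2_le_imp_le)
    qed
    then show "hyponormal H S"
      unfolding hyponormal_def using densely_defined_S[OF fin]
      by (auto simp: adjoint_S[OF fin] S_def dom_def split: if_splits)
  qed
qed

end


section \<open>Forests whose norms are moments\<close>

text \<open>The sum of the measures c v * \<mu> v is countably additive because nonnegative sums can
  be exchanged, and the integral formula passes from indicators to all nonnegative measurable
  functions.\<close>

lemma exists_mixture:
  fixes \<mu> :: "'v \<Rightarrow> 'x measure" and N :: "'x measure" and c :: "'v \<Rightarrow> ennreal"
  assumes A: "countable A" and sets: "\<And>v. v \<in> A \<Longrightarrow> sets (\<mu> v) = sets N"
  shows "\<exists>M. sets M = sets N \<and>
    (\<forall>f\<in>borel_measurable N. (\<integral>\<^sup>+x. f x \<partial>M) = (\<integral>\<^sup>+v. c v * (\<integral>\<^sup>+x. f x \<partial>\<mu> v) \<partial>count_space A))"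
proof -
  define m where "m B = (\<integral>\<^sup>+v. c v * emeasure (\<mu> v) B \<partial>count_space A)" for B
  define M where "M = measure_of (space N) (sets N) m"
  have sets_M: "sets M = sets N"
    unfolding M_def by (simp add: sets.space_closed sets.sigma_sets_eq)
  have em: "emeasure M B = m B" if "B \<in> sets N" for B
  proof (rule emeasure_measure_of[OF M_def])
    show "positive (sets M) m" by (simp add: positive_def m_def)
    show "countably_additive (sets M) m"
      unfolding countably_additive_def
    proof (intro allI impI)
      fix B :: "nat \<Rightarrow> 'x set"
      assume B: "range B \<subseteq> sets M" "disjoint_family B"
      have "(\<Sum>i. m (B i)) = (\<integral>\<^sup>+v. (\<Sum>i. c v * emeasure (\<mu> v) (B i)) \<partial>count_space A)"
        unfolding m_def by (rule nn_integral_suminf[symmetric]) simp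
      also have "\<dots> = m (\<Union>i. B i)"
        unfolding m_def
        by (intro nn_integral_cong, subst ennreal_suminf_cmult, subst suminf_emeasure)
          (use B sets sets_M in auto)
      finally show "(\<Sum>i. m (B i)) = m (\<Union>i. B i)" .
    qed
  qed (use that sets_M sets.space_closed in auto)
  have "(\<integral>\<^sup>+x. f x \<partial>M) = (\<integral>\<^sup>+v. c v * (\<integral>\<^sup>+x. f x \<partial>\<mu> v) \<partial>count_space A)"
    if "f \<in> borel_measurable N" for f
    using that
  proof (induction rule: borel_measurable_induct)
    case (cong f g)
    have "(\<integral>\<^sup>+x. f x \<partial>M) = (\<integral>\<^sup>+x. g x \<partial>M)"
      by (rule nn_integral_cong) (use cong sets_eq_imp_space_eq[OF sets_M] in auto)
    moreover have "(\<integral>\<^sup>+v. c v * (\<integral>\<^sup>+x. f x \<partial>\<mu> v) \<partial>count_space A) = (\<integral>\<^sup>+v. c v * (\<integral>\<^sup>+x. g x \<partial>\<mu> v) \<partial>count_space A)"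
      by (intro nn_integral_cong arg_cong2[where f = "(*)"] refl)
        (use cong sets_eq_imp_space_eq[OF sets] in auto)
    ultimately show ?case using cong by simp
  next
    case (set B)
    then have "(\<integral>\<^sup>+x. indicator B x \<partial>M) = m B" using em sets_M by simp
    also have "\<dots> = (\<integral>\<^sup>+v. c v * (\<integral>\<^sup>+x. indicator B x \<partial>\<mu> v) \<partial>count_space A)"
      unfolding m_def by (rule nn_integral_cong) (use set sets in simp)
    finally show ?case .
  next
    case (mult u a)
    have "(\<integral>\<^sup>+x. a * u x \<partial>M) = a * (\<integral>\<^sup>+x. u x \<partial>M)"
      by (rule nn_integral_cmult) (use mult sets_M in \<open>simp cong: measurable_cong_sets\<close>)
    also have "\<dots> = (\<integral>\<^sup>+v. a * (c v * (\<integral>\<^sup>+x. u x \<partial>\<mu> v)) \<partial>count_space A)"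
      unfolding mult.IH by (rule nn_integral_cmult[symmetric]) simp
    also have "\<dots> = (\<integral>\<^sup>+v. c v * (\<integral>\<^sup>+x. a * u x \<partial>\<mu> v) \<partial>count_space A)"
    proof (rule nn_integral_cong)
      fix v assume "v \<in> space (count_space A)"
      then have "u \<in> borel_measurable (\<mu> v)" using mult sets by (simp cong: measurable_cong_sets)
      then show "a * (c v * (\<integral>\<^sup>+x. u x \<partial>\<mu> v)) = c v * (\<integral>\<^sup>+x. a * u x \<partial>\<mu> v)"
        by (simp add: nn_integral_cmult mult_ac)
    qed
    finally show ?case .
  next
    case (add u w)
    have "(\<integral>\<^sup>+x. w x + u x \<partial>M) = (\<integral>\<^sup>+x. w x \<partial>M) + (\<integral>\<^sup>+x. u x \<partial>M)"
      by (rule nn_integral_add) (use add sets_M in \<open>simp_all cong: measurable_cong_sets\<close>)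
    also have "\<dots> = (\<integral>\<^sup>+v. c v * (\<integral>\<^sup>+x. w x \<partial>\<mu> v) + c v * (\<integral>\<^sup>+x. u x \<partial>\<mu> v) \<partial>count_space A)"
      unfolding add.IH by (rule nn_integral_add[symmetric]) simp_all
    also have "\<dots> = (\<integral>\<^sup>+v. c v * (\<integral>\<^sup>+x. w x + u x \<partial>\<mu> v) \<partial>count_space A)"
    proof (rule nn_integral_cong)
      fix v assume "v \<in> space (count_space A)"
      then have "u \<in> borel_measurable (\<mu> v)" "w \<in> borel_measurable (\<mu> v)"
        using add sets by (simp_all cong: measurable_cong_sets)
      then show "c v * (\<integral>\<^sup>+x. w x \<partial>\<mu> v) + c v * (\<integral>\<^sup>+x. u x \<partial>\<mu> v) = c v * (\<integral>\<^sup>+x. w x + u x \<partial>\<mu> v)"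
        by (simp add: nn_integral_add distrib_left)
    qed
    finally show ?case .
  next
    case (seq U)
    have sup: "(\<integral>\<^sup>+x. (SUP i. U i) x \<partial>\<mu>') = (SUP i. \<integral>\<^sup>+x. U i x \<partial>\<mu>')" if "sets \<mu>' = sets N" for \<mu>'
      unfolding SUP_apply by (rule nn_integral_monotone_convergence_SUP)
        (use seq that in \<open>simp_all cong: measurable_cong_sets\<close>)
    have "(\<integral>\<^sup>+x. (SUP i. U i) x \<partial>M) = (SUP i. \<integral>\<^sup>+v. c v * (\<integral>\<^sup>+x. U i x \<partial>\<mu> v) \<partial>count_space A)"
      unfolding sup[OF sets_M] seq.IH ..
    also have "\<dots> = (\<integral>\<^sup>+v. (SUP i. c v * (\<integral>\<^sup>+x. U i x \<partial>\<mu> v)) \<partial>count_space A)"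
    proof (rule nn_integral_monotone_convergence_SUP[symmetric])
      show "incseq (\<lambda>i v. c v * (\<integral>\<^sup>+x. U i x \<partial>\<mu> v))"
        using seq by (auto simp: incseq_def le_fun_def intro!: mult_left_mono nn_integral_mono)
    qed simp
    also have "\<dots> = (\<integral>\<^sup>+v. c v * (\<integral>\<^sup>+x. (SUP i. U i) x \<partial>\<mu> v) \<partial>count_space A)"
    proof (rule nn_integral_cong)
      fix v assume "v \<in> space (count_space A)"
      then show "(SUP i. c v * (\<integral>\<^sup>+x. U i x \<partial>\<mu> v)) = c v * (\<integral>\<^sup>+x. (SUP i. U i) x \<partial>\<mu> v)"
        using sup[of "\<mu> v"] sets by (simp only: SUP_mult_left_ennreal space_count_space)
    qed
    finally show ?case .
  qed
  then show ?thesis using sets_M by blast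
qed

lemma borel_measure_nonneg_measurable:
  assumes "borel_measure_nonneg \<mu>" "f \<in> measurable borel N"
  shows "f \<in> measurable \<mu> N"
  using assms measurable_restrict_space1[OF assms(2), of "{0..}"]
  by (simp add: borel_measure_nonneg_def cong: measurable_cong_sets)

lemma borel_measure_nonneg_space:
  assumes "borel_measure_nonneg \<mu>"
  shows "space \<mu> = {0..}"
  using sets_eq_imp_space_eq[of \<mu> "restrict_space borel {0..}"] assms
  by (simp add: borel_measure_nonneg_def space_restrict_space)

lemma borel_measure_nonneg_sets:
  assumes "borel_measure_nonneg \<mu>" "B \<in> sets borel" "B \<subseteq> {0..}"
  shows "B \<in> sets \<mu>"
  using assms by (auto simp: borel_measure_nonneg_def sets_restrict_space_iff)

text \<open>On the half-line the powers are nonnegative, so a Bochner moment is the same as a finite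
  nonnegative integral. Moments can then be computed in \<open>ennreal\<close>.\<close>

lemma S_representing_iff:
  "S_representing a \<mu> \<longleftrightarrow> borel_measure_nonneg \<mu> \<and>
    (\<forall>n. 0 \<le> a n \<and> (\<integral>\<^sup>+x. ennreal (x ^ n) \<partial>\<mu>) = ennreal (a n))"
proof (cases "borel_measure_nonneg \<mu>")
  case True
  have "has_bochner_integral \<mu> (\<lambda>x. x ^ n) (a n) \<longleftrightarrow>
      0 \<le> a n \<and> (\<integral>\<^sup>+x. ennreal (x ^ n) \<partial>\<mu>) = ennreal (a n)" for n
  proof
    assume *: "has_bochner_integral \<mu> (\<lambda>x. x ^ n) (a n)"
    have "AE x in \<mu>. 0 \<le> x ^ n" by (rule AE_I2) (simp add: borel_measure_nonneg_space[OF True])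
    moreover from this have "0 \<le> integral\<^sup>L \<mu> (\<lambda>x. x ^ n)" by (rule integral_nonneg_AE)
    ultimately show "0 \<le> a n \<and> (\<integral>\<^sup>+x. ennreal (x ^ n) \<partial>\<mu>) = ennreal (a n)"
      using * by (simp add: has_bochner_integral_iff nn_integral_eq_integral)
  next
    assume *: "0 \<le> a n \<and> (\<integral>\<^sup>+x. ennreal (x ^ n) \<partial>\<mu>) = ennreal (a n)"
    show "has_bochner_integral \<mu> (\<lambda>x. x ^ n) (a n)"
    proof (rule has_bochner_integral_nn_integral)
      show "(\<lambda>x. x ^ n) \<in> borel_measurable \<mu>"
        by (rule borel_measure_nonneg_measurable[OF True]) simp
      show "AE x in \<mu>. 0 \<le> x ^ n" by (rule AE_I2) (simp add: borel_measure_nonneg_space[OF True])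
    qed (use * in auto)
  qed
  then show ?thesis by (simp add: S_representing_def)
qed (simp add: S_representing_def)

lemma first_moment_sq_le:
  assumes "borel_measure_nonneg \<mu>"
  shows "(\<integral>\<^sup>+x. ennreal x \<partial>\<mu>)\<^sup>2 \<le> emeasure \<mu> (space \<mu>) * (\<integral>\<^sup>+x. ennreal (x\<^sup>2) \<partial>\<mu>)"
proof -
  have [measurable]: "ennreal \<in> borel_measurable \<mu>"
    by (rule borel_measure_nonneg_measurable[OF assms]) simp
  have "(\<integral>\<^sup>+x. 1 * ennreal x \<partial>\<mu>)\<^sup>2 \<le> (\<integral>\<^sup>+x. 1\<^sup>2 \<partial>\<mu>) * (\<integral>\<^sup>+x. (ennreal x)\<^sup>2 \<partial>\<mu>)"
    by (rule Cauchy_Schwarz_nn_integral) auto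
  also have "(\<integral>\<^sup>+x. (ennreal x)\<^sup>2 \<partial>\<mu>) = (\<integral>\<^sup>+x. ennreal (x\<^sup>2) \<partial>\<mu>)"
    by (rule nn_integral_cong) (simp add: borel_measure_nonneg_space[OF assms] ennreal_power)
  finally show ?thesis by simp
qed

text \<open>Since \<open>weight_power 0\<close> is 1, the case n = 0 of \<open>moments\<close> makes
  every \<open>\<mu> u\<close> a probability measure.\<close>

locale moment_forest = weighted_forest V V0 par lam
  for V V0 :: "'v set" and par :: "'v \<Rightarrow> 'v" and lam :: "'v \<Rightarrow> real" +
  fixes \<mu> :: "'v \<Rightarrow> real measure"
  assumes borel_\<mu>: "u \<in> V \<Longrightarrow> borel_measure_nonneg (\<mu> u)"
    and moments: "u \<in> V \<Longrightarrow> (\<integral>\<^sup>+x. ennreal (x ^ n) \<partial>\<mu> u) = weight_power n u"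
    and finite_moments: "u \<in> V \<Longrightarrow> weight_power n u < \<infinity>"
begin

lemma first_weight_power_sq_le: "(weight_power 1 u)\<^sup>2 \<le> weight_power 2 u" if u: "u \<in> V"
proof -
  have "emeasure (\<mu> u) (space (\<mu> u)) = 1" using moments[OF u, of 0] by simp
  then show ?thesis
    using first_moment_sq_le[OF borel_\<mu>[OF u]] moments[OF u, of 1] moments[OF u, of 2]
    by (simp del: weight_power.simps)
qed

lemma paranormal: "paranormal H S"
  using first_weight_power_sq_le by (rule paranormal_S)

lemma Stieltjes_norm_powers:
  assumes f: "f \<in> dom_infty H S"
  shows "Stieltjes_moment_seq (\<lambda>n. (hnorm H (the (op_power H S n f)))\<^sup>2)"
proof -
  let ?N = "restrict_space borel {0::real..}"
  obtain M where M: "sets M = sets ?N"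
    "\<And>g. g \<in> borel_measurable ?N \<Longrightarrow>
      (\<integral>\<^sup>+x. g x \<partial>M) = (\<integral>\<^sup>+u. ennreal ((cmod (f u))\<^sup>2) * (\<integral>\<^sup>+x. g x \<partial>\<mu> u) \<partial>count_space V)"
    using exists_mixture[OF countable_V, of \<mu> ?N "\<lambda>u. ennreal ((cmod (f u))\<^sup>2)"] borel_\<mu>
    by (auto simp: borel_measure_nonneg_def)
  have "(\<integral>\<^sup>+x. ennreal (x ^ n) \<partial>M) = ennreal ((hnorm H (the (op_power H S n f)))\<^sup>2)" for n
  proof -
    have "(\<integral>\<^sup>+x. ennreal (x ^ n) \<partial>M) = (\<integral>\<^sup>+u. ennreal ((cmod (f u))\<^sup>2) * (\<integral>\<^sup>+x. ennreal (x ^ n) \<partial>\<mu> u) \<partial>count_space V)"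
      by (rule M(2)) (simp add: measurable_restrict_space1)
    also have "\<dots> = (\<integral>\<^sup>+u. ennreal ((cmod (f u))\<^sup>2) * weight_power n u \<partial>count_space V)"
      by (rule nn_integral_cong) (simp add: moments)
    also have "\<dots> = ennreal ((hnorm H (the (op_power H S n f)))\<^sup>2)"
      using f by (intro norm_op_power[symmetric]) (auto simp: dom_infty_def)
    finally show ?thesis .
  qed
  then have "S_representing (\<lambda>n. (hnorm H (the (op_power H S n f)))\<^sup>2) M"
    using M(1) by (simp add: S_representing_iff borel_measure_nonneg_def)
  then show ?thesis unfolding Stieltjes_moment_seq_def by blast
qed

text \<open>Write w_n for \<open>weight_power n\<close>. With a single child v, w_1(u) = lam(v)^2
  and w_2(u) = lam(v)^2 w_1(v), so the sum lam(v)^2 / w_1(v) equals w_1(u)^2 / w_2(u). Log-convexity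
  at u is exactly the claim.\<close>

lemma child_sum_single_le:
  assumes u: "u \<in> V" and ch: "children u = {v}" and pos: "0 < lam v" "0 < weight_power 1 v"
  shows "child_sum u \<le> 1"
proof -
  have v: "v \<in> V" using ch V0 by (auto simp: children_def)
  obtain r where r: "weight_power 1 v = ennreal r" "0 < r"
    using finite_moments[OF v, of 1] pos(2) by (cases "weight_power 1 v") auto
  have w1: "weight_power 1 u = ennreal ((lam v)\<^sup>2)"
    using weight_power_single[OF ch, of 0] by simp
  have w2: "weight_power 2 u = ennreal ((lam v)\<^sup>2) * weight_power 1 v"
    using weight_power_single[OF ch, of 1] by (simp add: numeral_2_eq_2)
  have "ennreal (((lam v)\<^sup>2)\<^sup>2) \<le> ennreal ((lam v)\<^sup>2 * r)"
    using first_weight_power_sq_le[OF u] pos r(2)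
    unfolding w1 w2 r(1) by (simp add: ennreal_power ennreal_mult)
  then have "(lam v)\<^sup>2 * (lam v)\<^sup>2 \<le> (lam v)\<^sup>2 * r"
    using r(2) by (simp add: power2_eq_square[of "(lam v)\<^sup>2"])
  moreover have "0 < (lam v)\<^sup>2" using pos(1) by simp
  ultimately have "(lam v)\<^sup>2 \<le> r" by (simp only: mult_le_cancel_left_pos)
  then show ?thesis
    unfolding child_sum_def ch using r by (simp add: divide_ennreal ennreal_le_1 del: weight_power.simps)
qed

end


section \<open>The tree with one branching vertex\<close>

lemma trunk_in_tree_verts_iff: "Trunk k \<in> tree_verts \<eta> \<kappa> \<longleftrightarrow> enat k \<le> \<kappa>"
  by (cases k) (auto simp: tree_verts_def J_def zero_enat_def[symmetric])

lemma branch_in_tree_verts_iff: "Branch i j \<in> tree_verts \<eta> \<kappa> \<longleftrightarrow> i \<in> J \<eta> \<and> 1 \<le> j"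
  by (auto simp: tree_verts_def)

lemma trunk_in_tree_verts_nonroot_iff: "Trunk k \<in> tree_verts_nonroot \<eta> \<kappa> \<longleftrightarrow> enat k < \<kappa>"
  by (auto simp: tree_verts_nonroot_def trunk_in_tree_verts_iff)

lemma branch_in_tree_verts_nonroot_iff: "Branch i j \<in> tree_verts_nonroot \<eta> \<kappa> \<longleftrightarrow> i \<in> J \<eta> \<and> 1 \<le> j"
  by (auto simp: tree_verts_nonroot_def branch_in_tree_verts_iff)

lemma parent_trunk: "enat k < \<kappa> \<Longrightarrow> parent \<eta> \<kappa> (Trunk k) = Trunk (Suc k)"
  unfolding parent_def
  by (rule the_equality) (auto simp: tree_edges_def J_def Suc_ile_eq intro!: exI[of _ "Suc k"])

lemma parent_branch_1: "i \<in> J \<eta> \<Longrightarrow> parent \<eta> \<kappa> (Branch i (Suc 0)) = Trunk 0"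
  unfolding parent_def by (rule the_equality) (auto simp: tree_edges_def)

lemma parent_branch_Suc: "i \<in> J \<eta> \<Longrightarrow> 1 \<le> j \<Longrightarrow> parent \<eta> \<kappa> (Branch i (Suc j)) = Branch i j"
  unfolding parent_def by (rule the_equality) (auto simp: tree_edges_def)

lemma countable_tree_verts: "countable (tree_verts \<eta> \<kappa>)"
proof -
  have "tree_verts \<eta> \<kappa> \<subseteq> range Trunk \<union> range (\<lambda>(i, j). Branch i j)"
    by (auto simp: tree_verts_def)
  then show ?thesis by (rule countable_subset) auto
qed

locale tree_data =
  fixes \<eta> \<kappa> :: enat and \<gamma> :: "int \<Rightarrow> real" and \<nu> \<rho> :: "real measure" and \<Omega> :: "nat \<Rightarrow> real set"
  assumes gamma_pos: "\<And>n. n \<in> ints_from_minus \<kappa> \<Longrightarrow> 0 < \<gamma> n"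
    and gamma_0: "\<gamma> 0 = 1"
    and nu: "borel_measure_nonneg \<nu>"
    and gamma_moments:
      "\<And>n. n \<in> ints_from_minus \<kappa> \<Longrightarrow> (\<integral>\<^sup>+x. ennreal x powi n \<partial>\<nu>) = ennreal (\<gamma> n)"
    and rho: "S_representing (\<lambda>n. \<gamma> (int n + 1)) \<rho>"
    and rho_inverse_moment: "(\<integral>\<^sup>+x. 1 / ennreal x \<partial>\<rho>) < \<infinity>"
    and Omega_borel: "\<And>i. i \<in> J \<eta> \<Longrightarrow> \<Omega> i \<in> sets borel"
    and Omega_disjoint: "disjoint_family_on \<Omega> (J \<eta>)"
    and Omega_pos: "\<And>i. i \<in> J \<eta> \<Longrightarrow> 0 < emeasure \<rho> (\<Omega> i)"
    and Omega_union: "(\<Union>i\<in>J \<eta>. \<Omega> i) = {0<..}"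
begin

abbreviation "V \<equiv> tree_verts \<eta> \<kappa>"
abbreviation "V0 \<equiv> tree_verts_nonroot \<eta> \<kappa>"
abbreviation "lam \<equiv> shift_weight \<gamma> \<rho> \<Omega>"

sublocale weighted_forest V V0 "parent \<eta> \<kappa>" lam
proof
  fix v assume v: "v \<in> V0"
  show "parent \<eta> \<kappa> v \<in> V"
  proof (cases v)
    case (Trunk k)
    then show ?thesis using v
      by (simp add: trunk_in_tree_verts_nonroot_iff parent_trunk trunk_in_tree_verts_iff Suc_ile_eq)
  next
    case (Branch i j)
    then have ij: "i \<in> J \<eta>" "1 \<le> j" using v by (auto simp: branch_in_tree_verts_nonroot_iff)
    show ?thesis
    proof (cases "j = 1")
      case True
      then show ?thesis using ij Branch
        by (simp add: parent_branch_1 trunk_in_tree_verts_iff zero_enat_def[symmetric])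
    next
      case False
      then obtain j' where "j = Suc j'" "1 \<le> j'" using ij by (cases j) auto
      then show ?thesis using ij Branch by (simp add: parent_branch_Suc branch_in_tree_verts_iff)
    qed
  qed
qed (auto simp: countable_tree_verts tree_verts_nonroot_def)

lemma weighted_shift_eq: "weighted_shift \<eta> \<kappa> lam = S"
proof -
  have "shift_map \<eta> \<kappa> lam f = Lam f" for f by (auto simp: shift_map_def Lam_def)
  then show ?thesis by (auto simp: weighted_shift_def S_def)
qed

lemma V0_cases:
  assumes "v \<in> V0"
  obtains k where "v = Trunk k" "enat k < \<kappa>" "parent \<eta> \<kappa> v = Trunk (Suc k)"
  | i where "v = Branch i 1" "i \<in> J \<eta>" "parent \<eta> \<kappa> v = Trunk 0"
  | i j where "v = Branch i (Suc j)" "i \<in> J \<eta>" "1 \<le> j" "parent \<eta> \<kappa> v = Branch i j"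
proof (cases v)
  case (Trunk k)
  then show ?thesis using that(1) assms by (simp add: trunk_in_tree_verts_nonroot_iff parent_trunk)
next
  case (Branch i j)
  then have ij: "i \<in> J \<eta>" "1 \<le> j" using assms by (auto simp: branch_in_tree_verts_nonroot_iff)
  show ?thesis
  proof (cases "j = 1")
    case True
    then show ?thesis using that(2)[of i] ij Branch by (simp add: parent_branch_1)
  next
    case False
    then obtain j' where "j = Suc j'" "1 \<le> j'" using ij by (cases j) auto
    then show ?thesis using ij Branch that(3)[of i j'] by (simp add: parent_branch_Suc)
  qed
qed

lemma children_trunk_0: "children (Trunk 0) = (\<lambda>i. Branch i 1) ` J \<eta>"
  by (auto simp: children_def branch_in_tree_verts_nonroot_iff parent_branch_1 elim: V0_cases)

lemma children_trunk_Suc: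
  assumes "Trunk (Suc k) \<in> V" shows "children (Trunk (Suc k)) = {Trunk k}"
proof -
  have k: "enat k < \<kappa>" using assms by (simp add: trunk_in_tree_verts_iff Suc_ile_eq)
  then show ?thesis
    by (auto simp: children_def trunk_in_tree_verts_nonroot_iff parent_trunk elim: V0_cases)
qed

lemma children_branch:
  assumes "Branch i j \<in> V" shows "children (Branch i j) = {Branch i (Suc j)}"
proof -
  have "i \<in> J \<eta>" "1 \<le> j" using assms by (auto simp: branch_in_tree_verts_iff)
  then show ?thesis
    by (auto simp: children_def branch_in_tree_verts_nonroot_iff parent_branch_Suc elim: V0_cases)
qed

lemma countable_J: "countable (J \<eta>)" by simp

lemma borel_rho: "borel_measure_nonneg \<rho>"
  using rho by (simp add: S_representing_def)

lemmas space_rho = borel_measure_nonneg_space[OF borel_rho]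
lemmas space_nu = borel_measure_nonneg_space[OF nu]

lemma rho_measurable: "f \<in> measurable borel N \<Longrightarrow> f \<in> measurable \<rho> N"
  by (rule borel_measure_nonneg_measurable[OF borel_rho])

lemma nu_measurable: "f \<in> measurable borel N \<Longrightarrow> f \<in> measurable \<nu> N"
  by (rule borel_measure_nonneg_measurable[OF nu])

lemma Omega_positive: "i \<in> J \<eta> \<Longrightarrow> x \<in> \<Omega> i \<Longrightarrow> 0 < x"
  using Omega_union by auto

lemma Omega_sets_rho: "i \<in> J \<eta> \<Longrightarrow> \<Omega> i \<in> sets \<rho>"
  using Omega_positive[of i]
  by (intro borel_measure_nonneg_sets[OF borel_rho Omega_borel]) (auto intro: less_imp_le)

text \<open>With 1/0 = \<infinity> the finite integral of 1/x leaves no mass at 0, so the sets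
  \<open>\<Omega> i\<close>, which cover only the positive half-line, carry all of \<rho>.\<close>

lemma AE_rho_positive: "AE x in \<rho>. 0 < x"
proof -
  have "(\<lambda>x. 1 / ennreal x) \<in> borel_measurable \<rho>" by (rule rho_measurable) measurable
  then have "AE x in \<rho>. 1 / ennreal x \<noteq> \<infinity>"
    using rho_inverse_moment by (intro nn_integral_PInf_AE) auto
  then show ?thesis
    using AE_space
  proof eventually_elim
    case (elim x)
    then show ?case by (cases "x = 0") (auto simp: space_rho)
  qed
qed

lemma rho_moment: "(\<integral>\<^sup>+x. ennreal (x ^ n) \<partial>\<rho>) = ennreal (\<gamma> (int n + 1))"
  using rho by (simp add: S_representing_iff)

lemma nn_integral_rho_split:
  assumes f: "f \<in> borel_measurable borel"
  shows "(\<integral>\<^sup>+x. f x \<partial>\<rho>) = (\<integral>\<^sup>+i. (\<integral>\<^sup>+x. f x * indicator (\<Omega> i) x \<partial>\<rho>) \<partial>count_space (J \<eta>))"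
proof -
  have [measurable]: "f \<in> borel_measurable \<rho>" using f by (rule rho_measurable)
  have "(\<integral>\<^sup>+x. f x \<partial>\<rho>) = (\<integral>\<^sup>+x. (\<integral>\<^sup>+i. f x * indicator (\<Omega> i) x \<partial>count_space (J \<eta>)) \<partial>\<rho>)"
  proof (rule nn_integral_cong_AE, use AE_rho_positive in eventually_elim)
    case (elim x)
    then obtain i where i: "i \<in> J \<eta>" "x \<in> \<Omega> i" using Omega_union by auto
    have "x \<notin> \<Omega> k" if "k \<in> J \<eta>" "k \<noteq> i" for k
      using Omega_disjoint i that by (auto simp: disjoint_family_on_def)
    then have "(\<integral>\<^sup>+i. f x * indicator (\<Omega> i) x \<partial>count_space (J \<eta>)) = (\<Sum>i\<in>{i}. f x * indicator (\<Omega> i) x)"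
      using i by (intro nn_integral_count_space') auto
    then show ?case using i by simp
  qed
  also have "\<dots> = (\<integral>\<^sup>+i. (\<integral>\<^sup>+x. f x * indicator (\<Omega> i) x \<partial>\<rho>) \<partial>count_space (J \<eta>))"
  proof (rule nn_integral_count_space_nn_integral)
    fix i assume "i \<in> J \<eta>"
    then have [measurable]: "\<Omega> i \<in> sets \<rho>" by (rule Omega_sets_rho)
    show "(\<lambda>x. f x * indicator (\<Omega> i) x) \<in> borel_measurable \<rho>" by measurable
  qed simp
  finally show ?thesis .
qed

section \<open>Moments over the branches and along the trunk\<close>

definition branch_moment :: "nat \<Rightarrow> nat \<Rightarrow> real" where
  "branch_moment i n = enn2real (\<integral>\<^sup>+x. ennreal (x ^ n) * indicator (\<Omega> i) x \<partial>\<rho>)"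

text \<open>On \<open>\<Omega> i\<close> all powers of x are positive, and \<open>\<Omega> i\<close>
  has positive measure, so the moment cannot vanish. It can therefore serve as a divisor
  throughout.\<close>

lemma branch_moment:
  assumes i: "i \<in> J \<eta>"
  shows "(\<integral>\<^sup>+x. ennreal (x ^ n) * indicator (\<Omega> i) x \<partial>\<rho>) = ennreal (branch_moment i n)"
    and "0 < branch_moment i n"
proof -
  note [measurable] = Omega_sets_rho[OF i]
  have [measurable]: "(\<lambda>x. ennreal (x ^ n)) \<in> borel_measurable \<rho>" by (rule rho_measurable) measurable
  let ?I = "\<integral>\<^sup>+x. ennreal (x ^ n) * indicator (\<Omega> i) x \<partial>\<rho>"
  have "?I \<le> (\<integral>\<^sup>+x. ennreal (x ^ n) \<partial>\<rho>)" by (rule nn_integral_mono) (auto simp: indicator_def)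
  then have fin: "?I < \<infinity>" unfolding rho_moment by (auto intro: le_less_trans)
  then show "?I = ennreal (branch_moment i n)" by (simp add: branch_moment_def)
  have "?I \<noteq> 0"
  proof
    assume "?I = 0"
    then have "AE x in \<rho>. ennreal (x ^ n) * indicator (\<Omega> i) x = 0"
      by (subst (asm) nn_integral_0_iff_AE) measurable
    then have "AE x in \<rho>. x \<notin> \<Omega> i"
    proof eventually_elim
      case (elim x)
      have "0 < x ^ n" if "x \<in> \<Omega> i" using Omega_positive[OF i that] by (rule zero_less_power)
      with elim show ?case by (auto simp: ennreal_eq_0_iff not_le[symmetric])
    qed
    then have "emeasure \<rho> (\<Omega> i) = 0"
      using AE_iff_measurable[of "\<Omega> i" \<rho> "\<lambda>x. x \<notin> \<Omega> i"] sets.sets_into_space[OF Omega_sets_rho[OF i]]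
        Omega_sets_rho[OF i] by auto
    then show False using Omega_pos[OF i] by simp
  qed
  then show "0 < branch_moment i n" using fin by (simp add: branch_moment_def enn2real_positive_iff zero_less_iff_neq_zero)
qed

lemma branch_moment_neq_0 [simp]: "i \<in> J \<eta> \<Longrightarrow> branch_moment i n \<noteq> 0"
  using branch_moment(2)[of i n] by simp

lemma emeasure_Omega: "i \<in> J \<eta> \<Longrightarrow> emeasure \<rho> (\<Omega> i) = ennreal (branch_moment i 0)"
  using branch_moment(1)[of i 0] Omega_sets_rho[of i] by simp

lemma integral_branch_measure:
  assumes i: "i \<in> J \<eta>"
  shows "(\<integral>x. x ^ n \<partial>branch_measure \<rho> \<Omega> i) = branch_moment i n / branch_moment i 0"
proof -
  have [measurable]: "(\<lambda>x. x ^ n) \<in> borel_measurable \<rho>" by (rule rho_measurable) measurable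
  have "(\<integral>x. x ^ n \<partial>branch_measure \<rho> \<Omega> i) = enn2real (\<integral>\<^sup>+x. ennreal (x ^ n) \<partial>branch_measure \<rho> \<Omega> i)"
    unfolding branch_measure_def by (rule integral_eq_nn_integral) (auto simp: space_rho)
  also have "(\<integral>\<^sup>+x. ennreal (x ^ n) \<partial>branch_measure \<rho> \<Omega> i) =
      ennreal (branch_moment i n) / ennreal (branch_moment i 0)"
    unfolding branch_measure_def using Omega_sets_rho[OF i]
    by (subst nn_integral_uniform_measure) (auto simp: branch_moment[OF i] emeasure_Omega[OF i])
  finally show ?thesis
    using branch_moment(2)[OF i] by (simp add: divide_ennreal less_imp_le)
qed

lemma lam_branch_1_sq: "i \<in> J \<eta> \<Longrightarrow> (lam (Branch i 1))\<^sup>2 = branch_moment i 0"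
  using branch_moment(2)[of i 0] by (simp add: measure_def emeasure_Omega less_imp_le)

text \<open>The normalising factor of the branch measure cancels in the quotient, so the product of
  the squared weights from (i, 1) down to (i, j + 1) telescopes to the moment of order j.\<close>

lemma lam_branch_Suc_sq:
  assumes i: "i \<in> J \<eta>" and j: "1 \<le> j"
  shows "(lam (Branch i (Suc j)))\<^sup>2 = branch_moment i j / branch_moment i (j - 1)"
proof -
  have "Suc j - 2 = j - 1" by simp
  then show ?thesis
    using j branch_moment(2)[OF i]
    by (simp add: integral_branch_measure[OF i] i less_imp_le)
qed

lemma in_ints_from_minus: "Trunk k \<in> V \<Longrightarrow> int n - int k \<in> ints_from_minus \<kappa>"
proof -
  assume "Trunk k \<in> V"
  moreover have "nat (- (int n - int k)) \<le> k" by simp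
  ultimately show ?thesis
    unfolding ints_from_minus_def trunk_in_tree_verts_iff mem_Collect_eq
    by (meson enat_ord_simps(1) order_trans)
qed

lemma gamma_trunk_pos: "Trunk k \<in> V \<Longrightarrow> 0 < \<gamma> (int n - int k)"
  using in_ints_from_minus gamma_pos by blast

lemma lam_trunk_sq:
  assumes "Trunk (Suc k) \<in> V"
  shows "(lam (Trunk k))\<^sup>2 = \<gamma> (- int k) / \<gamma> (- int (Suc k))"
proof -
  have "0 < \<gamma> (- int (Suc k))" using gamma_trunk_pos[OF assms, of 0] by simp
  moreover have "0 < \<gamma> (- int k)" using gamma_trunk_pos[OF assms, of 1] by simp
  moreover have "- (int k + 1) = - int (Suc k)" by simp
  ultimately show ?thesis by (simp only: shift_weight.simps) (simp add: divide_nonneg_nonneg less_imp_le)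
qed

text \<open>In \<open>ennreal\<close> the inverse of 0 is \<infinity>, so finiteness of \<gamma> at
  -1, which belongs to the data once there is a vertex -1, excludes an atom of \<nu> at 0.\<close>

lemma AE_nu_positive:
  assumes "Trunk (Suc k) \<in> V" shows "AE x in \<nu>. 0 < x"
proof -
  have "- 1 \<in> ints_from_minus \<kappa>" using in_ints_from_minus[OF assms, of k] by simp
  from gamma_moments[OF this] have "(\<integral>\<^sup>+x. inverse (ennreal x) \<partial>\<nu>) < \<infinity>"
    by (simp add: power_int_def)
  moreover have "(\<lambda>x. inverse (ennreal x)) \<in> borel_measurable \<nu>" by (rule nu_measurable) measurable
  ultimately have "AE x in \<nu>. inverse (ennreal x) \<noteq> \<infinity>"
    by (intro nn_integral_PInf_AE) auto
  then show ?thesis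
    using AE_space
  proof eventually_elim
    case (elim x)
    then show ?case by (cases "x = 0") (auto simp: space_nu)
  qed
qed

lemma nu_moment:
  assumes k: "Trunk k \<in> V"
  shows "(\<integral>\<^sup>+x. inverse (ennreal x) ^ k * ennreal (x ^ n) \<partial>\<nu>) = ennreal (\<gamma> (int n - int k))"
proof -
  have "(\<integral>\<^sup>+x. inverse (ennreal x) ^ k * ennreal (x ^ n) \<partial>\<nu>) = (\<integral>\<^sup>+x. ennreal x powi (int n - int k) \<partial>\<nu>)"
  proof (cases k)
    \<comment> \<open>An atom at 0 may be present here, but no negative power of x occurs, and the
      integrands agree pointwise.\<close>
    case 0
    then show ?thesis
      by (intro nn_integral_cong) (simp add: space_nu ennreal_power power_int_def)
  next
    case (Suc k')
    show ?thesis
    proof (rule nn_integral_cong_AE, use AE_nu_positive[OF k[unfolded Suc]] in eventually_elim)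
      case (elim x)
      have "ennreal x powi (int n - int k) = ennreal (x powi (int n - int k))"
        using elim by (simp add: power_int_def ennreal_power inverse_ennreal)
      also have "x powi (int n - int k) = inverse x ^ k * x ^ n"
        using elim by (simp add: power_int_diff field_simps)
      finally show ?case using elim by (simp add: inverse_ennreal ennreal_power ennreal_mult)
    qed
  qed
  then show ?thesis using gamma_moments[OF in_ints_from_minus[OF k]] by simp
qed

definition vertex_measure :: "vertex \<Rightarrow> real measure" where
  "vertex_measure u = (case u of
     Trunk k \<Rightarrow> density \<nu> (\<lambda>x. inverse (ennreal x) ^ k * ennreal (1 / \<gamma> (- int k)))
   | Branch i j \<Rightarrow>
       density \<rho> (\<lambda>x. ennreal (x ^ (j - 1)) * indicator (\<Omega> i) x * ennreal (1 / branch_moment i (j - 1))))"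

definition vertex_moment :: "nat \<Rightarrow> vertex \<Rightarrow> real" where
  "vertex_moment n u = (case u of
     Trunk k \<Rightarrow> \<gamma> (int n - int k) / \<gamma> (- int k)
   | Branch i j \<Rightarrow> branch_moment i (j - 1 + n) / branch_moment i (j - 1))"

lemma borel_vertex_measure: "borel_measure_nonneg (vertex_measure u)"
  using nu borel_rho by (auto simp: vertex_measure_def borel_measure_nonneg_def split: vertex.split)

lemma vertex_moment_pos:
  assumes "u \<in> V" shows "0 < vertex_moment n u"
  using assms gamma_trunk_pos[of _ n] gamma_trunk_pos[of _ 0] branch_moment(2)
  by (cases u) (auto simp: vertex_moment_def branch_in_tree_verts_iff)

lemma nn_integral_vertex_measure:
  assumes u: "u \<in> V"
  shows "(\<integral>\<^sup>+x. ennreal (x ^ n) \<partial>vertex_measure u) = ennreal (vertex_moment n u)"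
proof (cases u)
  case (Trunk k)
  have k: "Trunk k \<in> V" using u Trunk by simp
  have [measurable]: "(\<lambda>x. ennreal (x ^ n)) \<in> borel_measurable \<nu>"
    "(\<lambda>x. inverse (ennreal x) ^ k) \<in> borel_measurable \<nu>"
    by (rule nu_measurable, measurable)+
  have "(\<integral>\<^sup>+x. ennreal (x ^ n) \<partial>vertex_measure u) =
      (\<integral>\<^sup>+x. ennreal (1 / \<gamma> (- int k)) * (inverse (ennreal x) ^ k * ennreal (x ^ n)) \<partial>\<nu>)"
    unfolding vertex_measure_def Trunk vertex.case
    by (subst nn_integral_density) (auto simp: mult_ac)
  also have "\<dots> = ennreal (1 / \<gamma> (- int k)) * ennreal (\<gamma> (int n - int k))"
    by (subst nn_integral_cmult) (auto simp: nu_moment[OF k])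
  also have "\<dots> = ennreal (vertex_moment n u)"
    using gamma_trunk_pos[OF k, of n] gamma_trunk_pos[OF k, of 0]
    by (simp add: vertex_moment_def Trunk flip: ennreal_mult)
  finally show ?thesis .
next
  case (Branch i j)
  have i: "i \<in> J \<eta>" using u Branch by (simp add: branch_in_tree_verts_iff)
  note [measurable] = Omega_sets_rho[OF i]
  have [measurable]: "(\<lambda>x. ennreal (x ^ m)) \<in> borel_measurable \<rho>" for m
    by (rule rho_measurable) measurable
  have "(\<integral>\<^sup>+x. ennreal (x ^ n) \<partial>vertex_measure u) =
      (\<integral>\<^sup>+x. ennreal (1 / branch_moment i (j - 1)) * (ennreal (x ^ (j - 1 + n)) * indicator (\<Omega> i) x) \<partial>\<rho>)"
    unfolding vertex_measure_def Branch vertex.case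
  proof (subst nn_integral_density)
    show "(\<integral>\<^sup>+x. ennreal (x ^ (j - 1)) * indicator (\<Omega> i) x * ennreal (1 / branch_moment i (j - 1)) * ennreal (x ^ n) \<partial>\<rho>) =
      (\<integral>\<^sup>+x. ennreal (1 / branch_moment i (j - 1)) * (ennreal (x ^ (j - 1 + n)) * indicator (\<Omega> i) x) \<partial>\<rho>)"
      by (rule nn_integral_cong) (simp add: space_rho power_add ennreal_mult mult_ac)
  qed measurable
  also have "\<dots> = ennreal (1 / branch_moment i (j - 1)) * ennreal (branch_moment i (j - 1 + n))"
    by (subst nn_integral_cmult) (auto simp: branch_moment[OF i])
  also have "\<dots> = ennreal (vertex_moment n u)"
    using branch_moment(2)[OF i, of "j - 1"] branch_moment(2)[OF i, of "j - 1 + n"]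
    by (simp add: vertex_moment_def Branch flip: ennreal_mult)
  finally show ?thesis .
qed

text \<open>The quotients telescope at a vertex with one child. At the branching vertex, \<lambda>^2
  times the n-th moment of branch i is the integral of x^n over \<open>\<Omega> i\<close>; these add
  up to the n-th moment of \<rho>, which is \<gamma> at n + 1, hence the moment of order n + 1 of
  \<nu>.\<close>

lemma weight_power_eq: "u \<in> V \<Longrightarrow> weight_power n u = ennreal (vertex_moment n u)"
proof (induction n arbitrary: u)
  case 0
  then show ?case
    using gamma_trunk_pos[of _ 0]
    by (cases u) (auto simp: vertex_moment_def branch_in_tree_verts_iff dest: less_imp_neq[symmetric])
next
  case (Suc n)
  consider (branch) i j where "u = Branch i j" | (trunk) k where "u = Trunk (Suc k)" | (zero) "u = Trunk 0"
    by (metis vertex.exhaust not0_implies_Suc)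
  then show ?case
  proof cases
    case (branch i j)
    then have ij: "i \<in> J \<eta>" "1 \<le> j" using Suc.prems by (auto simp: branch_in_tree_verts_iff)
    have "Branch i (Suc j) \<in> V" using ij by (simp add: branch_in_tree_verts_iff)
    then have "weight_power (Suc n) u =
        ennreal (branch_moment i j / branch_moment i (j - 1)) * ennreal (branch_moment i (j + n) / branch_moment i j)"
      unfolding branch weight_power_single[OF children_branch[OF Suc.prems[unfolded branch]]]
        lam_branch_Suc_sq[OF ij] by (simp add: Suc.IH vertex_moment_def)
    also have "\<dots> = ennreal (branch_moment i (j + n) / branch_moment i (j - 1))"
      using branch_moment(2)[OF ij(1)] by (simp add: less_imp_le less_imp_neq[symmetric] flip: ennreal_mult)
    also have "j + n = j - 1 + Suc n" using ij by simp
    finally show ?thesis by (simp add: vertex_moment_def branch)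
  next
    case (trunk k)
    have kV: "Trunk (Suc k) \<in> V" "Trunk k \<in> V"
      using Suc.prems by (auto simp: trunk trunk_in_tree_verts_iff Suc_ile_eq)
    have "weight_power (Suc n) u =
        ennreal (\<gamma> (- int k) / \<gamma> (- int (Suc k))) * ennreal (\<gamma> (int n - int k) / \<gamma> (- int k))"
      unfolding trunk weight_power_single[OF children_trunk_Suc[OF kV(1)]] lam_trunk_sq[OF kV(1)]
        Suc.IH[OF kV(2)] by (simp add: vertex_moment_def)
    also have "\<dots> = ennreal (\<gamma> (int n - int k) / \<gamma> (- int (Suc k)))"
      using gamma_trunk_pos[OF kV(2), of 0] gamma_trunk_pos[OF kV(2), of n] gamma_trunk_pos[OF kV(1), of 0]
      by (simp add: less_imp_le less_imp_neq[symmetric] del: of_nat_Suc flip: ennreal_mult)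
    finally show ?thesis by (simp add: vertex_moment_def trunk)
  next
    case zero
    have "weight_power (Suc n) u = (\<integral>\<^sup>+i. ennreal ((lam (Branch i 1))\<^sup>2) * weight_power n (Branch i 1) \<partial>count_space (J \<eta>))"
      unfolding zero weight_power.simps children_trunk_0
      by (rule nn_integral_bij_count_space[symmetric]) (auto simp: bij_betw_def inj_on_def)
    also have "\<dots> = (\<integral>\<^sup>+i. (\<integral>\<^sup>+x. ennreal (x ^ n) * indicator (\<Omega> i) x \<partial>\<rho>) \<partial>count_space (J \<eta>))"
    proof (rule nn_integral_cong)
      fix i assume "i \<in> space (count_space (J \<eta>))"
      then have i: "i \<in> J \<eta>" by simp
      then have "Branch i 1 \<in> V" by (simp add: branch_in_tree_verts_iff)
      then have "weight_power n (Branch i 1) = ennreal (branch_moment i n / branch_moment i 0)"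
        by (simp add: Suc.IH vertex_moment_def)
      then show "ennreal ((lam (Branch i 1))\<^sup>2) * weight_power n (Branch i 1) =
          (\<integral>\<^sup>+x. ennreal (x ^ n) * indicator (\<Omega> i) x \<partial>\<rho>)"
        unfolding lam_branch_1_sq[OF i] branch_moment(1)[OF i]
        using branch_moment(2)[OF i, of 0] branch_moment(2)[OF i, of n]
        by (simp add: less_imp_le less_imp_neq[symmetric] flip: ennreal_mult)
    qed
    also have "\<dots> = (\<integral>\<^sup>+x. ennreal (x ^ n) \<partial>\<rho>)"
      by (rule nn_integral_rho_split[symmetric]) measurable
    also have "\<dots> = ennreal (vertex_moment (Suc n) u)"
      by (simp add: rho_moment vertex_moment_def zero gamma_0 add.commute)
    finally show ?thesis .
  qed
qed

sublocale moment_forest V V0 "parent \<eta> \<kappa>" lam vertex_measure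
  by standard (auto simp: borel_vertex_measure nn_integral_vertex_measure weight_power_eq)

lemma lam_pos: "v \<in> V0 \<Longrightarrow> 0 < lam v"
proof (erule V0_cases)
  fix k assume "v = Trunk k" "enat k < \<kappa>"
  then have "Trunk (Suc k) \<in> V" by (simp add: trunk_in_tree_verts_iff Suc_ile_eq)
  then have "0 < \<gamma> (- int (Suc k))" "0 < \<gamma> (- int k)"
    using gamma_trunk_pos[of "Suc k" 0] gamma_trunk_pos[of "Suc k" 1] by simp_all
  moreover have "- (int k + 1) = - int (Suc k)" by simp
  ultimately show "0 < lam v" unfolding \<open>v = Trunk k\<close> shift_weight.simps by (simp only:) simp
next
  fix i assume "v = Branch i 1" "i \<in> J \<eta>"
  then show "0 < lam v" using branch_moment(2)[of i 0] by (simp add: measure_def emeasure_Omega)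
next
  fix i j assume "v = Branch i (Suc j)" "i \<in> J \<eta>" "1 \<le> j"
  then show "0 < lam v" using branch_moment(2)[of i] by (simp add: integral_branch_measure)
qed

lemma hyponormal_iff_child_sum: "hyponormal H S \<longleftrightarrow> child_sum (Trunk 0) \<le> 1"
proof -
  have pos: "0 < weight_power 1 u" if "u \<in> V" for u
    using vertex_moment_pos[OF that, of 1] by (simp add: weight_power_eq[OF that] del: weight_power.simps)
  have "child_sum u \<le> 1" if u: "u \<in> V" "u \<noteq> Trunk 0" for u
  proof -
    obtain v where ch: "children u = {v}"
      using u children_trunk_Suc children_branch by (metis vertex.exhaust not0_implies_Suc)
    then have v: "v \<in> V0" by (auto simp: children_def)
    then have "v \<in> V" using V0 by auto
    show ?thesis by (rule child_sum_single_le[OF u(1) ch lam_pos[OF v] pos[OF \<open>v \<in> V\<close>]])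
  qed
  moreover have "Trunk 0 \<in> V" by (simp add: trunk_in_tree_verts_iff zero_enat_def[symmetric])
  ultimately show ?thesis
    using hyponormal_S_iff[OF finite_moments pos] by auto
qed

text \<open>With b_n = \<open>branch_moment i n\<close>, \<lambda>^2 is b_0 and \<parallel>S
  e\<parallel>^2 is b_1 / b_0, the mean of the branch measure.\<close>

lemma branch_term:
  assumes i: "i \<in> J \<eta>"
  shows "ennreal ((lam (Branch i 1))\<^sup>2) / ennreal ((hnorm H (the (S (basis_vec (Branch i 1)))))\<^sup>2) =
      ennreal ((branch_moment i 0)\<^sup>2 / branch_moment i 1)"
    and "ennreal ((hnorm H (the (S (basis_vec (Branch i 1)))))\<^sup>2) = weight_power 1 (Branch i 1)"
proof -
  have v: "Branch i 1 \<in> V" using i by (simp add: branch_in_tree_verts_iff)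
  show *: "ennreal ((hnorm H (the (S (basis_vec (Branch i 1)))))\<^sup>2) = weight_power 1 (Branch i 1)"
    using finite_moments[OF v] by (rule norm_S_basis_vec[OF v])
  show "ennreal ((lam (Branch i 1))\<^sup>2) / ennreal ((hnorm H (the (S (basis_vec (Branch i 1)))))\<^sup>2) =
      ennreal ((branch_moment i 0)\<^sup>2 / branch_moment i 1)"
    unfolding * weight_power_eq[OF v] lam_branch_1_sq[OF i]
    using branch_moment(2)[OF i, of 0] branch_moment(2)[OF i, of 1]
    by (simp add: vertex_moment_def divide_ennreal power2_eq_square less_imp_le)
qed

section \<open>The branch sum, the integral of 1/x and the defect between them\<close>

definition branch_sum :: ennreal where
  "branch_sum = (\<Sum>\<^sub>\<infinity>i\<in>J \<eta>. ennreal ((lam (Branch i 1))\<^sup>2) /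
     ennreal ((hnorm H (the (S (basis_vec (Branch i 1)))))\<^sup>2))"

lemma child_sum_trunk_0: "child_sum (Trunk 0) = branch_sum"
proof -
  have "child_sum (Trunk 0) = (\<Sum>\<^sub>\<infinity>i\<in>J \<eta>. ennreal ((lam (Branch i 1))\<^sup>2) / weight_power 1 (Branch i 1))"
    unfolding child_sum_def children_trunk_0
    by (subst infsum_reindex) (auto simp: inj_on_def comp_def)
  also have "\<dots> = branch_sum"
    unfolding branch_sum_def by (rule infsum_cong) (simp only: branch_term(2))
  finally show ?thesis .
qed

text \<open>The factor \<lambda>^2, which is the mass of \<open>\<Omega> i\<close>, undoes the
  normalisation of the branch measure, and the sets \<open>\<Omega> i\<close> exhaust \<rho> up to a
  null set.\<close>

lemma consistency_sum:
  "(\<Sum>\<^sub>\<infinity>i\<in>J \<eta>. ennreal ((lam (Branch i 1))\<^sup>2) * (\<integral>\<^sup>+x. 1 / ennreal x \<partial>branch_measure \<rho> \<Omega> i)) =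
    (\<integral>\<^sup>+x. 1 / ennreal x \<partial>\<rho>)"
proof -
  have [measurable]: "(\<lambda>x. 1 / ennreal x) \<in> borel_measurable \<rho>" by (rule rho_measurable) measurable
  have "(\<Sum>\<^sub>\<infinity>i\<in>J \<eta>. ennreal ((lam (Branch i 1))\<^sup>2) * (\<integral>\<^sup>+x. 1 / ennreal x \<partial>branch_measure \<rho> \<Omega> i)) =
      (\<Sum>\<^sub>\<infinity>i\<in>J \<eta>. \<integral>\<^sup>+x. 1 / ennreal x * indicator (\<Omega> i) x \<partial>\<rho>)"
  proof (rule infsum_cong)
    fix i assume i: "i \<in> J \<eta>"
    have "(\<integral>\<^sup>+x. 1 / ennreal x \<partial>branch_measure \<rho> \<Omega> i) =
        (\<integral>\<^sup>+x. 1 / ennreal x * indicator (\<Omega> i) x \<partial>\<rho>) / ennreal (branch_moment i 0)"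
      unfolding branch_measure_def using Omega_sets_rho[OF i]
      by (subst nn_integral_uniform_measure) (auto simp: emeasure_Omega[OF i])
    then show "ennreal ((lam (Branch i 1))\<^sup>2) * (\<integral>\<^sup>+x. 1 / ennreal x \<partial>branch_measure \<rho> \<Omega> i) =
        (\<integral>\<^sup>+x. 1 / ennreal x * indicator (\<Omega> i) x \<partial>\<rho>)"
      unfolding lam_branch_1_sq[OF i] using branch_moment(2)[OF i, of 0]
      by (simp only: mult.commute[of "ennreal _"]) (simp add: ennreal_divide_times)
  qed
  also have "\<dots> = (\<integral>\<^sup>+i. (\<integral>\<^sup>+x. 1 / ennreal x * indicator (\<Omega> i) x \<partial>\<rho>) \<partial>count_space (J \<eta>))"
    by (rule nn_integral_count_space_infsum[symmetric]) simp
  also have "\<dots> = (\<integral>\<^sup>+x. 1 / ennreal x \<partial>\<rho>)"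
    by (rule nn_integral_rho_split[symmetric]) measurable
  finally show ?thesis .
qed

definition branch_defect :: "nat \<Rightarrow> ennreal" where
  "branch_defect i = (let m = branch_moment i 1 / branch_moment i 0 in
     \<integral>\<^sup>+x. ennreal ((x - m)\<^sup>2 / (x * m\<^sup>2)) * indicator (\<Omega> i) x \<partial>\<rho>)"

text \<open>Integrate \<open>1/x + x/m\<^sup>2 = 2/m + (x - m)\<^sup>2 / (x m\<^sup>2)\<close> over \<open>\<Omega> i\<close>, where \<open>m\<close> is the mean of
  \<open>\<mu>\<^sub>i\<^sub>,\<^sub>1\<close>.\<close>

lemma inverse_moment_branch:
  assumes i: "i \<in> J \<eta>"
  shows "(\<integral>\<^sup>+x. 1 / ennreal x * indicator (\<Omega> i) x \<partial>\<rho>) =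
    ennreal ((branch_moment i 0)\<^sup>2 / branch_moment i 1) + branch_defect i"
proof -
  define b where "b = branch_moment i"
  have b: "0 < b n" for n using branch_moment(2)[OF i] by (simp add: b_def)
  define m where "m = b 1 / b 0"
  \<comment> \<open>b_1 / m^2 = t and 2 b_0 / m = 2 t, so the integrated identity reads I + t = 2 t
    + defect, with I the integral of 1/x over \<open>\<Omega> i\<close>. Only the finite t gets
    cancelled, as \<open>ennreal\<close> requires.\<close>
  define t where "t = ennreal ((b 0)\<^sup>2 / b 1)"
  have m: "0 < m" using b by (simp add: m_def)
  let ?I = "indicator (\<Omega> i) :: real \<Rightarrow> ennreal"
  let ?D = "\<lambda>x. ennreal ((x - m)\<^sup>2 / (x * m\<^sup>2))"
  note [measurable] = Omega_sets_rho[OF i]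
  have [measurable]: "(\<lambda>x. 1 / ennreal x) \<in> borel_measurable \<rho>" "?D \<in> borel_measurable \<rho>"
    "ennreal \<in> borel_measurable \<rho>"
    by (rule rho_measurable, measurable)+
  have pt: "1 / ennreal x * ?I x + ennreal (1 / m\<^sup>2) * (ennreal (x ^ 1) * ?I x) =
      ennreal (2 / m) * (ennreal (x ^ 0) * ?I x) + ?D x * ?I x" for x
  proof (cases "x \<in> \<Omega> i")
    case True
    then have x: "0 < x" by (rule Omega_positive[OF i])
    have "1 / ennreal x = ennreal (1 / x)"
      using x divide_ennreal[of 1 x] by simp
    moreover have "ennreal (1 / m\<^sup>2) * ennreal x = ennreal (x / m\<^sup>2)"
      using x by (simp flip: ennreal_mult)
    ultimately have "1 / ennreal x + ennreal (1 / m\<^sup>2) * ennreal x = ennreal (1 / x + x / m\<^sup>2)"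
      using x by (simp add: ennreal_plus)
    also have "1 / x + x / m\<^sup>2 = 2 / m + (x - m)\<^sup>2 / (x * m\<^sup>2)"
      using x m by (simp add: field_simps power2_eq_square)
    also have "ennreal \<dots> = ennreal (2 / m) + ?D x"
      using x m by (intro ennreal_plus) auto
    finally show ?thesis using True by simp
  qed simp
  have "(\<integral>\<^sup>+x. 1 / ennreal x * ?I x \<partial>\<rho>) + ennreal (1 / m\<^sup>2) * (\<integral>\<^sup>+x. ennreal (x ^ 1) * ?I x \<partial>\<rho>) =
      (\<integral>\<^sup>+x. 1 / ennreal x * ?I x + ennreal (1 / m\<^sup>2) * (ennreal (x ^ 1) * ?I x) \<partial>\<rho>)"
    by (subst nn_integral_add) (auto simp: nn_integral_cmult)
  also have "\<dots> = (\<integral>\<^sup>+x. ennreal (2 / m) * (ennreal (x ^ 0) * ?I x) + ?D x * ?I x \<partial>\<rho>)"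
    unfolding pt ..
  also have "\<dots> = ennreal (2 / m) * (\<integral>\<^sup>+x. ennreal (x ^ 0) * ?I x \<partial>\<rho>) + branch_defect i"
    unfolding branch_defect_def Let_def b_def[symmetric] m_def[symmetric]
    by (subst nn_integral_add) (auto simp: nn_integral_cmult)
  finally have "(\<integral>\<^sup>+x. 1 / ennreal x * ?I x \<partial>\<rho>) + ennreal (1 / m\<^sup>2) * ennreal (b 1) =
      ennreal (2 / m) * ennreal (b 0) + branch_defect i"
    unfolding branch_moment(1)[OF i] b_def .
  moreover have "ennreal (1 / m\<^sup>2) * ennreal (b 1) = t"
    using b[of 0] b[of 1] by (simp add: t_def m_def power2_eq_square flip: ennreal_mult)
  moreover have "ennreal (2 / m) * ennreal (b 0) = t + t"
    using b[of 0] b[of 1] m by (simp add: t_def m_def power2_eq_square flip: ennreal_mult ennreal_plus)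
  ultimately have "t + (\<integral>\<^sup>+x. 1 / ennreal x * ?I x \<partial>\<rho>) = t + (t + branch_defect i)"
    by (simp add: ac_simps)
  then show ?thesis
    by (subst (asm) ennreal_add_left_cancel) (simp add: t_def b_def)
qed

lemma inverse_moment_eq:
  "(\<integral>\<^sup>+x. 1 / ennreal x \<partial>\<rho>) = branch_sum + (\<integral>\<^sup>+i. branch_defect i \<partial>count_space (J \<eta>))"
proof -
  have "(\<integral>\<^sup>+x. 1 / ennreal x \<partial>\<rho>) = (\<integral>\<^sup>+i. (\<integral>\<^sup>+x. 1 / ennreal x * indicator (\<Omega> i) x \<partial>\<rho>) \<partial>count_space (J \<eta>))"
    by (rule nn_integral_rho_split) measurable
  also have "\<dots> = (\<integral>\<^sup>+i. ennreal ((branch_moment i 0)\<^sup>2 / branch_moment i 1) + branch_defect i \<partial>count_space (J \<eta>))"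
    by (rule nn_integral_cong) (simp add: inverse_moment_branch)
  also have "\<dots> = (\<integral>\<^sup>+i. ennreal ((branch_moment i 0)\<^sup>2 / branch_moment i 1) \<partial>count_space (J \<eta>)) +
      (\<integral>\<^sup>+i. branch_defect i \<partial>count_space (J \<eta>))"
    by (rule nn_integral_add) auto
  also have "(\<integral>\<^sup>+i. ennreal ((branch_moment i 0)\<^sup>2 / branch_moment i 1) \<partial>count_space (J \<eta>)) = branch_sum"
    unfolding branch_sum_def nn_integral_count_space_infsum[OF countable_J]
    by (rule infsum_cong) (simp only: branch_term(1))
  finally show ?thesis .
qed

text \<open>On \<open>\<Omega> i\<close> the integrand of the defect vanishes only at the mean m, so
  zero defect means that \<rho> restricted to \<open>\<Omega> i\<close> sits at the point m.
  Conversely, the mean of a point mass is its point.\<close>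

lemma branch_defect_eq_0_iff:
  assumes i: "i \<in> J \<eta>"
  shows "branch_defect i = 0 \<longleftrightarrow> (\<exists>q\<in>\<Omega> i. \<forall>\<sigma>\<in>sets borel. \<sigma> \<subseteq> {0..} \<longrightarrow>
    emeasure \<rho> (\<sigma> \<inter> \<Omega> i) = emeasure \<rho> (\<Omega> i) * indicator \<sigma> q)"
proof -
  define b where "b = branch_moment i"
  have b: "0 < b n" for n using branch_moment(2)[OF i] by (simp add: b_def)
  define m where "m = b 1 / b 0"
  have m: "0 < m" using b by (simp add: m_def)
  note \<Omega>m [measurable] = Omega_sets_rho[OF i]
  let ?D = "\<lambda>x. ennreal ((x - m)\<^sup>2 / (x * m\<^sup>2))"
  have [measurable]: "?D \<in> borel_measurable \<rho>" by (rule rho_measurable) measurable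
  have "branch_defect i = 0 \<longleftrightarrow> (AE x in \<rho>. ?D x * indicator (\<Omega> i) x = 0)"
    unfolding branch_defect_def Let_def b_def[symmetric] m_def[symmetric]
    by (rule nn_integral_0_iff_AE) measurable
  also have "\<dots> \<longleftrightarrow> (AE x in \<rho>. x \<in> \<Omega> i \<longrightarrow> x = m)"
  proof (rule AE_cong)
    fix x
    have "0 < x" if "x \<in> \<Omega> i" using Omega_positive[OF i that] .
    then show "?D x * indicator (\<Omega> i) x = 0 \<longleftrightarrow> (x \<in> \<Omega> i \<longrightarrow> x = m)"
      using m by (auto simp: indicator_def ennreal_eq_0_iff divide_le_0_iff mult_le_0_iff)
  qed
  finally have iff: "branch_defect i = 0 \<longleftrightarrow> (AE x in \<rho>. x \<in> \<Omega> i \<longrightarrow> x = m)" .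
  show ?thesis
  proof
    assume "branch_defect i = 0"
    with iff have AE: "AE x in \<rho>. x \<in> \<Omega> i \<longrightarrow> x = m" by simp
    have em: "emeasure \<rho> (\<sigma> \<inter> \<Omega> i) = emeasure \<rho> (\<Omega> i) * indicator \<sigma> m"
      if \<sigma>: "\<sigma> \<in> sets borel" "\<sigma> \<subseteq> {0..}" for \<sigma>
    proof -
      have [measurable]: "\<sigma> \<in> sets \<rho>" using borel_measure_nonneg_sets[OF borel_rho \<sigma>] .
      show ?thesis
      proof (cases "m \<in> \<sigma>")
        case True
        have "emeasure \<rho> (\<sigma> \<inter> \<Omega> i) = emeasure \<rho> (\<Omega> i)"
          by (rule emeasure_eq_AE) (use AE True in \<open>auto elim: eventually_mono\<close>)
        then show ?thesis using True by simp
      next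
        case False
        have "emeasure \<rho> (\<sigma> \<inter> \<Omega> i) = emeasure \<rho> {}"
          by (rule emeasure_eq_AE) (use AE False in \<open>auto elim: eventually_mono\<close>)
        then show ?thesis using False by simp
      qed
    qed
    \<comment> \<open>Were m outside, \<open>\<Omega> i\<close> would be a null set.\<close>
    have "m \<in> \<Omega> i"
    proof (rule ccontr)
      assume "m \<notin> \<Omega> i"
      then have "emeasure \<rho> (\<Omega> i) = emeasure \<rho> {}"
        by (intro emeasure_eq_AE) (use AE in \<open>auto elim: eventually_mono\<close>)
      then show False using Omega_pos[OF i] by simp
    qed
    then show "\<exists>q\<in>\<Omega> i. \<forall>\<sigma>\<in>sets borel. \<sigma> \<subseteq> {0..} \<longrightarrow>
        emeasure \<rho> (\<sigma> \<inter> \<Omega> i) = emeasure \<rho> (\<Omega> i) * indicator \<sigma> q"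
      using em by blast
  next
    assume "\<exists>q\<in>\<Omega> i. \<forall>\<sigma>\<in>sets borel. \<sigma> \<subseteq> {0..} \<longrightarrow>
        emeasure \<rho> (\<sigma> \<inter> \<Omega> i) = emeasure \<rho> (\<Omega> i) * indicator \<sigma> q"
    \<comment> \<open>Taking the half-line without q for \<sigma> shows that
      \<open>\<Omega> i\<close> has no mass away from q.\<close>
    then obtain q where q: "q \<in> \<Omega> i" "emeasure \<rho> (({0..} - {q}) \<inter> \<Omega> i) = 0"
      by fastforce
    have q0: "0 < q" using Omega_positive[OF i q(1)] .
    have "{0..} - {q} \<in> sets \<rho>" by (rule borel_measure_nonneg_sets[OF borel_rho]) auto
    then have "({0..} - {q}) \<inter> \<Omega> i \<in> null_sets \<rho>" using q(2) by (intro null_setsI) auto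
    then have "AE x in \<rho>. x \<notin> ({0..} - {q}) \<inter> \<Omega> i" by (rule AE_not_in)
    then have AE: "AE x in \<rho>. x \<in> \<Omega> i \<longrightarrow> x = q"
      using AE_space by eventually_elim (auto simp: space_rho)
    have "ennreal (b 1) = (\<integral>\<^sup>+x. ennreal q * (ennreal (x ^ 0) * indicator (\<Omega> i) x) \<partial>\<rho>)"
      unfolding b_def branch_moment(1)[OF i, symmetric]
      by (rule nn_integral_cong_AE) (use AE in \<open>auto elim!: eventually_mono simp: indicator_def\<close>)
    also have "\<dots> = ennreal q * ennreal (b 0)"
      unfolding b_def branch_moment(1)[OF i, symmetric] by (rule nn_integral_cmult) simp
    finally have "b 1 = q * b 0" using b[of 0] b[of 1] q0 by (simp flip: ennreal_mult)
    then have "m = q" using b[of 0] by (simp add: m_def)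
    then show "branch_defect i = 0" using iff AE by simp
  qed
qed

text \<open>The integral of 1/x is finite, so \<open>branch_sum\<close> can be cancelled and
  equality means that the total defect is 0. As a sum of nonnegative terms it is 0 only if each
  defect is.\<close>

lemma branch_sum_eq_iff:
  "branch_sum = (\<integral>\<^sup>+x. 1 / ennreal x \<partial>\<rho>) \<longleftrightarrow>
    (\<forall>i\<in>J \<eta>. \<exists>q\<in>\<Omega> i. \<forall>\<sigma>\<in>sets borel. \<sigma> \<subseteq> {0..} \<longrightarrow>
      emeasure \<rho> (\<sigma> \<inter> \<Omega> i) = emeasure \<rho> (\<Omega> i) * indicator \<sigma> q)"
proof -
  let ?D = "\<integral>\<^sup>+i. branch_defect i \<partial>count_space (J \<eta>)"
  have "branch_sum < \<infinity>"
    using rho_inverse_moment unfolding inverse_moment_eq by simp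
  then have "branch_sum = branch_sum + ?D \<longleftrightarrow> ?D = 0"
    using ennreal_add_left_cancel[of branch_sum 0 ?D] by auto
  also have "\<dots> \<longleftrightarrow> (\<forall>i\<in>J \<eta>. branch_defect i = 0)"
    by (subst nn_integral_0_iff_AE) (auto simp: AE_count_space)
  finally show ?thesis unfolding inverse_moment_eq using branch_defect_eq_0_iff by simp
qed

end


section \<open>Subnormality in the determinate case\<close>

context tree_data
begin

lemma trunk_0_in_V: "Trunk 0 \<in> V"
  by (simp add: trunk_in_tree_verts_iff zero_enat_def[symmetric])

text \<open>The moments of x d\<nu> are those of \<nu> with the order raised by one, so this measure
  represents the same sequence as \<rho>.\<close>

lemma determinate_rho:
  assumes det: "S_determinate (\<lambda>n. \<gamma> (int n + 1))"
  shows "\<rho> = density \<nu> ennreal"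
proof -
  have [measurable]: "ennreal \<in> borel_measurable \<nu>" "(\<lambda>x. ennreal (x ^ n)) \<in> borel_measurable \<nu>" for n
    by (rule nu_measurable, measurable)+
  have "(\<integral>\<^sup>+x. ennreal (x ^ n) \<partial>density \<nu> ennreal) = ennreal (\<gamma> (int n + 1))" for n
  proof -
    have "(\<integral>\<^sup>+x. ennreal (x ^ n) \<partial>density \<nu> ennreal) = (\<integral>\<^sup>+x. ennreal (x ^ Suc n) \<partial>\<nu>)"
      by (subst nn_integral_density) (auto intro!: nn_integral_cong simp: space_nu ennreal_mult)
    also have "\<dots> = ennreal (\<gamma> (int n + 1))"
      using nu_moment[OF trunk_0_in_V, of "Suc n"] by (simp add: add.commute)
    finally show ?thesis .
  qed
  moreover have "0 \<le> \<gamma> (int n + 1)" for n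
    using gamma_trunk_pos[OF trunk_0_in_V, of "Suc n"] by (simp add: add.commute)
  moreover have "borel_measure_nonneg (density \<nu> ennreal)"
    using nu by (simp add: borel_measure_nonneg_def)
  ultimately have "S_representing (\<lambda>n. \<gamma> (int n + 1)) (density \<nu> ennreal)"
    by (simp add: S_representing_iff)
  then show ?thesis using det rho unfolding S_determinate_def by blast
qed

lemma emeasure_nu: "emeasure \<nu> (space \<nu>) = 1"
  using nu_moment[OF trunk_0_in_V, of 0] by (simp add: gamma_0)

lemma determinate_inverse_moment:
  assumes det: "S_determinate (\<lambda>n. \<gamma> (int n + 1))"
  shows "(\<integral>\<^sup>+x. 1 / ennreal x \<partial>\<rho>) \<le> 1"
proof -
  have [measurable]: "ennreal \<in> borel_measurable \<nu>" "(\<lambda>x. 1 / ennreal x) \<in> borel_measurable \<nu>"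
    by (rule nu_measurable, measurable)+
  have "(\<integral>\<^sup>+x. 1 / ennreal x \<partial>\<rho>) = (\<integral>\<^sup>+x. ennreal x * (1 / ennreal x) \<partial>\<nu>)"
    unfolding determinate_rho[OF det] by (subst nn_integral_density) auto
  also have "\<dots> \<le> (\<integral>\<^sup>+x. 1 \<partial>\<nu>)"
  proof (rule nn_integral_mono)
    fix x :: real
    \<comment> \<open>At 0 the product is 0 * \<infinity> = 0: mass of \<nu> at 0 is lost, which is
      why only an inequality results.\<close>
    show "ennreal x * (1 / ennreal x) \<le> 1"
      by (cases "0 < x") (simp_all add: ennreal_times_divide ennreal_neg)
  qed
  finally show ?thesis by (simp add: emeasure_nu)
qed

section \<open>The product model and its normal operator\<close>

definition model_space :: "(int \<times> real) measure" where
  "model_space = count_space UNIV \<Otimes>\<^sub>M \<nu>"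

sublocale nu: finite_measure \<nu>
  by (rule finite_measureI) (simp add: emeasure_nu)

lemma nn_integral_model_space:
  assumes "f \<in> borel_measurable model_space"
  shows "(\<integral>\<^sup>+p. f p \<partial>model_space) = (\<integral>\<^sup>+n. \<integral>\<^sup>+x. f (n, x) \<partial>\<nu> \<partial>count_space UNIV)"
  using nu.nn_integral_fst[of f "count_space UNIV"] assms by (simp add: model_space_def)

lemma model_space_measurable:
  assumes "\<And>n. (\<lambda>x. f (n, x)) \<in> measurable \<nu> N"
  shows "f \<in> measurable model_space N"
  unfolding model_space_def using assms by (intro measurable_pair_measure_countable1) auto

lemma space_model_space: "space model_space = UNIV \<times> {0..}"
  by (simp add: model_space_def space_pair_measure space_nu)

definition shift_by :: "int \<Rightarrow> int \<times> real \<Rightarrow> int \<times> real" where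
  "shift_by k p = (fst p + k, snd p)"

lemma shift_by_measurable [measurable]: "shift_by k \<in> measurable model_space model_space"
  unfolding shift_by_def model_space_def by measurable

text \<open>Composition with the shift by -1 moves a function one level up, just as S carries values
  from a parent to its children. The weight depends on the second coordinate alone, hence is
  invariant.\<close>

lemma weighted_automorphism_model_space:
  "weighted_automorphism model_space (shift_by (-1)) (shift_by 1) (\<lambda>p. sqrt (snd p))"
proof
  have "(\<lambda>x. sqrt x) \<in> borel_measurable \<nu>" by (rule nu_measurable) measurable
  then show "(\<lambda>p. sqrt (snd p)) \<in> borel_measurable model_space"
    by (intro model_space_measurable) simp
  show "distr model_space model_space (shift_by (-1)) = model_space"
  proof (rule measure_eqI)
    fix A assume "A \<in> sets (distr model_space model_space (shift_by (-1)))"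
    then have [measurable]: "A \<in> sets model_space" by simp
    have bij: "bij_betw (\<lambda>n::int. n + - 1) UNIV UNIV"
      by (rule bij_betw_byWitness[where f' = "\<lambda>n. n + 1"]) auto
    have "emeasure (distr model_space model_space (shift_by (-1))) A =
        (\<integral>\<^sup>+p. indicator A p \<partial>distr model_space model_space (shift_by (-1)))" by simp
    also have "\<dots> = (\<integral>\<^sup>+p. indicator A (shift_by (-1) p) \<partial>model_space)"
      by (rule nn_integral_distr) measurable
    also have "\<dots> = (\<integral>\<^sup>+n. \<integral>\<^sup>+x. indicator A (shift_by (-1) (n, x)) \<partial>\<nu> \<partial>count_space UNIV)"
      by (rule nn_integral_model_space) measurable
    also have "\<dots> = (\<integral>\<^sup>+n. \<integral>\<^sup>+x. indicator A (n + -1, x) \<partial>\<nu> \<partial>count_space UNIV)"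
      by (simp add: shift_by_def)
    also have "\<dots> = (\<integral>\<^sup>+n. \<integral>\<^sup>+x. indicator A (n, x) \<partial>\<nu> \<partial>count_space UNIV)"
      by (rule nn_integral_bij_count_space[OF bij])
    also have "\<dots> = (\<integral>\<^sup>+p. indicator A p \<partial>model_space)"
      by (rule nn_integral_model_space[symmetric]) measurable
    finally show "emeasure (distr model_space model_space (shift_by (-1))) A = emeasure model_space A"
      by simp
  qed simp
qed (auto simp: shift_by_def)

section \<open>The embedding of the sequence space over the tree into the model\<close>

definition branch_index :: "real \<Rightarrow> nat" where
  "branch_index x = (if 0 < x then THE i. i \<in> J \<eta> \<and> x \<in> \<Omega> i else 0)"

lemma branch_index_eq:
  assumes "i \<in> J \<eta>" "x \<in> \<Omega> i" shows "branch_index x = i"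
proof -
  have "(THE i. i \<in> J \<eta> \<and> x \<in> \<Omega> i) = i"
    using assms Omega_disjoint by (intro the_equality) (auto simp: disjoint_family_on_def)
  then show ?thesis using Omega_positive[OF assms] by (simp add: branch_index_def)
qed

lemma branch_index_in:
  assumes "0 < x" shows "branch_index x \<in> J \<eta>" "x \<in> \<Omega> (branch_index x)"
proof -
  obtain i where "i \<in> J \<eta>" "x \<in> \<Omega> i" using Omega_union assms by auto
  then show "branch_index x \<in> J \<eta>" "x \<in> \<Omega> (branch_index x)" by (simp_all add: branch_index_eq)
qed

text \<open>Countably many preimages suffice: \<open>\<Omega> i\<close> for an index i, and the
  half-line x \<le> 0 for the value 0, which is free as a marker because indices start at 1.\<close>

lemma branch_index_measurable [measurable]: "branch_index \<in> measurable borel (count_space UNIV)"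
proof (subst measurable_count_space_eq2_countable, safe)
  fix i
  have pos: "0 \<notin> J \<eta>" by (simp add: J_def)
  show "branch_index -` {i} \<inter> space borel \<in> sets borel"
  proof (cases "i \<in> J \<eta>")
    case True
    have "branch_index -` {i} = \<Omega> i"
    proof (intro equalityI subsetI)
      fix x assume "x \<in> branch_index -` {i}"
      then have "branch_index x = i" by simp
      moreover from this have "0 < x" using True pos by (auto simp: branch_index_def split: if_splits)
      ultimately show "x \<in> \<Omega> i" using branch_index_in(2) by blast
    qed (use True branch_index_eq in auto)
    then show ?thesis using Omega_borel[OF True] by simp
  next
    case False
    have "x \<in> branch_index -` {i} \<longleftrightarrow> x \<in> (if i = 0 then {..0} else {})" for x
    proof (cases "0 < x")
      case True
      then have "branch_index x \<noteq> i" using False branch_index_in(1) by blast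
      then show ?thesis using True by simp
    next
      case False
      then have "branch_index x = 0" by (simp add: branch_index_def)
      then show ?thesis using False by auto
    qed
    then have "branch_index -` {i} = (if i = 0 then {..0} else {})" by blast
    then show ?thesis by simp
  qed
qed auto

text \<open>Over \<open>x \<in> \<Omega> i\<close> the fibre of the model is \<open>\<ell>\<^sup>2\<close> of the path through the trunk and the \<open>i\<close>-th branch,
  with the trunk vertex \<open>-k\<close> at level \<open>-k\<close> and \<open>(i, j)\<close> at level \<open>j\<close>; the weights are square
  roots of the densities with respect to \<open>\<nu>\<close> of the measures representing the vertices. An atom of
  \<open>\<nu>\<close> at \<open>0\<close> is possible only for \<open>\<kappa> = 0\<close>.\<close>

definition level_vertex :: "int \<Rightarrow> real \<Rightarrow> vertex" where
  "level_vertex n x = (if n \<le> 0 then Trunk (nat (- n)) else Branch (branch_index x) (nat n))"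

definition level_density :: "int \<Rightarrow> real \<Rightarrow> real" where
  "level_density n x = (if n \<le> 0
     then if x = 0 \<and> \<kappa> \<noteq> 0 then 0 else inverse x ^ nat (- n) / \<gamma> n
     else x ^ nat n / branch_moment (branch_index x) (nat n - 1))"

definition embed :: "(vertex \<Rightarrow> complex) \<Rightarrow> int \<times> real \<Rightarrow> complex" where
  "embed f = (\<lambda>(n, x). f (level_vertex n x) * of_real (sqrt (level_density n x)))"

lemma embed_measurable: "embed f \<in> borel_measurable model_space"
proof (rule model_space_measurable, rule nu_measurable)
  fix n :: int
  have [measurable]: "g \<in> borel_measurable (count_space UNIV)" for g :: "nat \<Rightarrow> 'z::topological_space"
    by simp
  have "(\<lambda>x. f (level_vertex n x)) \<in> borel_measurable borel"
    using measurable_compose[OF branch_index_measurable, of "\<lambda>i. f (Branch i (nat n))"]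
    by (cases "n \<le> 0") (simp_all add: level_vertex_def)
  moreover have "level_density n \<in> borel_measurable borel"
    using measurable_compose[OF branch_index_measurable, of "\<lambda>i. branch_moment i (nat n - 1)" borel]
    by (cases "n \<le> 0") (simp_all add: level_density_def[abs_def])
  ultimately show "(\<lambda>x. embed f (n, x)) \<in> borel_measurable borel"
    by (simp add: embed_def)
qed

lemma embed_add: "embed (\<lambda>v. f v + g v) = (\<lambda>p. embed f p + embed g p)"
  by (auto simp: embed_def distrib_right)

lemma embed_scale: "embed (\<lambda>v. c * f v) = (\<lambda>p. c * embed f p)"
  by (auto simp: embed_def)

lemma AE_nu_positive_or_rootless:
  "AE x in \<nu>. \<not> (x = 0 \<and> \<kappa> \<noteq> 0)"
proof (cases "\<kappa> = 0")
  case False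
  then have "Trunk (Suc 0) \<in> V"
    by (cases \<kappa>) (auto simp: trunk_in_tree_verts_iff zero_enat_def Suc_le_eq)
  from AE_nu_positive[OF this] show ?thesis by eventually_elim simp
qed simp

text \<open>A level -k without a vertex contributes nothing because f vanishes there; otherwise the
  density at this level has integral 1 with respect to \<nu>.\<close>

lemma norm_embed_trunk:
  assumes f: "f \<in> hcarrier H"
  shows "(\<integral>\<^sup>+x. ennreal ((cmod (embed f (- int k, x)))\<^sup>2) \<partial>\<nu>) = ennreal ((cmod (f (Trunk k)))\<^sup>2)"
proof (cases "Trunk k \<in> V")
  case True
  have \<gamma>: "0 < \<gamma> (- int k)" using gamma_trunk_pos[OF True, of 0] by simp
  have [measurable]: "(\<lambda>x. inverse (ennreal x) ^ k) \<in> borel_measurable \<nu>"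
    by (rule nu_measurable) measurable
  have "(\<integral>\<^sup>+x. ennreal ((cmod (embed f (- int k, x)))\<^sup>2) \<partial>\<nu>) =
      (\<integral>\<^sup>+x. ennreal ((cmod (f (Trunk k)))\<^sup>2 / \<gamma> (- int k)) * inverse (ennreal x) ^ k \<partial>\<nu>)"
  proof (rule nn_integral_cong_AE)
    have pt: "ennreal ((cmod (embed f (- int k, x)))\<^sup>2) =
        ennreal ((cmod (f (Trunk k)))\<^sup>2 / \<gamma> (- int k)) * inverse (ennreal x) ^ k"
      if x: "0 \<le> x" "0 < x \<or> k = 0" "\<not> (x = 0 \<and> \<kappa> \<noteq> 0)" for x
    proof -
      have "inverse (ennreal x) ^ k = ennreal (inverse x ^ k)"
        using x by (cases "k = 0") (auto simp: inverse_ennreal ennreal_power)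
      moreover have "(cmod (embed f (- int k, x)))\<^sup>2 = (cmod (f (Trunk k)))\<^sup>2 / \<gamma> (- int k) * inverse x ^ k"
        using x \<gamma> by (auto simp: embed_def level_vertex_def level_density_def norm_mult power_mult_distrib)
      moreover have "ennreal ((cmod (f (Trunk k)))\<^sup>2 / \<gamma> (- int k) * inverse x ^ k) =
          ennreal ((cmod (f (Trunk k)))\<^sup>2 / \<gamma> (- int k)) * ennreal (inverse x ^ k)"
        by (rule ennreal_mult) (use x \<gamma> in auto)
      ultimately show ?thesis by (simp only:)
    qed
    have "AE x in \<nu>. 0 < x \<or> k = 0"
      using AE_nu_positive[of "k - 1"] True by (cases k) auto
    then show "AE x in \<nu>. ennreal ((cmod (embed f (- int k, x)))\<^sup>2) =
        ennreal ((cmod (f (Trunk k)))\<^sup>2 / \<gamma> (- int k)) * inverse (ennreal x) ^ k"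
      using AE_space AE_nu_positive_or_rootless
      by eventually_elim (rule pt, auto simp: space_nu)
  qed
  also have "\<dots> = ennreal ((cmod (f (Trunk k)))\<^sup>2 / \<gamma> (- int k)) * ennreal (\<gamma> (- int k))"
    using nu_moment[OF True, of 0] by (subst nn_integral_cmult) auto
  also have "\<dots> = ennreal ((cmod (f (Trunk k)))\<^sup>2)"
    using \<gamma> by (simp flip: ennreal_mult)
  finally show ?thesis .
next
  case False
  then have "f (Trunk k) = 0" using f by (simp add: ell2_carrier_iff)
  then show ?thesis by (simp add: embed_def level_vertex_def)
qed

text \<open>At level j + 1 the density on \<open>\<Omega> i\<close> is x * x^j / b_j, with b_j =
  \<open>branch_moment i j\<close>. The factor x turns \<nu> into \<rho>, and what remains has
  integral 1 over \<open>\<Omega> i\<close>, where the coefficient of the embedded function is the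
  constant f (i, j + 1).\<close>

lemma norm_embed_branch:
  assumes rho_nu: "\<rho> = density \<nu> ennreal"
  shows "(\<integral>\<^sup>+x. ennreal ((cmod (embed f (int (Suc j), x)))\<^sup>2) \<partial>\<nu>) =
    (\<integral>\<^sup>+i. ennreal ((cmod (f (Branch i (Suc j))))\<^sup>2) \<partial>count_space (J \<eta>))"
proof -
  let ?c = "\<lambda>i. (cmod (f (Branch i (Suc j))))\<^sup>2 / branch_moment i j"
  let ?g = "\<lambda>x. ennreal (?c (branch_index x)) * ennreal (x ^ j)"
  have g: "?g \<in> borel_measurable borel"
    using measurable_compose[OF branch_index_measurable, of "\<lambda>i. ennreal (?c i)" borel] by simp
  have [measurable]: "?g \<in> borel_measurable \<nu>" "ennreal \<in> borel_measurable \<nu>"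
    using g by (auto intro: nu_measurable)
  have "(\<integral>\<^sup>+x. ennreal ((cmod (embed f (int (Suc j), x)))\<^sup>2) \<partial>\<nu>) = (\<integral>\<^sup>+x. ennreal x * ?g x \<partial>\<nu>)"
  proof (rule nn_integral_cong)
    fix x assume "x \<in> space \<nu>"
    then have x: "0 \<le> x" by (simp add: space_nu)
    show "ennreal ((cmod (embed f (int (Suc j), x)))\<^sup>2) = ennreal x * ?g x"
    proof (cases "x = 0")
      case False
      then have "0 < branch_moment (branch_index x) j" using x branch_index_in(1) branch_moment(2) by simp
      moreover from this have "(cmod (embed f (int (Suc j), x)))\<^sup>2 = x * (?c (branch_index x) * x ^ j)"
        using x
        by (simp add: embed_def level_vertex_def level_density_def norm_mult power_mult_distrib nat_add_distrib)
      moreover have "ennreal (x * (?c (branch_index x) * x ^ j)) = ennreal x * ennreal (?c (branch_index x) * x ^ j)"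
        "ennreal (?c (branch_index x) * x ^ j) = ?g x"
        by (rule ennreal_mult; use x calculation(1) in simp)+
      ultimately show ?thesis by (simp only:)
    qed (simp add: embed_def level_density_def)
  qed
  also have "\<dots> = (\<integral>\<^sup>+x. ?g x \<partial>\<rho>)"
  proof -
    have "(\<integral>\<^sup>+x. ennreal x * h x \<partial>\<nu>) = (\<integral>\<^sup>+x. h x \<partial>\<rho>)" if "h \<in> borel_measurable \<nu>" for h
      unfolding rho_nu by (rule nn_integral_density[symmetric]) (use that in auto)
    then show ?thesis by this measurable
  qed
  also have "\<dots> = (\<integral>\<^sup>+i. (\<integral>\<^sup>+x. ?g x * indicator (\<Omega> i) x \<partial>\<rho>) \<partial>count_space (J \<eta>))"
    by (rule nn_integral_rho_split[OF g])
  also have "\<dots> = (\<integral>\<^sup>+i. ennreal ((cmod (f (Branch i (Suc j))))\<^sup>2) \<partial>count_space (J \<eta>))"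
  proof (rule nn_integral_cong)
    fix i assume "i \<in> space (count_space (J \<eta>))"
    then have i: "i \<in> J \<eta>" by simp
    note [measurable] = Omega_sets_rho[OF i]
    have [measurable]: "(\<lambda>x. ennreal (x ^ j)) \<in> borel_measurable \<rho>" by (rule rho_measurable) measurable
    have "(\<integral>\<^sup>+x. ?g x * indicator (\<Omega> i) x \<partial>\<rho>) = (\<integral>\<^sup>+x. ennreal (?c i) * (ennreal (x ^ j) * indicator (\<Omega> i) x) \<partial>\<rho>)"
      by (rule nn_integral_cong) (auto simp: indicator_def branch_index_eq[OF i])
    also have "\<dots> = ennreal (?c i) * ennreal (branch_moment i j)"
      by (subst nn_integral_cmult) (auto simp: branch_moment(1)[OF i])
    also have "\<dots> = ennreal ((cmod (f (Branch i (Suc j))))\<^sup>2)"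
      using branch_moment(2)[OF i, of j] by (simp flip: ennreal_mult)
    finally show "(\<integral>\<^sup>+x. ?g x * indicator (\<Omega> i) x \<partial>\<rho>) = ennreal ((cmod (f (Branch i (Suc j))))\<^sup>2)" .
  qed
  finally show ?thesis .
qed

text \<open>Every vertex has one level, so both sides decompose over the levels: a level n \<le> 0
  holds at most one vertex, of the trunk, and a level n > 0 holds one vertex of each branch.\<close>

lemma sq_norm_embed:
  assumes rho_nu: "\<rho> = density \<nu> ennreal" and f: "f \<in> hcarrier H"
  shows "sq_norm model_space (embed f) = sq_norm (count_space V) f"
proof -
  let ?c = "\<lambda>v. ennreal ((cmod (f v))\<^sup>2)"
  define level where "level v = (case v of Trunk k \<Rightarrow> - int k | Branch i j \<Rightarrow> int j)" for v
  have "sq_norm (count_space V) f = (\<integral>\<^sup>+v. (\<integral>\<^sup>+n. ?c v * indicator {level v} n \<partial>count_space UNIV) \<partial>count_space V)"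
    unfolding sq_norm_def
  proof (rule nn_integral_cong)
    fix v
    have "(\<integral>\<^sup>+n. ?c v * indicator {level v} n \<partial>count_space UNIV) = (\<Sum>n\<in>{level v}. ?c v * indicator {level v} n)"
      by (rule nn_integral_count_space') auto
    then show "?c v = (\<integral>\<^sup>+n. ?c v * indicator {level v} n \<partial>count_space UNIV)" by simp
  qed
  also have "\<dots> = (\<integral>\<^sup>+n. (\<integral>\<^sup>+v. ?c v * indicator {level v} n \<partial>count_space V) \<partial>count_space UNIV)"
    by (rule nn_integral_count_space_nn_integral) auto
  also have "\<dots> = (\<integral>\<^sup>+n. \<integral>\<^sup>+x. ennreal ((cmod (embed f (n, x)))\<^sup>2) \<partial>\<nu> \<partial>count_space UNIV)"
  proof (rule nn_integral_cong)
    fix n :: int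
    show "(\<integral>\<^sup>+v. ?c v * indicator {level v} n \<partial>count_space V) = (\<integral>\<^sup>+x. ennreal ((cmod (embed f (n, x)))\<^sup>2) \<partial>\<nu>)"
    proof (cases "n \<le> 0")
      case True
      define k where "k = nat (- n)"
      have n: "n = - int k" using True by (simp add: k_def)
      have "(\<integral>\<^sup>+v. ?c v * indicator {level v} n \<partial>count_space V) =
          (\<integral>\<^sup>+v. ?c v * indicator {level v} n \<partial>count_space {Trunk k})"
      proof (rule nn_integral_count_space_eq)
        fix v assume "v \<in> V - {Trunk k}"
        then have "level v \<noteq> n"
          by (cases v) (auto simp: n level_def branch_in_tree_verts_iff)
        then show "?c v * indicator {level v} n = 0" by simp
      next
        fix v assume "v \<in> {Trunk k} - V"
        then have "f v = 0" using f by (auto simp: ell2_carrier_iff)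
        then show "?c v * indicator {level v} n = 0" by simp
      qed
      also have "\<dots> = ?c (Trunk k)"
        by (simp add: nn_integral_count_space_finite level_def n)
      finally show ?thesis unfolding n norm_embed_trunk[OF f] .
    next
      case False
      then obtain j where n: "n = int (Suc j)"
        by (metis not_le gr0_conv_Suc pos_int_cases)
      have "(\<integral>\<^sup>+v. ?c v * indicator {level v} n \<partial>count_space V) =
          (\<integral>\<^sup>+v. ?c v * indicator {level v} n \<partial>count_space ((\<lambda>i. Branch i (Suc j)) ` J \<eta>))"
      proof (rule nn_integral_count_space_eq)
        fix v assume "v \<in> V - (\<lambda>i. Branch i (Suc j)) ` J \<eta>"
        then have "level v \<noteq> n"
          by (cases v) (auto simp: n level_def branch_in_tree_verts_iff image_iff)
        then show "?c v * indicator {level v} n = 0" by simp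
      next
        fix v assume "v \<in> (\<lambda>i. Branch i (Suc j)) ` J \<eta> - V"
        then show "?c v * indicator {level v} n = 0" by (auto simp: branch_in_tree_verts_iff)
      qed
      also have "\<dots> = (\<integral>\<^sup>+i. ?c (Branch i (Suc j)) * indicator {level (Branch i (Suc j))} n \<partial>count_space (J \<eta>))"
        by (rule nn_integral_bij_count_space[symmetric]) (auto simp: bij_betw_def inj_on_def)
      also have "\<dots> = (\<integral>\<^sup>+i. ?c (Branch i (Suc j)) \<partial>count_space (J \<eta>))"
        by (simp add: level_def n)
      finally show ?thesis unfolding n norm_embed_branch[OF rho_nu] .
    qed
  qed
  also have "\<dots> = sq_norm model_space (embed f)"
  proof -
    have [measurable]: "embed f \<in> borel_measurable model_space" by (rule embed_measurable)
    show ?thesis unfolding sq_norm_def by (rule nn_integral_model_space[symmetric]) measurable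
  qed
  finally show ?thesis ..
qed

lemma embed_L2:
  assumes "\<rho> = density \<nu> ennreal" "f \<in> hcarrier H"
  shows "embed f \<in> L2 model_space"
  using sq_norm_embed[OF assms] ell2_carrier_L2[OF assms(2)] embed_measurable
  by (simp add: L2_def)

lemma L2_inner_embed:
  assumes rho_nu: "\<rho> = density \<nu> ennreal" and f: "f \<in> hcarrier H" and g: "g \<in> hcarrier H"
  shows "L2_inner model_space (embed f) (embed g) = L2_inner (count_space V) f g"
proof (rule L2_polarization)
  fix c
  have "(\<lambda>p. embed f p + c * embed g p) = embed (\<lambda>v. f v + c * g v)"
    by (simp add: embed_add embed_scale)
  then show "sq_norm model_space (\<lambda>p. embed f p + c * embed g p) = sq_norm (count_space V) (\<lambda>v. f v + c * g v)"
    using sq_norm_embed[OF rho_nu carrier_add[OF f carrier_scale[OF g]]] by simp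
qed (simp_all add: embed_L2[OF rho_nu] ell2_carrier_L2 sq_norm_embed[OF rho_nu] f g)

text \<open>For x > 0, on levels joined by an edge, this is the square root of x d_(n-1) =
  \<lambda>^2 d_n, with d_n = \<open>level_density n x\<close> and \<lambda> the weight of the
  vertex at level n over x. It holds across the branching vertex because d_0 = 1 there.\<close>

lemma embed_Lam:
  assumes f: "f \<in> hcarrier H" and x: "0 \<le> x"
  shows "of_real (sqrt x) * embed f (n - 1, x) = embed (Lam f) (n, x)"
proof (cases "x = 0")
  case True
  show ?thesis
  \<comment> \<open>Over x = 0 the density is nonzero only at level 0 of a tree without trunk edges.
    There \<open>Trunk 0\<close> is the root, and both sides vanish: one through sqrt 0, the other
    because \<open>Lam f\<close> is 0 at the root.\<close>
  proof (cases "n = 0 \<and> \<kappa> = 0")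
    case True
    then have "Trunk 0 \<notin> V0" by (simp add: trunk_in_tree_verts_nonroot_iff zero_enat_def)
    then have "Lam f (Trunk 0) = 0" by (simp add: Lam_def)
    moreover have "n = 0" using True by simp
    ultimately show ?thesis using \<open>x = 0\<close> by (simp add: embed_def level_vertex_def)
  next
    case False
    then have "level_density n 0 = 0" by (auto simp: level_density_def power_0_left)
    then show ?thesis using True by (simp add: embed_def)
  qed
next
  case False
  with x have x: "0 < x" by simp
  show ?thesis
  proof (cases "n \<le> 0")
    case True
    define k where "k = nat (- n)"
    have n: "n = - int k" "n - 1 = - int (Suc k)" using True by (simp_all add: k_def)
    show ?thesis
    proof (cases "Trunk (Suc k) \<in> V")
      case True
      have V0: "Trunk k \<in> V0" "parent \<eta> \<kappa> (Trunk k) = Trunk (Suc k)"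
        using True by (simp_all add: trunk_in_tree_verts_iff trunk_in_tree_verts_nonroot_iff Suc_ile_eq parent_trunk)
      have \<gamma>: "0 < \<gamma> (- int k)" "0 < \<gamma> (- int (Suc k))"
        using gamma_trunk_pos[OF True, of 0] gamma_trunk_pos[OF True, of 1] by simp_all
      have lam: "lam (Trunk k) = sqrt (\<gamma> (- int k) / \<gamma> (- int (Suc k)))"
        using lam_trunk_sq[OF True] lam_pos[OF V0(1)] by (metis real_sqrt_abs abs_of_pos)
      have "sqrt x * sqrt (inverse x ^ Suc k / \<gamma> (- int (Suc k))) =
          sqrt (\<gamma> (- int k) / \<gamma> (- int (Suc k))) * sqrt (inverse x ^ k / \<gamma> (- int k))"
        unfolding real_sqrt_mult[symmetric] using x \<gamma> by (simp add: field_simps)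
      then have eq: "sqrt x * sqrt (level_density (- int (Suc k)) x) = lam (Trunk k) * sqrt (level_density (- int k) x)"
        unfolding lam level_density_def using x by (simp del: of_nat_Suc)
      have "of_real (sqrt x) * embed f (n - 1, x) =
          f (Trunk (Suc k)) * of_real (sqrt x * sqrt (level_density (- int (Suc k)) x))"
        unfolding n(2) by (simp add: embed_def level_vertex_def del: of_nat_Suc)
      also have "\<dots> = embed (Lam f) (n, x)"
        unfolding n(1) eq using V0 by (simp add: embed_def level_vertex_def Lam_def del: shift_weight.simps)
      finally show ?thesis .
    next
      \<comment> \<open>No vertex sits at level n - 1, so f is 0 there, and the vertex at level n,
        if there is one, is the root.\<close>
      case False
      then have "Trunk k \<notin> V0" "f (Trunk (Suc k)) = 0"
        using f by (simp_all add: trunk_in_tree_verts_iff trunk_in_tree_verts_nonroot_iff Suc_ile_eq ell2_carrier_iff)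
      then have "embed (Lam f) (n, x) = 0"
        unfolding n(1) by (simp add: embed_def level_vertex_def Lam_def)
      moreover have "embed f (n - 1, x) = 0"
        unfolding n(2) using \<open>f (Trunk (Suc k)) = 0\<close>
        by (simp add: embed_def level_vertex_def del: of_nat_Suc)
      ultimately show ?thesis by simp
    qed
  next
    case False
    then obtain j where n: "n = int (Suc j)" by (metis not_le gr0_conv_Suc pos_int_cases)
    define i where "i = branch_index x"
    have i: "i \<in> J \<eta>" using branch_index_in(1)[OF x] by (simp add: i_def)
    have b: "0 < branch_moment i m" for m using branch_moment(2)[OF i] .
    have V0: "Branch i (Suc j) \<in> V0" using i by (simp add: branch_in_tree_verts_nonroot_iff)
    note pos = lam_pos[OF V0]
    have "of_real (sqrt x) * embed f (int j, x) =
        of_real (lam (Branch i (Suc j))) * f (parent \<eta> \<kappa> (Branch i (Suc j))) * of_real (sqrt (x ^ Suc j / branch_moment i j))"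
    proof (cases j)
      case 0
      have "lam (Branch i (Suc j)) = sqrt (branch_moment i 0)"
        using lam_branch_1_sq[OF i] pos 0 by (metis real_sqrt_abs abs_of_pos One_nat_def)
      moreover have "sqrt x = sqrt (branch_moment i 0) * sqrt (x / branch_moment i 0)"
        unfolding real_sqrt_mult[symmetric] using b[of 0] by simp
      ultimately show ?thesis
        using 0 x i by (simp add: embed_def level_vertex_def level_density_def gamma_0 parent_branch_1
            del: shift_weight.simps)
    next
      case (Suc j')
      have lam: "lam (Branch i (Suc j)) = sqrt (branch_moment i j / branch_moment i (j - 1))"
        using lam_branch_Suc_sq[OF i, of j] pos Suc by (metis real_sqrt_abs abs_of_pos le_add1 plus_1_eq_Suc)
      have eq: "sqrt x * sqrt (x ^ j / branch_moment i (j - 1)) =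
          sqrt (branch_moment i j / branch_moment i (j - 1)) * sqrt (x ^ Suc j / branch_moment i j)"
        unfolding real_sqrt_mult[symmetric] using b[of j] b[of "j - 1"] by (simp add: field_simps)
      have "of_real (sqrt x) * embed f (int j, x) =
          f (Branch i j) * of_real (sqrt x * sqrt (x ^ j / branch_moment i (j - 1)))"
        using Suc by (simp add: embed_def level_vertex_def level_density_def i_def del: of_nat_Suc)
      also have "\<dots> = of_real (lam (Branch i (Suc j))) * f (parent \<eta> \<kappa> (Branch i (Suc j))) *
          of_real (sqrt (x ^ Suc j / branch_moment i j))"
        unfolding eq lam using parent_branch_Suc[OF i, of j] Suc by simp
      finally show ?thesis .
    qed
    then show ?thesis
      using V0 by (simp add: n embed_def level_vertex_def level_density_def Lam_def i_def[symmetric] nat_add_distrib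
          del: shift_weight.simps)
  qed
qed

text \<open>\<open>subnormal\<close> wants the elements of the larger space to be sets of functions
  on vertices, so a point ((n, x), z) of a graph is stored as such a function. Its values at a
  branch vertex, at \<open>Trunk 0\<close> and at any other trunk vertex are the numbers n, x and
  z.\<close>

definition encode :: "(int \<times> real) \<times> complex \<Rightarrow> vertex \<Rightarrow> complex" where
  "encode p v = (case v of Branch i j \<Rightarrow> of_int (fst (fst p))
     | Trunk k \<Rightarrow> if k = 0 then of_real (snd (fst p)) else snd p)"

lemma inj_encode: "inj encode"
proof (rule injI)
  fix p q assume eq: "encode p = encode q"
  show "p = q"
    using fun_cong[OF eq, of "Branch 0 0"] fun_cong[OF eq, of "Trunk 0"] fun_cong[OF eq, of "Trunk 1"]
    by (simp add: encode_def prod_eq_iff)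
qed

lemma subnormal_S:
  assumes rho_nu: "\<rho> = density \<nu> ennreal"
  shows "subnormal H S"
proof -
  obtain K :: "(vertex \<Rightarrow> complex) set hspace" and cls where K: "L2_model model_space K cls"
    using exists_L2_model[OF inj_encode] by blast
  interpret model: weighted_automorphism_model model_space K cls "shift_by (-1)" "shift_by 1" "\<lambda>p. sqrt (snd p)"
    by (intro weighted_automorphism_model.intro K weighted_automorphism_model_space)
  let ?\<iota> = "\<lambda>f. cls (embed f)"
  have "isometric_embedding H K ?\<iota>"
    unfolding isometric_embedding_def
    by (auto simp: model.cls_closed embed_L2[OF rho_nu] ell2_simps embed_add embed_scale model.add
        model.scale model.inner ell2_inner L2_inner_embed[OF rho_nu])
  moreover have "model.shift_op (?\<iota> h) = Some (?\<iota> (the (S h)))" if h: "h \<in> dom S" for h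
  proof -
    have hH: "h \<in> hcarrier H" and LhH: "Lam h \<in> hcarrier H" and the: "the (S h) = Lam h"
      using h by (auto simp: S_def split: if_splits)
    have AE: "AE p in model_space. embed (Lam h) p = model.shift_fun (embed h) p"
      using embed_Lam[OF hH]
      by (intro AE_I2) (auto simp: space_model_space model.shift_fun_def shift_by_def)
    have L2: "model.shift_fun (embed h) \<in> L2 model_space"
      by (rule L2_cong_AE[OF embed_L2[OF rho_nu LhH] model.shift_fun_measurable[OF embed_measurable] AE])
    show ?thesis
      using AE L2 by (simp add: model.shift_op_cls embed_L2[OF rho_nu] hH LhH the model.cls_eq_iff eq_commute)
  qed
  ultimately show ?thesis
    unfolding subnormal_def using linear_S densely_defined_S[OF finite_moments]
      model.complex_hilbert_space model.normal_shift_op by blast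
qed

end


theorem theorem4p1p1:
  fixes \<eta> \<kappa> :: enat
    and \<gamma> :: "int \<Rightarrow> real"
    and \<nu> \<rho> :: "real measure"
    and \<Omega> :: "nat \<Rightarrow> real set"
    and V :: "vertex set"
    and H :: "(vertex \<Rightarrow> complex) hspace"
    and lam :: "vertex \<Rightarrow> real"
    and S :: "(vertex \<Rightarrow> complex) \<rightharpoonup> (vertex \<Rightarrow> complex)"
  assumes eta: "2 \<le> \<eta>"
    and gamma_pos: "\<forall>n\<in>ints_from_minus \<kappa>. 0 < \<gamma> n"
    and gamma_0: "\<gamma> 0 = 1"
    and nu: "borel_measure_nonneg \<nu>"
    and gamma_moments:
      "\<forall>n\<in>ints_from_minus \<kappa>. (\<integral>\<^sup>+x. ennreal x powi n \<partial>\<nu>) = ennreal (\<gamma> n)"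
    and rho: "S_representing (\<lambda>n. \<gamma> (int n + 1)) \<rho>"
    and rho_neg_moments: "\<forall>n\<in>J (\<kappa> + 1).
      0 < (\<integral>\<^sup>+x. 1 / ennreal x ^ n \<partial>\<rho>) \<and> (\<integral>\<^sup>+x. 1 / ennreal x ^ n \<partial>\<rho>) < \<infinity>"
    and rho_support: "case \<eta> of
        enat m \<Rightarrow> infinite (closed_support \<rho>) \<or> m \<le> card (closed_support \<rho>)
      | \<infinity> \<Rightarrow> infinite (closed_support \<rho>)"
    and Omega_borel: "\<forall>i\<in>J \<eta>. \<Omega> i \<in> sets borel"
    and Omega_disjoint: "disjoint_family_on \<Omega> (J \<eta>)"
    and Omega_pos: "\<forall>i\<in>J \<eta>. 0 < emeasure \<rho> (\<Omega> i)"
    and Omega_union: "(\<Union>i\<in>J \<eta>. \<Omega> i) = {0<..}"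
    and V: "V = tree_verts \<eta> \<kappa>"
    and H: "H = ell2 V"
    and lam: "lam = shift_weight \<gamma> \<rho> \<Omega>"
    and S: "S = weighted_shift \<eta> \<kappa> lam"
  shows
    "((\<forall>u\<in>V. basis_vec u \<in> dom_infty H S) \<and> hspan H (basis_vec ` V) \<subseteq> dom_infty H S) \<and>
     (\<forall>f\<in>dom_infty H S. Stieltjes_moment_seq (\<lambda>n. (hnorm H (the (op_power H S n f)))\<^sup>2)) \<and>
     paranormal H S \<and>
     ((\<Sum>\<^sub>\<infinity>i\<in>J \<eta>. ennreal ((lam (Branch i 1))\<^sup>2) * (\<integral>\<^sup>+x. 1 / ennreal x \<partial>branch_measure \<rho> \<Omega> i)) \<le> 1
        \<longleftrightarrow> (\<integral>\<^sup>+x. 1 / ennreal x \<partial>\<rho>) \<le> 1) \<and>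
     (hyponormal H S \<longleftrightarrow>
        (\<Sum>\<^sub>\<infinity>i\<in>J \<eta>. ennreal ((lam (Branch i 1))\<^sup>2) /
           ennreal ((hnorm H (the (S (basis_vec (Branch i 1)))))\<^sup>2)) \<le> 1) \<and>
     (\<Sum>\<^sub>\<infinity>i\<in>J \<eta>. ennreal ((lam (Branch i 1))\<^sup>2) /
        ennreal ((hnorm H (the (S (basis_vec (Branch i 1)))))\<^sup>2)) \<le> (\<integral>\<^sup>+x. 1 / ennreal x \<partial>\<rho>) \<and>
     ((\<Sum>\<^sub>\<infinity>i\<in>J \<eta>. ennreal ((lam (Branch i 1))\<^sup>2) /
         ennreal ((hnorm H (the (S (basis_vec (Branch i 1)))))\<^sup>2)) = (\<integral>\<^sup>+x. 1 / ennreal x \<partial>\<rho>)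
        \<longleftrightarrow> (\<forall>i\<in>J \<eta>. \<exists>q\<in>\<Omega> i. \<forall>\<sigma>\<in>sets borel. \<sigma> \<subseteq> {0..} \<longrightarrow>
              emeasure \<rho> (\<sigma> \<inter> \<Omega> i) = emeasure \<rho> (\<Omega> i) * indicator \<sigma> q)) \<and>
     (S_determinate (\<lambda>n. \<gamma> (int n + 1)) \<longrightarrow>
        subnormal H S \<and> (\<integral>\<^sup>+x. 1 / ennreal x \<partial>\<rho>) \<le> 1)"
proof -
  have data: "tree_data \<eta> \<kappa> \<gamma> \<nu> \<rho> \<Omega>"
  proof
    \<comment> \<open>The order 1 belongs to \<open>J (\<kappa> + 1)\<close> even for \<kappa> = 0,
      so the integral of 1/x is always finite.\<close>
    have "enat 1 \<le> \<kappa> + 1" unfolding one_enat_def[symmetric] by simp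
    then have "1 \<in> J (\<kappa> + 1)" by (simp add: J_def)
    then show "(\<integral>\<^sup>+x. 1 / ennreal x \<partial>\<rho>) < \<infinity>" using rho_neg_moments by fastforce
  qed (use assms in auto)
  interpret tree_data \<eta> \<kappa> \<gamma> \<nu> \<rho> \<Omega> by (rule data)
  have H_eq: "H = ell2 (tree_verts \<eta> \<kappa>)" by (simp add: H V)
  have S_eq: "S = weighted_forest.S (tree_verts \<eta> \<kappa>) (tree_verts_nonroot \<eta> \<kappa>) (parent \<eta> \<kappa>)
      (shift_weight \<gamma> \<rho> \<Omega>)"
    by (simp only: S lam weighted_shift_eq)
  have subnormal: "S_determinate (\<lambda>n. \<gamma> (int n + 1)) \<longrightarrow>
      subnormal H S \<and> (\<integral>\<^sup>+x. 1 / ennreal x \<partial>\<rho>) \<le> 1"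
    unfolding H_eq S_eq using subnormal_S[OF determinate_rho] determinate_inverse_moment by blast
  show ?thesis
    unfolding V lam H_eq S_eq consistency_sum branch_sum_def[symmetric]
  proof (intro conjI ballI)
    show "basis_vec u \<in> dom_infty (ell2 (tree_verts \<eta> \<kappa>)) local.S" if "u \<in> tree_verts \<eta> \<kappa>" for u
      by (rule basis_vec_dom_infty[OF that finite_moments[OF that]])
    show "hspan (ell2 (tree_verts \<eta> \<kappa>)) (basis_vec ` tree_verts \<eta> \<kappa>) \<subseteq> dom_infty (ell2 (tree_verts \<eta> \<kappa>)) local.S"
      using finite_moments by (rule hspan_dom_infty)
    show "branch_sum \<le> (\<integral>\<^sup>+x. 1 / ennreal x \<partial>\<rho>)" by (simp add: inverse_moment_eq)
  qed (use Stieltjes_norm_powers paranormal hyponormal_iff_child_sum child_sum_trunk_0 branch_sum_eq_iff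
      subnormal in \<open>simp_all add: H_eq S_eq\<close>)
qed

end
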